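(* Let $2 \le n \le 8$ and let $(X,w)$ be a tight Euclidean $6$-design in $\mathbb{R}^n$ supported by two concentric spheres (i.e. $|\{\|\mathbf{x}\| : \mathbf{x}\in X\}| = 2$). Then $n = 2$ and, up to an orthogonal transformation of $\mathbb{R}^2$ and multiplication of $w$ by a positive constant, $(X,w)$ is the following design: writing $r_1, r_2$ for the two (distinct, positive) radii, $$X=\left\{ b_{kj}=\left(r_k\cos\left(\tfrac{2j+k}{5}\pi\right),\ r_k\sin\left(\tfrac{2j+k}{5}\pi\right)\right) : 1\le j\le 5,\ 1\le k\le 2\right\},$$ with weight function $w(b_{kj}) = \dfrac{1}{r_k^{5}}$ for $k=1,2$.
   Context: Let $X\subseteq\mathbb{R}^n$ ($n\ge 2$) be a finite nonempty set with a weight function $w:X\to\mathbb{R}_{>0}$. Let $\{r_1,\dots,r_p\}=\{\|\mathbf{x}\|:\mathbf{x}\in X\}$ (Euclidean norm; some $r_i$ may be $0$), let $S_i=\{\mathbf{x}\in\mathbb{R}^n:\|\mathbf{x}\|=r_i\}$ (so $S_i=\{\mathbf{0}\}$ if $r_i=0$), $X_i=X\cap S_i$, $w(X_i)=\sum_{\mathbf{x}\in X_i}w(\mathbf{x})$, and $S=\bigcup_{i=1}^p S_i$; $X$ is said to be supported by the $p$ concentric spheres $S_1,\dots,S_p$. Let $\sigma_i$ be the $O(n)$-invariant measure on $S_i$ normalized so that its total mass is $|S_i| = r_i^{n-1}|S^{n-1}|$, where $|S^{n-1}|$ is the surface area of the unit sphere; for $r_i=0$ one sets $\frac{1}{|S_i|}\int_{S_i}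 f\,d\sigma_i := f(\mathbf{0})$. $(X,w)$ is a Euclidean $t$-design if $\sum_{i=1}^p \frac{w(X_i)}{|S_i|}\int_{S_i} f(\mathbf{x})\,d\sigma_i(\mathbf{x}) = \sum_{\mathbf{x}\in X} w(\mathbf{x})f(\mathbf{x})$ for every real polynomial $f$ in $n$ variables of degree at most $t$. Let $\mathrm{Pol}_e(S)$ denote the vector space of restrictions to $S$ of real polynomials in $n$ variables of degree at most $e$, and $\mathrm{Pol}_e(\mathbb{R}^n)$ the space of all such polynomials (dimension $\binom{n+e}{e}$). A Euclidean $2e$-design $(X,w)$ supported by $S$ is called a tight Euclidean $2e$-design if $|X| = \dim \mathrm{Pol}_e(S) = \dim\mathrm{Pol}_e(\mathbb{R}^n)$; for $e=3$ this means $|X|=\binom{n+3}{3}$. *)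

theory Defs
  imports "HOL-Analysis.Analysis" "HOL-Library.Function_Algebras"
begin

section \<open>Integration over spheres\<close>

text \<open>The \<open>(n-1)\<close>-dimensional area of the sphere of radius \<open>r\<close> in \<open>n\<close>-space. The factor
  \<open>n * unit_ball_vol n = 2 * pi powr (n/2) / Gamma (n/2)\<close> is the area of the unit sphere.\<close>

definition sphere_area :: "nat \<Rightarrow> real \<Rightarrow> real" where
  "sphere_area n r = r ^ (n - 1) * (real n * unit_ball_vol (real n))"

definition is_sphere_measure :: "real \<Rightarrow> (real^'n) measure \<Rightarrow> bool" where
  "is_sphere_measure r \<sigma> \<longleftrightarrow>
     sets \<sigma> = sets (restrict_space borel (sphere 0 r)) \<and>
     (\<forall>T A. orthogonal_transformation T \<and> A \<in> sets \<sigma> \<longrightarrow> emeasure \<sigma> (T ` A) = emeasure \<sigma> A) \<and>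
     emeasure \<sigma> (sphere 0 r) = ennreal (sphere_area CARD('n) r)"

text \<open>Existence and uniqueness for \<open>r > 0\<close> are shown in \<open>ex1_sphere_measure\<close> below.\<close>

definition sphere_measure :: "real \<Rightarrow> (real^'n) measure" where
  "sphere_measure r = (THE \<sigma>. is_sphere_measure r \<sigma>)"

definition sphere_mean :: "real \<Rightarrow> (real^'n \<Rightarrow> real) \<Rightarrow> real" where
  "sphere_mean r f =
     (if r = 0 then f 0
      else 1 / sphere_area CARD('n) r * (\<integral>x. f x \<partial>sphere_measure r))"


section \<open>Polynomial functions\<close>

text \<open>Polynomials are identified with the functions they induce (the field is infinite); an
  exponent vector is a map \<open>'n \<Rightarrow> nat\<close>.\<close>

definition exponents_le :: "nat \<Rightarrow> ('n::finite \<Rightarrow> nat) set" where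
  "exponents_le t = {\<alpha>. (\<Sum>i\<in>UNIV. \<alpha> i) \<le> t}"

definition Pol :: "nat \<Rightarrow> (real^'n \<Rightarrow> real) set" where
  "Pol t = {f. \<exists>c. f = (\<lambda>x. \<Sum>\<alpha>\<in>exponents_le t. c \<alpha> * (\<Prod>i\<in>UNIV. (x $ i) ^ \<alpha> i))}"

text \<open>A function on \<open>S\<close> is represented by its extension by zero to the whole space, which is
  compatible with the pointwise vector space operations.\<close>

definition Pol_on :: "nat \<Rightarrow> (real^'n) set \<Rightarrow> (real^'n \<Rightarrow> real) set" where
  "Pol_on t S = (\<lambda>f x. if x \<in> S then f x else 0) ` Pol t"

definition fun_dim :: "('a \<Rightarrow> real) set \<Rightarrow> nat" where
  "fun_dim V = vector_space.dim (\<lambda>c f x. c * f x) V"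


section \<open>Euclidean designs\<close>

text \<open>Only the values of the weight function on \<open>X\<close> matter.\<close>

definition euclidean_design :: "nat \<Rightarrow> (real^'n) set \<Rightarrow> (real^'n \<Rightarrow> real) \<Rightarrow> bool" where
  "euclidean_design t X w \<longleftrightarrow>
     finite X \<and> X \<noteq> {} \<and> (\<forall>x\<in>X. w x > 0) \<and>
     (\<forall>f\<in>Pol t. (\<Sum>r\<in>norm ` X. (\<Sum>x\<in>X \<inter> sphere 0 r. w x) * sphere_mean r f) = (\<Sum>x\<in>X. w x * f x))"

definition support_spheres :: "(real^'n) set \<Rightarrow> (real^'n) set" where
  "support_spheres X = (\<Union>r\<in>norm ` X. sphere 0 r)"

definition tight_euclidean_design :: "nat \<Rightarrow> (real^'n) set \<Rightarrow> (real^'n \<Rightarrow> real) \<Rightarrow> bool" where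
  "tight_euclidean_design e X w \<longleftrightarrow>
     euclidean_design (2 * e) X w \<and>
     card X = fun_dim (Pol_on e (support_spheres X)) \<and>
     fun_dim (Pol_on e (support_spheres X)) = fun_dim (Pol e :: (real^'n \<Rightarrow> real) set)"

text \<open>In the plane, with \<open>a\<close> and \<open>b\<close> the first and the second coordinate.\<close>

definition pentagon_point :: "'n \<Rightarrow> 'n \<Rightarrow> (nat \<Rightarrow> real) \<Rightarrow> nat \<Rightarrow> nat \<Rightarrow> real^'n" where
  "pentagon_point a b r k j =
     axis a (r k * cos (real (2 * j + k) / 5 * pi)) + axis b (r k * sin (real (2 * j + k) / 5 * pi))"


section \<open>Well-definedness\<close>

lemma finite_exponents_le: "finite (exponents_le t :: ('n::finite \<Rightarrow> nat) set)"
proof (rule finite_subset)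
  show "exponents_le t \<subseteq> (PiE UNIV (\<lambda>_. {..t}) :: ('n \<Rightarrow> nat) set)"
  proof
    fix \<alpha> :: "'n \<Rightarrow> nat" assume "\<alpha> \<in> exponents_le t"
    then have "\<alpha> i \<le> t" for i
      using member_le_sum[of i UNIV \<alpha>] by (auto simp: exponents_le_def intro: order_trans)
    then show "\<alpha> \<in> PiE UNIV (\<lambda>_. {..t})" by auto
  qed
qed (auto intro!: finite_PiE)

lemma vector_space_fun: "vector_space (\<lambda>(c::real) f (x::'a). c * f x)"
  by unfold_locales (auto simp: fun_eq_iff algebra_simps)

lemma sphere_area_pos: "n > 0 \<Longrightarrow> r > 0 \<Longrightarrow> sphere_area n r > 0"
  unfolding sphere_area_def by (intro mult_pos_pos) auto

lemma nn_integral_dist_ball: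
  fixes M :: "'a::euclidean_space measure"
  assumes sM: "sets M = sets borel"
  shows "(\<integral>\<^sup>+x. indicator {..<e} (dist x y) \<partial>M) = emeasure M (ball y e)"
    and "(\<integral>\<^sup>+x. indicator {..<e} (dist y x) \<partial>M) = emeasure M (ball y e)"
proof -
  have ind: "indicator {..<e} (dist x y) = (indicator (ball y e) x :: ennreal)"
    "indicator {..<e} (dist y x) = (indicator (ball y e) x :: ennreal)" for x
    by (simp_all add: indicator_def dist_commute)
  show "(\<integral>\<^sup>+x. indicator {..<e} (dist x y) \<partial>M) = emeasure M (ball y e)"
    "(\<integral>\<^sup>+x. indicator {..<e} (dist y x) \<partial>M) = emeasure M (ball y e)"
    unfolding ind by (simp_all add: nn_integral_indicator sM)
qed

text \<open>Two measures that assign a common value to all balls of equal radius centred in their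
  support agree on open sets.\<close>

lemma emeasure_le_of_uniform:
  fixes M N :: "'a::euclidean_space measure"
  assumes sM[measurable_cong]: "sets M = sets borel" and sN[measurable_cong]: "sets N = sets borel"
    and fM: "sigma_finite_measure M" and fN: "sigma_finite_measure N"
    and g: "\<And>y e. y \<in> S \<Longrightarrow> emeasure M (ball y e) = g e"
    and h: "\<And>y e. y \<in> S \<Longrightarrow> emeasure N (ball y e) = g e"
    and zM: "AE x in M. x \<in> S" and zN: "AE x in N. x \<in> S"
    and gfin: "\<And>e. g e \<noteq> \<infinity>"
    and pos: "\<And>e. e > 0 \<Longrightarrow> g e \<noteq> 0"
    and U: "open U"
  shows "emeasure M U \<le> emeasure N U"
proof -
  interpret M: sigma_finite_measure M by fact
  interpret N: sigma_finite_measure N by fact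
  interpret P: pair_sigma_finite M N ..
  have [measurable]: "U \<in> sets borel" using U by auto
  define d where "d k = inverse (real (Suc k))" for k
  have dpos: "d k > 0" for k by (simp add: d_def)
  define W where "W k x = (\<integral>\<^sup>+y. indicator U y * indicator {..<d k} (dist x y) \<partial>N)" for k x
  have Wm[measurable]: "W k \<in> borel_measurable M" for k
    unfolding W_def by measurable
  have lim: "indicator U x \<le> liminf (\<lambda>k. W k x / g (d k))" if x: "x \<in> S" for x
  proof (cases "x \<in> U")
    case True
    then obtain e where e: "e > 0" "ball x e \<subseteq> U" using U open_contains_ball by blast
    have "eventually (\<lambda>k. d k < e) sequentially"
      using LIMSEQ_inverse_real_of_nat e(1) unfolding d_def by (rule order_tendstoD)
    then have "eventually (\<lambda>k. 1 \<le> W k x / g (d k)) sequentially"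
    proof eventually_elim
      case (elim k)
      have "indicator U y * indicator {..<d k} (dist x y) = (indicator {..<d k} (dist x y) :: ennreal)" for y
        using e(2) elim by (auto simp: indicator_def subset_iff)
      then have "W k x = g (d k)"
        by (simp add: W_def nn_integral_dist_ball[OF sN] h[OF x])
      then show ?case using pos[OF dpos[of k]] gfin[of "d k"]
        by (simp add: ennreal_divide_self less_top)
    qed
    then have "1 \<le> liminf (\<lambda>k. W k x / g (d k))" by (rule Liminf_bounded)
    then show ?thesis using True by simp
  qed simp
  have int_u: "(\<integral>\<^sup>+x. W k x / g (d k) \<partial>M) \<le> emeasure N U" for k
  proof -
    have "(\<integral>\<^sup>+x. W k x / g (d k) \<partial>M) = (\<integral>\<^sup>+x. W k x \<partial>M) / g (d k)"
      by (intro nn_integral_divide) measurable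
    also have "(\<integral>\<^sup>+x. W k x \<partial>M) =
        (\<integral>\<^sup>+y. (\<integral>\<^sup>+x. indicator U y * indicator {..<d k} (dist x y) \<partial>M) \<partial>N)"
      unfolding W_def by (rule P.Fubini'[symmetric]) measurable
    also have "\<dots> = (\<integral>\<^sup>+y. indicator U y * emeasure M (ball y (d k)) \<partial>N)"
    proof (rule nn_integral_cong)
      fix y
      have "(\<integral>\<^sup>+x. indicator U y * indicator {..<d k} (dist x y) \<partial>M) =
          indicator U y * (\<integral>\<^sup>+x. indicator {..<d k} (dist x y) \<partial>M)"
        by (rule nn_integral_cmult) measurable
      then show "(\<integral>\<^sup>+x. indicator U y * indicator {..<d k} (dist x y) \<partial>M) =
          indicator U y * emeasure M (ball y (d k))"
        by (simp only: nn_integral_dist_ball[OF sM])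
    qed
    also have "\<dots> = (\<integral>\<^sup>+y. g (d k) * indicator U y \<partial>N)"
      using zN by (intro nn_integral_cong_AE) (auto simp: g mult.commute)
    also have "\<dots> = g (d k) * emeasure N U"
      by (rule nn_integral_cmult_indicator) measurable
    also have "\<dots> / g (d k) = emeasure N U"
      using pos[OF dpos[of k]] gfin[of "d k"]
      by (simp add: mult.commute[of "g (d k)"] ennreal_times_divide[symmetric] ennreal_divide_self less_top)
    finally show ?thesis by simp
  qed
  have "emeasure M U = (\<integral>\<^sup>+x. indicator U x \<partial>M)" by simp
  also have "\<dots> \<le> (\<integral>\<^sup>+x. liminf (\<lambda>k. W k x / g (d k)) \<partial>M)"
    using zM by (intro nn_integral_mono_AE) (auto simp: lim)
  also have "\<dots> \<le> liminf (\<lambda>k. \<integral>\<^sup>+x. W k x / g (d k) \<partial>M)"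
    by (rule nn_integral_liminf) measurable
  also have "\<dots> \<le> liminf (\<lambda>k::nat. emeasure N U)"
    by (intro Liminf_mono always_eventually allI int_u)
  also have "\<dots> = emeasure N U" by (simp add: Liminf_const)
  finally show ?thesis .
qed

lemma measure_eqI_uniform:
  fixes M N :: "'a::euclidean_space measure"
  assumes sM: "sets M = sets borel" and sN: "sets N = sets borel"
    and g: "\<And>y e. y \<in> S \<Longrightarrow> emeasure M (ball y e) = g e"
    and h: "\<And>y e. y \<in> S \<Longrightarrow> emeasure N (ball y e) = g e"
    and zM: "AE x in M. x \<in> S" and zN: "AE x in N. x \<in> S"
    and gfin: "\<And>e. g e \<noteq> \<infinity>"
    and pos: "\<And>e. e > 0 \<Longrightarrow> g e \<noteq> 0"
    and bM: "\<And>e. emeasure M (ball 0 e) \<noteq> \<infinity>" and bN: "\<And>e. emeasure N (ball 0 e) \<noteq> \<infinity>"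
  shows "M = N"
proof -
  have spM: "space M = UNIV" and spN: "space N = UNIV"
    using sets_eq_imp_space_eq[OF sM] sets_eq_imp_space_eq[OF sN] by simp_all
  have un: "(\<Union>i. ball 0 (real i)) = (UNIV :: 'a set)"
  proof -
    have "\<exists>i. x \<in> ball 0 (real i)" for x :: 'a
      using reals_Archimedean2[of "norm x"] by auto
    then show ?thesis by blast
  qed
  have sf: "sigma_finite_measure L"
    if "sets L = sets borel" "space L = UNIV" "\<And>e. emeasure L (ball 0 e) \<noteq> \<infinity>" for L :: "'a measure"
  proof
    show "\<exists>A. countable A \<and> A \<subseteq> sets L \<and> \<Union> A = space L \<and> (\<forall>a\<in>A. emeasure L a \<noteq> \<infinity>)"
      using that un by (intro exI[of _ "range (\<lambda>i::nat. ball 0 (real i))"]) auto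
  qed
  have eq: "emeasure M U = emeasure N U" if "open U" for U
    using emeasure_le_of_uniform[OF sM sN sf[OF sM spM bM] sf[OF sN spN bN] g h zM zN gfin pos that]
      emeasure_le_of_uniform[OF sN sM sf[OF sN spN bN] sf[OF sM spM bM] h g zN zM gfin pos that]
    by (rule antisym)
  have b: "sets (borel :: 'a measure) = sigma_sets UNIV {U. open U}"
    unfolding borel_def by (rule sets_measure_of) simp
  show ?thesis
  proof (rule measure_eqI_generator_eq[where E = "{U. open U}" and \<Omega> = UNIV and A = "\<lambda>i. ball 0 (real i)"])
    show "sets M = sigma_sets UNIV {U. open U}" "sets N = sigma_sets UNIV {U. open U}"
      using sM sN b by simp_all
    show "(\<Union>i. ball 0 (real i)) = (UNIV :: 'a set)" by (rule un)
    show "emeasure M (ball 0 (real i)) \<noteq> \<infinity>" for i by (rule bM)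
  qed (auto simp: Int_stable_def eq)
qed

lemma uniform_ball_values_eq:
  fixes M N :: "'a::euclidean_space measure"
  assumes sM[measurable_cong]: "sets M = sets borel" and sN[measurable_cong]: "sets N = sets borel"
    and fM: "finite_measure M" and fN: "finite_measure N"
    and g: "\<And>y. y \<in> S \<Longrightarrow> emeasure M (ball y e) = g"
    and h: "\<And>y. y \<in> S \<Longrightarrow> emeasure N (ball y e) = h"
    and zM: "AE x in M. x \<in> S" and zN: "AE x in N. x \<in> S"
    and tot: "emeasure M UNIV = m" "emeasure N UNIV = m" and m0: "m \<noteq> 0"
  shows "g = h"
proof -
  interpret M: finite_measure M by fact
  interpret N: finite_measure N by fact
  interpret P: pair_sigma_finite M N ..
  have spM: "space M = UNIV" and spN: "space N = UNIV"
    using sets_eq_imp_space_eq[OF sM] sets_eq_imp_space_eq[OF sN] by simp_all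
  have mfin: "m \<noteq> \<infinity>" using tot(1) M.emeasure_finite[of UNIV] by simp
  have "(\<integral>\<^sup>+y. \<integral>\<^sup>+x. indicator {..<e} (dist x y) \<partial>M \<partial>N) =
      (\<integral>\<^sup>+x. \<integral>\<^sup>+y. indicator {..<e} (dist x y) \<partial>N \<partial>M)"
    by (rule P.Fubini') measurable
  then have "(\<integral>\<^sup>+y. emeasure M (ball y e) \<partial>N) = (\<integral>\<^sup>+y. emeasure N (ball y e) \<partial>M)"
    by (simp only: nn_integral_dist_ball[OF sM] nn_integral_dist_ball[OF sN])
  moreover have "(\<integral>\<^sup>+y. emeasure M (ball y e) \<partial>N) = (\<integral>\<^sup>+y. g \<partial>N)"
    using zN by (intro nn_integral_cong_AE) (auto simp: g)
  moreover have "(\<integral>\<^sup>+y. emeasure N (ball y e) \<partial>M) = (\<integral>\<^sup>+y. h \<partial>M)"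
    using zM by (intro nn_integral_cong_AE) (auto simp: h)
  ultimately have "g * m = h * m"
    using tot by (simp add: spM spN)
  then have "m * g = m * h" by (simp add: mult.commute)
  then show ?thesis using m0 mfin by (simp add: ennreal_mult_cancel_left)
qed

lemma orthogonal_transformation_dist:
  assumes T: "orthogonal_transformation T"
  shows "dist (T x) (T y) = dist x y"
proof -
  have "T x - T y = T (x - y)"
    using linear_diff[OF orthogonal_transformation_linear[OF T], of x y] by simp
  then show ?thesis by (simp only: dist_norm orthogonal_transformation_norm[OF T])
qed

lemma emeasure_lborel_orthogonal_image:
  fixes T :: "real^'n \<Rightarrow> real^'n"
  assumes T: "orthogonal_transformation T" and C: "C \<in> sets borel"
  shows "T ` C \<in> sets borel" and "emeasure lborel (T ` C) = emeasure lborel C"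
proof -
  define T' where "T' = inv T"
  have T': "orthogonal_transformation T'"
    unfolding T'_def by (rule orthogonal_transformation_inv[OF T])
  have inv: "T (T' x) = x" "T' (T x) = x" for x
    using orthogonal_transformation_bij[OF T] unfolding T'_def
    by (simp_all add: bij_is_surj surj_f_inv_f bij_is_inj inv_f_f)
  have im: "T ` A = T' -` A" for A using inv by (auto simp: image_iff) metis
  have m: "T' \<in> borel_measurable borel"
    using T' by (intro borel_measurable_continuous_onI linear_continuous_on)
       (simp add: orthogonal_transformation_linear linear_linear)
  show "T ` C \<in> sets borel" using measurable_sets[OF m C] by (simp add: im)
  have d: "dist (T' u) v = dist u (T v)" for u v
    using orthogonal_transformation_dist[OF T, of "T' u" v] by (simp only: inv)
  have pre: "T' -` ball y e = ball (T y) e" for y e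
    unfolding vimage_def ball_def mem_Collect_eq dist_commute[of y] dist_commute[of "T y"] d ..
  have b: "emeasure lborel (ball y e) = emeasure lborel (ball (0::real^'n) e)" for y :: "real^'n" and e
    by (cases "e \<ge> 0") (simp_all add: emeasure_ball ball_empty)
  have "distr lborel borel T' = (lborel :: (real^'n) measure)"
  proof (rule measure_eqI_uniform[where S = UNIV and g = "\<lambda>e. emeasure lborel (ball (0::real^'n) e)"])
    show "emeasure (distr lborel borel T') (ball y e) = emeasure lborel (ball (0::real^'n) e)" for y e
      using m b[of "T y" e] by (simp add: emeasure_distr pre)
    then show "emeasure (distr lborel borel T') (ball 0 e) \<noteq> \<infinity>" for e
      using emeasure_lborel_ball_finite[of "0::real^'n" e] by simp
    show "emeasure lborel (ball (0::real^'n) e) \<noteq> 0" if "e > 0" for e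
      using that by (simp add: emeasure_ball ennreal_eq_0_iff not_le)
    show "emeasure lborel (ball (0::real^'n) e) \<noteq> \<infinity>"
      "emeasure lborel (ball (0::real^'n) e) \<noteq> \<infinity>" for e
      using emeasure_lborel_ball_finite[of "0::real^'n" e] by simp_all
    show "emeasure lborel (ball y e) = emeasure lborel (ball (0::real^'n) e)" for y :: "real^'n" and e
      by (rule b)
  qed simp_all
  then have "emeasure lborel C = emeasure (distr lborel borel T') C" by simp
  also have "\<dots> = emeasure lborel (T ` C)" using m C by (simp add: emeasure_distr im)
  finally show "emeasure lborel (T ` C) = emeasure lborel C" by simp
qed

lemma orthogonal_image_ball:
  fixes T :: "real^'n \<Rightarrow> real^'n"
  assumes T: "orthogonal_transformation T"
  shows "T ` (ball y e \<inter> sphere 0 r) = ball (T y) e \<inter> sphere 0 r"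
proof -
  note d = orthogonal_transformation_dist[OF T]
  show ?thesis
  proof
    show "T ` (ball y e \<inter> sphere 0 r) \<subseteq> ball (T y) e \<inter> sphere 0 r"
      using T by (auto simp: d orthogonal_transformation_norm)
    show "ball (T y) e \<inter> sphere 0 r \<subseteq> T ` (ball y e \<inter> sphere 0 r)"
    proof
      fix z assume z: "z \<in> ball (T y) e \<inter> sphere 0 r"
      obtain x where x: "z = T x" using orthogonal_transformation_surj[OF T] by (metis surjD)
      with z show "z \<in> T ` (ball y e \<inter> sphere 0 r)"
        using T by (auto simp: d orthogonal_transformation_norm)
    qed
  qed
qed

lemma sphere_measure_extension:
  fixes \<sigma> :: "(real^'n) measure"
  assumes \<sigma>: "is_sphere_measure r \<sigma>" and r: "r > 0"
  defines "M \<equiv> distr \<sigma> borel (\<lambda>x. x)"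
  shows "sets M = sets borel" and "finite_measure M" and "AE x in M. x \<in> sphere 0 r"
    and "\<And>A. A \<in> sets borel \<Longrightarrow> emeasure M A = emeasure \<sigma> (A \<inter> sphere 0 r)"
    and "emeasure M UNIV = ennreal (sphere_area CARD('n) r)"
    and "\<And>x y e. x \<in> sphere 0 r \<Longrightarrow> y \<in> sphere 0 r \<Longrightarrow> emeasure M (ball x e) = emeasure M (ball y e)"
    and "\<And>x e. x \<in> sphere 0 r \<Longrightarrow> e > 0 \<Longrightarrow> emeasure M (ball x e) \<noteq> 0"
proof -
  have s\<sigma>: "sets \<sigma> = sets (restrict_space borel (sphere 0 r))"
    using \<sigma> by (simp add: is_sphere_measure_def)
  have sp: "space \<sigma> = sphere 0 r"
    using sets_eq_imp_space_eq[OF s\<sigma>] by (simp add: space_restrict_space)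
  have id: "(\<lambda>x. x) \<in> measurable \<sigma> borel"
    by (subst measurable_cong_sets[OF s\<sigma> refl]) (rule measurable_restrict_space1, simp)
  show sM: "sets M = sets borel" by (simp add: M_def)
  show em: "emeasure M A = emeasure \<sigma> (A \<inter> sphere 0 r)" if "A \<in> sets borel" for A
    using that by (simp add: M_def emeasure_distr[OF id] sp)
  show tot: "emeasure M UNIV = ennreal (sphere_area CARD('n) r)"
    using \<sigma> by (simp add: em is_sphere_measure_def)
  have spM: "space M = UNIV" by (simp add: M_def)
  show "finite_measure M"
    by (rule finite_measureI) (simp add: spM tot)
  show "AE x in M. x \<in> sphere 0 r"
  proof (rule AE_I)
    show "{x \<in> space M. x \<notin> sphere 0 r} \<subseteq> - sphere 0 r" by auto
    show "emeasure M (- sphere 0 r) = 0" by (subst em) auto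
    show "- sphere 0 r \<in> sets M" by (simp add: sM)
  qed
  show inv: "emeasure M (ball x e) = emeasure M (ball y e)"
    if xy: "x \<in> sphere 0 r" "y \<in> sphere 0 r" for x y e
  proof -
    have "norm y = norm x" using xy by simp
    then obtain T where T: "orthogonal_transformation T" "T y = x"
      by (rule orthogonal_transformation_exists)
    have "ball y e \<inter> sphere 0 r \<in> sets \<sigma>"
      unfolding s\<sigma> by (subst sets_restrict_space_iff) auto
    then have "emeasure \<sigma> (T ` (ball y e \<inter> sphere 0 r)) = emeasure \<sigma> (ball y e \<inter> sphere 0 r)"
      using \<sigma> T(1) by (auto simp: is_sphere_measure_def)
    then show ?thesis using orthogonal_image_ball[OF T(1), of y e r] T(2) by (simp add: em)
  qed
  show "emeasure M (ball x e) \<noteq> 0" if x: "x \<in> sphere 0 r" and e: "e > 0" for x e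
  proof
    assume 0: "emeasure M (ball x e) = 0"
    have "compact (sphere (0::real^'n) r)" by simp
    moreover have "open (ball y e)" if "y \<in> sphere 0 r" for y :: "real^'n" by simp
    moreover have "sphere (0::real^'n) r \<subseteq> (\<Union>y\<in>sphere 0 r. ball y e)"
      using e by (auto simp del: mem_sphere_0)
    ultimately obtain D where D: "D \<subseteq> sphere (0::real^'n) r" "finite D" "sphere 0 r \<subseteq> (\<Union>y\<in>D. ball y e)"
      by (rule compactE_image)
    have "emeasure M (\<Union>y\<in>D. ball y e) \<le> (\<Sum>y\<in>D. emeasure M (ball y e))"
      using D(2) by (intro emeasure_subadditive_finite) (auto simp: sM)
    also have "\<dots> = 0" using D(1) inv[OF _ x] 0 by (auto intro!: sum.neutral)
    finally have "emeasure M (\<Union>y\<in>D. ball y e) = 0" by simp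
    moreover have "emeasure M (sphere 0 r) \<le> emeasure M (\<Union>y\<in>D. ball y e)"
      using D(3) by (intro emeasure_mono) (simp_all add: sM borel_open open_UN)
    moreover have "emeasure M (sphere 0 r) = ennreal (sphere_area CARD('n) r)"
      using tot by (simp add: em)
    ultimately show False using sphere_area_pos[of "CARD('n)" r] r
      by (simp add: ennreal_eq_0_iff)
  qed
qed

lemma is_sphere_measure_unique:
  fixes \<mu> \<nu> :: "(real^'n) measure"
  assumes \<mu>: "is_sphere_measure r \<mu>" and \<nu>: "is_sphere_measure r \<nu>" and r: "r > 0"
  shows "\<mu> = \<nu>"
proof -
  define M where "M = distr \<mu> borel (\<lambda>x. x)"
  define N where "N = distr \<nu> borel (\<lambda>x. x)"
  note ext\<mu> = sphere_measure_extension[OF \<mu> r, folded M_def]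
  note ext\<nu> = sphere_measure_extension[OF \<nu> r, folded N_def]
  obtain p :: "real^'n" where p: "p \<in> sphere 0 r"
    using r by (metis mem_sphere_0 vector_choose_size less_imp_le)
  have m0: "ennreal (sphere_area CARD('n) r) \<noteq> 0"
    using sphere_area_pos[of "CARD('n)" r] r by (simp add: ennreal_eq_0_iff)
  have fin: "emeasure M A \<noteq> \<infinity>" "emeasure N A \<noteq> \<infinity>" for A
    using finite_measure.emeasure_finite[OF ext\<mu>(2)] finite_measure.emeasure_finite[OF ext\<nu>(2)] by auto
  have gh: "emeasure M (ball p e) = emeasure N (ball p e)" for e
    by (rule uniform_ball_values_eq[OF ext\<mu>(1) ext\<nu>(1) ext\<mu>(2) ext\<nu>(2) ext\<mu>(6)[OF _ p] ext\<nu>(6)[OF _ p]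
          ext\<mu>(3) ext\<nu>(3) ext\<mu>(5) ext\<nu>(5) m0])
  have MN: "M = N"
    by (rule measure_eqI_uniform[OF ext\<mu>(1) ext\<nu>(1) ext\<mu>(6)[OF _ p] ext\<nu>(6)[OF _ p, folded gh]
          ext\<mu>(3) ext\<nu>(3) fin(1) ext\<mu>(7)[OF p] fin])
  show ?thesis
  proof (rule measure_eqI)
    show "sets \<mu> = sets \<nu>" using \<mu> \<nu> by (simp add: is_sphere_measure_def)
    fix A assume "A \<in> sets \<mu>"
    then have "A \<in> sets (restrict_space borel (sphere 0 r))" using \<mu> by (simp add: is_sphere_measure_def)
    then have "A \<in> sets borel" "A \<inter> sphere 0 r = A"
      by (subst (asm) sets_restrict_space_iff; auto)+
    then show "emeasure \<mu> A = emeasure \<nu> A" using ext\<mu>(4)[of A] ext\<nu>(4)[of A] MN by simp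
  qed
qed

text \<open>Existence: the image of Lebesgue measure on the punctured unit ball under radial projection,
  suitably scaled.\<close>

lemma is_sphere_measure_exists:
  assumes r: "r > 0"
  shows "\<exists>\<sigma> :: (real^'n) measure. is_sphere_measure r \<sigma>"
proof -
  define B :: "(real^'n) set" where "B = cball 0 1 - {0}"
  define p :: "real^'n \<Rightarrow> real^'n" where "p x = (r / norm x) *\<^sub>R x" for x
  define K where "K = ennreal (real CARD('n) * r ^ (CARD('n) - 1))"
  define L where "L = restrict_space lborel B"
  define \<sigma> where "\<sigma> = scale_measure K (distr L (restrict_space borel (sphere 0 r)) p)"
  have Bm: "B \<in> sets borel" by (simp add: B_def)
  have pB: "p x \<in> sphere 0 r" if "x \<in> B" for x
    using that r by (auto simp: p_def B_def)
  have pm[measurable]: "p \<in> borel_measurable borel" unfolding p_def by measurable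
  have pmeas: "p \<in> measurable L (restrict_space borel (sphere 0 r))"
    unfolding L_def using pB
    by (intro measurable_restrict_space2 measurable_restrict_space1)
       (auto simp: space_restrict_space)
  have s\<sigma>: "sets \<sigma> = sets (restrict_space borel (sphere 0 r))" by (simp add: \<sigma>_def)
  have em: "emeasure \<sigma> A = K * emeasure lborel (p -` A \<inter> B)" if "A \<in> sets \<sigma>" for A
  proof -
    have "emeasure \<sigma> A = K * emeasure L (p -` A \<inter> space L)"
      using that by (simp add: \<sigma>_def emeasure_distr[OF pmeas])
    also have "space L = B" by (simp add: L_def space_restrict_space)
    also have "emeasure L (p -` A \<inter> B) = emeasure lborel (p -` A \<inter> B)"
      unfolding L_def using Bm by (intro emeasure_restrict_space) auto
    finally show ?thesis .
  qed
  have pre: "p -` A \<inter> B \<in> sets borel" if "A \<in> sets \<sigma>" for A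
  proof -
    have "A \<in> sets borel" using that unfolding s\<sigma> by (subst (asm) sets_restrict_space_iff) auto
    then show ?thesis using Bm measurable_sets[OF pm, of A] by auto
  qed
  have inv: "emeasure \<sigma> (T ` A) = emeasure \<sigma> A"
    if T: "orthogonal_transformation T" and A: "A \<in> sets \<sigma>" for T A
  proof -
    have bT: "bij T" by (rule orthogonal_transformation_bij[OF T])
    have Aim: "A \<in> sets borel" "A \<subseteq> sphere 0 r"
      using A unfolding s\<sigma> by (subst (asm) sets_restrict_space_iff; auto)+
    have "T ` A \<in> sets borel" by (rule emeasure_lborel_orthogonal_image(1)[OF T Aim(1)])
    moreover have "T ` A \<subseteq> sphere 0 r"
      using Aim(2) T by (auto simp: orthogonal_transformation_norm)
    ultimately have TA: "T ` A \<in> sets \<sigma>" unfolding s\<sigma> by (subst sets_restrict_space_iff) auto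
    have pT: "p (T x) = T (p x)" for x
      using T by (simp add: p_def orthogonal_transformation_norm linear_cmul orthogonal_transformation_linear)
    have BT: "T x \<in> B \<longleftrightarrow> x \<in> B" for x
    proof -
      have "z \<in> B \<longleftrightarrow> norm z \<le> 1 \<and> norm z \<noteq> 0" for z by (auto simp: B_def)
      then show ?thesis by (simp only: orthogonal_transformation_norm[OF T])
    qed
    have "p -` (T ` A) \<inter> B = T ` (p -` A \<inter> B)"
    proof (intro set_eqI iffI)
      fix x assume x: "x \<in> p -` (T ` A) \<inter> B"
      obtain z where z: "x = T z" using bT by (metis bij_pointE)
      then have "T (p z) \<in> T ` A" "z \<in> B" using x pT BT by auto
      then have "p z \<in> A" using bT by (simp add: bij_is_inj inj_image_mem_iff)
      then show "x \<in> T ` (p -` A \<inter> B)" using z \<open>z \<in> B\<close> by auto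
    next
      fix x assume "x \<in> T ` (p -` A \<inter> B)"
      then show "x \<in> p -` (T ` A) \<inter> B" by (auto simp: pT BT)
    qed
    moreover note emeasure_lborel_orthogonal_image(2)[OF T pre[OF A]]
    ultimately show ?thesis using em[OF TA] em[OF A] by simp
  qed
  have tot: "emeasure \<sigma> (sphere 0 r) = ennreal (sphere_area CARD('n) r)"
  proof -
    have S: "sphere 0 r \<in> sets \<sigma>" unfolding s\<sigma> by (subst sets_restrict_space_iff) auto
    have "p -` sphere 0 r \<inter> B = B" using pB by auto
    then have "emeasure \<sigma> (sphere 0 r) = K * emeasure lborel B" using em[OF S] by simp
    also have "emeasure lborel B = emeasure lborel (cball (0::real^'n) 1)"
      unfolding B_def by (rule emeasure_Diff_null_set) auto
    also have "\<dots> = ennreal (unit_ball_vol (real CARD('n)))"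
      by (subst emeasure_cball) auto
    finally show ?thesis
      using r by (simp add: K_def sphere_area_def ennreal_mult[symmetric] mult_ac)
  qed
  have "is_sphere_measure r \<sigma>" using s\<sigma> inv tot by (auto simp: is_sphere_measure_def)
  then show ?thesis ..
qed

lemma ex1_sphere_measure: "r > 0 \<Longrightarrow> \<exists>!\<sigma> :: (real^'n) measure. is_sphere_measure r \<sigma>"
  using is_sphere_measure_exists is_sphere_measure_unique by metis

lemma is_sphere_measure_sphere_measure: "r > 0 \<Longrightarrow> is_sphere_measure r (sphere_measure r)"
  unfolding sphere_measure_def by (rule theI'[OF ex1_sphere_measure])

end

theory Submission
  imports Defs
begin

text \<open>Let \<open>n\<close> be the dimension and \<open>r\<close>, \<open>s\<close> the two radii. Tightness makes evaluation on \<open>X\<close> a bijection from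
  the polynomials of degree at most 3 (restricted to the spheres) to the functions on \<open>X\<close>, so the
  reproducing kernel \<open>K\<close> of the former satisfies \<open>w y * K x y = 1\<close> for \<open>x = y\<close> and \<open>0\<close> for \<open>x \<noteq> y\<close> in \<open>X\<close>.
  On the diagonal this gives constant weights on each sphere and the equation for the numbers of
  points; off the diagonal it makes the normalised inner products between the two spheres roots of
  one cubic polynomial. Each sphere carries a 4-design, so the frequencies of the three roots
  are the weights of a 3-node quadrature rule determined by the nodes alone. Hence they are the same
  seen from either sphere, and become integers when multiplied by the greatest common divisor of the
  two cardinalities, a proper divisor of \<open>binomial (n + 3) 3\<close>.
  The rules in question form a one-parameter family; for \<open>3 \<le> n \<le> 8\<close> the weight of the node closest to
  the origin takes only finitely many admissible rational values, and for each of them the difference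
  of the other two weights is not an admissible rational. For \<open>n = 2\<close> the same argument forces five
  points on each sphere, and the cubic has the roots \<open>cos pi\<close>, \<open>cos (pi / 5)\<close>, \<open>cos (3 * pi / 5)\<close>.\<close>

section \<open>Polynomial functions\<close>

text \<open>The cubic for the cross inner products depends on radii and weights through one real
  parameter, \<open>\<kappa>3 * r * s / \<kappa>2\<close>, so nothing arithmetic is known about its
  roots; only their frequencies are rational. Three nodes and three weights under five moment
  equations again leave one degree of freedom. The parameter used is \<tau> = 1 - n b^2 for a node b
  near the origin, because the weight of b hardly varies: with k = (n - 1) / (n + 2) it lies between
  2k / (1 + 2k) and 2 / (4 - k), and at most two multiples of 1/g fit in there for each denominator
  g that has to be tested. These g are the maximal proper divisors T / p of T = binomial (n + 3) 3,
  since integrality for a divisor passes to its multiples. A value of this weight determines \<tau>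
  by a quadratic, whose smaller root is excluded because all nodes lie in [-1, 1]; then \<tau>
  determines the square of the difference of the outer weights, and the second integrality condition
  fails. In the plane a count of harmonics leaves 4, 5 or 6 points per sphere, and the gcd 2 of 4
  and 6 would require three positive multiples of 1/2 with sum 1.\<close>

definition monom_fun :: "('n::finite \<Rightarrow> nat) \<Rightarrow> real^'n \<Rightarrow> real" where
  "monom_fun \<alpha> x = (\<Prod>i\<in>UNIV. (x $ i) ^ \<alpha> i)"

interpretation fun_space: vector_space "\<lambda>(c::real) (f::'a \<Rightarrow> real) x. c * f x"
  by (rule vector_space_fun)

lemma Pol_iff: "f \<in> Pol t \<longleftrightarrow> (\<exists>c. f = (\<lambda>x. \<Sum>\<alpha>\<in>exponents_le t. c \<alpha> * monom_fun \<alpha> x))"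
  by (simp add: Pol_def monom_fun_def)

lemma monom_fun_in_Pol: "\<alpha> \<in> exponents_le t \<Longrightarrow> monom_fun \<alpha> \<in> Pol t"
  unfolding Pol_iff
  by (rule exI[of _ "\<lambda>\<beta>. if \<beta> = \<alpha> then 1 else 0"])
    (auto intro!: ext simp: if_distrib[where f = "\<lambda>c. c * _"] sum.delta finite_exponents_le cong: if_cong)

lemma Pol_add: "f \<in> Pol t \<Longrightarrow> g \<in> Pol t \<Longrightarrow> (\<lambda>x. f x + g x) \<in> Pol t"
  unfolding Pol_iff
proof (elim exE)
  fix c d
  assume "f = (\<lambda>x. \<Sum>\<alpha>\<in>exponents_le t. c \<alpha> * monom_fun \<alpha> x)"
    and "g = (\<lambda>x. \<Sum>\<alpha>\<in>exponents_le t. d \<alpha> * monom_fun \<alpha> x)"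
  then show "\<exists>c. (\<lambda>x. f x + g x) = (\<lambda>x. \<Sum>\<alpha>\<in>exponents_le t. c \<alpha> * monom_fun \<alpha> x)"
    by (intro exI[of _ "\<lambda>\<alpha>. c \<alpha> + d \<alpha>"]) (simp add: sum.distrib algebra_simps)
qed

lemma Pol_cmult: "f \<in> Pol t \<Longrightarrow> (\<lambda>x. c * f x) \<in> Pol t"
  unfolding Pol_iff
proof (elim exE)
  fix d
  assume "f = (\<lambda>x. \<Sum>\<alpha>\<in>exponents_le t. d \<alpha> * monom_fun \<alpha> x)"
  then show "\<exists>d. (\<lambda>x. c * f x) = (\<lambda>x. \<Sum>\<alpha>\<in>exponents_le t. d \<alpha> * monom_fun \<alpha> x)"
    by (intro exI[of _ "\<lambda>\<alpha>. c * d \<alpha>"]) (simp add: sum_distrib_left algebra_simps)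
qed

lemma Pol_zero: "(\<lambda>x. 0) \<in> Pol t"
  unfolding Pol_iff by (intro exI[of _ "\<lambda>_. 0"]) simp

lemma Pol_diff: "f \<in> Pol t \<Longrightarrow> g \<in> Pol t \<Longrightarrow> (\<lambda>x. f x - g x) \<in> Pol t"
  using Pol_add[OF _ Pol_cmult[of g t "-1"], of f] by simp

lemma Pol_sum: "(\<And>i. i \<in> I \<Longrightarrow> f i \<in> Pol t) \<Longrightarrow> (\<lambda>x. \<Sum>i\<in>I. f i x) \<in> Pol t"
  by (induction I rule: infinite_finite_induct) (auto simp: Pol_zero intro: Pol_add)

lemma Pol_const: "(\<lambda>x. c) \<in> Pol t"
proof -
  have "monom_fun (\<lambda>i. 0) \<in> Pol t" by (rule monom_fun_in_Pol) (simp add: exponents_le_def)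
  from Pol_cmult[OF this, of c] show ?thesis by (simp add: monom_fun_def)
qed

lemma Pol_nth: "t \<ge> 1 \<Longrightarrow> (\<lambda>x. x $ i) \<in> Pol t"
proof -
  assume t: "t \<ge> 1"
  have "monom_fun (\<lambda>j. if j = i then 1 else 0) \<in> Pol t"
    using t by (intro monom_fun_in_Pol) (simp add: exponents_le_def)
  moreover have "monom_fun (\<lambda>j. if j = i then 1 else 0) = (\<lambda>x. x $ i)"
    unfolding monom_fun_def by (simp add: fun_eq_iff if_distrib[where f = "\<lambda>k. _ ^ k"] prod.delta cong: if_cong)
  ultimately show ?thesis by simp
qed

lemma Pol_mult:
  fixes f g :: "real^'n \<Rightarrow> real"
  assumes "f \<in> Pol s" "g \<in> Pol t"
  shows "(\<lambda>x. f x * g x) \<in> Pol (s + t)"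
proof -
  obtain c d where c: "f = (\<lambda>x. \<Sum>\<alpha>\<in>exponents_le s. c \<alpha> * monom_fun \<alpha> x)"
    and d: "g = (\<lambda>x. \<Sum>\<alpha>\<in>exponents_le t. d \<alpha> * monom_fun \<alpha> x)"
    using assms unfolding Pol_iff by blast
  have "f x * g x = (\<Sum>\<alpha>\<in>exponents_le s. \<Sum>\<beta>\<in>exponents_le t.
      (c \<alpha> * d \<beta>) * monom_fun (\<lambda>i. \<alpha> i + \<beta> i) x)" for x
    unfolding c d sum_product by (intro sum.cong refl) (simp add: monom_fun_def power_add prod.distrib mult_ac)
  moreover have "(\<lambda>x. \<Sum>\<alpha>\<in>exponents_le s. \<Sum>\<beta>\<in>exponents_le t.
      (c \<alpha> * d \<beta>) * monom_fun (\<lambda>i. \<alpha> i + \<beta> i) x) \<in> Pol (s + t)"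
    by (intro Pol_sum Pol_cmult monom_fun_in_Pol) (auto simp: exponents_le_def sum.distrib intro: add_mono)
  ultimately show ?thesis by simp
qed

lemma Pol_inner: "t \<ge> 1 \<Longrightarrow> (\<lambda>x. v \<bullet> x) \<in> Pol t"
  unfolding inner_vec_def by (auto intro!: Pol_sum Pol_cmult Pol_nth)

lemma Pol_inner_pow: "(\<lambda>x. (v \<bullet> x) ^ k) \<in> Pol k"
proof (induction k)
  case (Suc k)
  show ?case using Pol_mult[OF Pol_inner[of 1 v] Suc] by simp
qed (simp add: Pol_const)

lemma Pol_norm2: "(\<lambda>x::real^'n. (norm x)\<^sup>2) \<in> Pol 2"
proof -
  have "(\<lambda>x::real^'n. x $ i * x $ i) \<in> Pol 2" for i :: 'n
    using Pol_mult[OF Pol_nth[of 1 i] Pol_nth[of 1 i]] by (simp add: numeral_2_eq_2)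
  then have "(\<lambda>x::real^'n. \<Sum>i\<in>UNIV. x $ i * x $ i) \<in> Pol 2" by (intro Pol_sum)
  then show ?thesis by (simp add: power2_norm_eq_inner inner_vec_def)
qed

lemma Pol_mono: "f \<in> Pol s \<Longrightarrow> s \<le> t \<Longrightarrow> f \<in> Pol t"
  using Pol_mult[of f s "\<lambda>x. 1" "t - s"] by (simp add: Pol_const)

lemma monom_fun_Suc:
  assumes "(\<Sum>i\<in>UNIV. \<alpha> i) = Suc k"
  obtains i \<beta> where "(\<Sum>i\<in>UNIV. \<beta> i) = k" "\<And>x. monom_fun \<alpha> x = x $ i * monom_fun \<beta> x"
proof -
  obtain i where i: "\<alpha> i > 0"
    using assms by (metis Zero_not_Suc gr0I sum.neutral)
  have a: "\<alpha> = (\<lambda>j. (if j = i then 1 else 0) + (\<alpha>(i := \<alpha> i - 1)) j)"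
    using i by auto
  have "(\<Sum>i\<in>UNIV. \<alpha> i) = 1 + (\<Sum>j\<in>UNIV. (\<alpha>(i := \<alpha> i - 1)) j)"
    by (subst a) (simp add: sum.distrib del: fun_upd_apply)
  moreover have "monom_fun \<alpha> x = x $ i * monom_fun (\<alpha>(i := \<alpha> i - 1)) x" for x
    unfolding monom_fun_def
    by (subst a) (simp add: power_add prod.distrib if_distrib[where f = "\<lambda>k. _ ^ k"] prod.delta
        del: fun_upd_apply cong: if_cong)
  ultimately show thesis using assms by (intro that[of "\<alpha>(i := \<alpha> i - 1)" i]) linarith+
qed

lemma monom_fun_0: "(\<Sum>i\<in>UNIV. \<alpha> i) = 0 \<Longrightarrow> monom_fun \<alpha> x = 1"
  by (simp add: monom_fun_def)

text \<open>By polarisation, powers of linear forms span the polynomials of degree at most 3.\<close>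

lemma Pol_3_induct:
  fixes f :: "real^'n \<Rightarrow> real"
  assumes f: "f \<in> Pol 3"
    and pow: "\<And>v k. k \<le> 3 \<Longrightarrow> P (\<lambda>x. (v \<bullet> x) ^ k)"
    and add: "\<And>f g. P f \<Longrightarrow> P g \<Longrightarrow> P (\<lambda>x. f x + g x)"
    and cmult: "\<And>c f. P f \<Longrightarrow> P (\<lambda>x. c * f x)"
  shows "P f"
proof -
  have diff: "P (\<lambda>x. f x - g x)" if "P f" "P g" for f g
    using add[OF that(1) cmult[OF that(2), of "-1"]] by simp
  have 0: "P (\<lambda>x. 1)" using pow[of 0 0] by simp
  have 1: "P (\<lambda>x. v \<bullet> x)" for v using pow[of 1 v] by simp
  have 2: "P (\<lambda>x. (u \<bullet> x) * (v \<bullet> x))" for u v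
  proof -
    have "P (\<lambda>x. (1/4) * (((u + v) \<bullet> x)^2 - ((u - v) \<bullet> x)^2))"
      by (intro cmult diff pow) auto
    moreover have "(1/4) * (((u + v) \<bullet> x)^2 - ((u - v) \<bullet> x)^2) = (u \<bullet> x) * (v \<bullet> x)" for x
      by (simp add: inner_simps power2_eq_square algebra_simps)
    ultimately show ?thesis by simp
  qed
  have 3: "P (\<lambda>x. (u \<bullet> x) * ((v \<bullet> x) * (w \<bullet> x)))" for u v w
  proof -
    have "P (\<lambda>x. (1/24) * (((u + v + w) \<bullet> x)^3 - ((u + v - w) \<bullet> x)^3 - ((u - v + w) \<bullet> x)^3
        - ((v + w - u) \<bullet> x)^3))"
      by (intro cmult diff pow) auto
    moreover have "(1/24) * (((u + v + w) \<bullet> x)^3 - ((u + v - w) \<bullet> x)^3 - ((u - v + w) \<bullet> x)^3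
        - ((v + w - u) \<bullet> x)^3) = (u \<bullet> x) * ((v \<bullet> x) * (w \<bullet> x))" for x
      by (simp add: inner_simps power3_eq_cube algebra_simps)
    ultimately show ?thesis by simp
  qed
  have nth: "(x::real^'n) $ i = axis i 1 \<bullet> x" for x i by (simp add: inner_axis' )
  have mon: "P (monom_fun \<alpha>)" if \<alpha>: "\<alpha> \<in> exponents_le 3" for \<alpha> :: "'n \<Rightarrow> nat"
  proof -
    obtain d where d: "(\<Sum>i\<in>UNIV. \<alpha> i) = d" "d \<le> 3" using \<alpha> by (auto simp: exponents_le_def)
    from d(2) consider "d = 0" | "d = Suc 0" | "d = Suc (Suc 0)" | "d = Suc (Suc (Suc 0))" by linarith
    then show ?thesis
    proof cases
      case 1
      then show ?thesis using 0 monom_fun_0[of \<alpha>] d by presburger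
    next
      case 2
      then obtain i \<beta> where "(\<Sum>i\<in>UNIV. \<beta> i) = 0" "\<And>x. monom_fun \<alpha> x = x $ i * monom_fun \<beta> x"
        using monom_fun_Suc[of \<alpha> 0] d by metis
      then have "monom_fun \<alpha> = (\<lambda>x. axis i 1 \<bullet> x)" using monom_fun_0[of \<beta>] nth by auto
      then show ?thesis using 1 by simp
    next
      case 3
      then obtain i \<beta> where b: "(\<Sum>i\<in>UNIV. \<beta> i) = Suc 0" "\<And>x. monom_fun \<alpha> x = x $ i * monom_fun \<beta> x"
        using monom_fun_Suc[of \<alpha> "Suc 0"] d by metis
      then obtain j \<delta> where "(\<Sum>i\<in>UNIV. \<delta> i) = 0" "\<And>x. monom_fun \<beta> x = x $ j * monom_fun \<delta> x"
        using monom_fun_Suc[of \<beta> 0] by metis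
      then have "monom_fun \<alpha> = (\<lambda>x. (axis i 1 \<bullet> x) * (axis j 1 \<bullet> x))" using monom_fun_0[of \<delta>] nth b by auto
      then show ?thesis using 2 by simp
    next
      case 4
      then obtain i \<beta> where b: "(\<Sum>i\<in>UNIV. \<beta> i) = Suc (Suc 0)" "\<And>x. monom_fun \<alpha> x = x $ i * monom_fun \<beta> x"
        using monom_fun_Suc[of \<alpha> "Suc (Suc 0)"] d by metis
      then obtain j \<delta> where c: "(\<Sum>i\<in>UNIV. \<delta> i) = Suc 0" "\<And>x. monom_fun \<beta> x = x $ j * monom_fun \<delta> x"
        using monom_fun_Suc[of \<beta> "Suc 0"] by metis
      then obtain l \<epsilon> where "(\<Sum>i\<in>UNIV. \<epsilon> i) = 0" "\<And>x. monom_fun \<delta> x = x $ l * monom_fun \<epsilon> x"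
        using monom_fun_Suc[of \<delta> 0] by metis
      then have "monom_fun \<alpha> = (\<lambda>x. (axis i 1 \<bullet> x) * ((axis j 1 \<bullet> x) * (axis l 1 \<bullet> x)))"
        using monom_fun_0[of \<epsilon>] nth b c by auto
      then show ?thesis using 3 by simp
    qed
  qed
  obtain c where c: "f = (\<lambda>x. \<Sum>\<alpha>\<in>exponents_le 3. c \<alpha> * monom_fun \<alpha> x)"
    using f unfolding Pol_iff by blast
  have "P (\<lambda>x. \<Sum>\<alpha>\<in>A. c \<alpha> * monom_fun \<alpha> x)" if "A \<subseteq> exponents_le 3" for A
    using finite_subset[OF that finite_exponents_le] that
  proof (induction A rule: finite_induct)
    case empty
    show ?case using cmult[OF 0, of 0] by simp
  next
    case (insert \<alpha> A)
    then show ?case using add[OF cmult[OF mon, of \<alpha> "c \<alpha>"]] by auto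
  qed
  then show ?thesis unfolding c by blast
qed

section \<open>Moments of the uniform distribution on a sphere\<close>

lemma sphere_measure_sets:
  "r > 0 \<Longrightarrow> sets (sphere_measure r :: (real^'n) measure) = sets (restrict_space borel (sphere 0 r))"
  using is_sphere_measure_sphere_measure[of r] by (auto simp: is_sphere_measure_def)

lemma sphere_measure_space: "r > 0 \<Longrightarrow> space (sphere_measure r :: (real^'n) measure) = sphere 0 r"
  using sets_eq_imp_space_eq[OF sphere_measure_sets] by (simp add: space_restrict_space)

lemma sphere_measure_total:
  "r > 0 \<Longrightarrow> emeasure (sphere_measure r :: (real^'n) measure) (sphere 0 r) = ennreal (sphere_area CARD('n) r)"
  using is_sphere_measure_sphere_measure[of r] by (auto simp: is_sphere_measure_def)

lemma sphere_measure_finite: "r > 0 \<Longrightarrow> finite_measure (sphere_measure r :: (real^'n) measure)"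
  by (rule finite_measureI) (simp add: sphere_measure_space sphere_measure_total)

lemma sphere_measure_measurable:
  fixes f :: "real^'n \<Rightarrow> real"
  assumes "r > 0" "continuous_on UNIV f"
  shows "f \<in> borel_measurable (sphere_measure r)"
proof -
  have "f \<in> borel_measurable (restrict_space borel (sphere 0 r))"
    using assms(2) by (intro measurable_restrict_space1 borel_measurable_continuous_onI)
  then show ?thesis using measurable_cong_sets[OF sphere_measure_sets[OF assms(1)] refl] by blast
qed

lemma sphere_measure_integrable:
  fixes f :: "real^'n \<Rightarrow> real"
  assumes r: "r > 0" and f: "continuous_on UNIV f"
  shows "integrable (sphere_measure r) f"
proof -
  have "compact (f ` sphere 0 r)"
    using continuous_on_subset[OF f] by (intro compact_continuous_image) auto
  then obtain B where "\<forall>y\<in>f ` sphere 0 r. norm y \<le> B"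
    using compact_imp_bounded bounded_iff by metis
  then show ?thesis
    using r by (intro finite_measure.integrable_const_bound[OF sphere_measure_finite[OF r], where B = B]
        sphere_measure_measurable f) (auto simp: sphere_measure_space intro!: AE_I2)
qed

lemma sphere_mean_cong:
  assumes "r > 0" "\<And>x::real^'n. norm x = r \<Longrightarrow> f x = g x"
  shows "sphere_mean r f = sphere_mean r g"
proof -
  have "(\<integral>x. f x \<partial>sphere_measure r) = (\<integral>x. g x \<partial>sphere_measure r)"
    using assms by (intro Bochner_Integration.integral_cong) (auto simp: sphere_measure_space)
  then show ?thesis using assms(1) by (simp add: sphere_mean_def)
qed

lemma sphere_mean_add:
  fixes f g :: "real^'n \<Rightarrow> real"
  assumes "r > 0" "continuous_on UNIV f" "continuous_on UNIV g"
  shows "sphere_mean r (\<lambda>x. f x + g x) = sphere_mean r f + sphere_mean r g"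
  using assms by (simp add: sphere_mean_def sphere_measure_integrable add_divide_distrib)

lemma sphere_mean_diff:
  fixes f g :: "real^'n \<Rightarrow> real"
  assumes "r > 0" "continuous_on UNIV f" "continuous_on UNIV g"
  shows "sphere_mean r (\<lambda>x. f x - g x) = sphere_mean r f - sphere_mean r g"
  using assms by (simp add: sphere_mean_def sphere_measure_integrable diff_divide_distrib)

lemma sphere_mean_cmult: "r > 0 \<Longrightarrow> sphere_mean r (\<lambda>x. c * f x) = c * sphere_mean r f"
  by (simp add: sphere_mean_def)

lemma sphere_mean_sum:
  fixes f :: "'i \<Rightarrow> real^'n \<Rightarrow> real"
  assumes "r > 0" "\<And>i. i \<in> I \<Longrightarrow> continuous_on UNIV (f i)"
  shows "sphere_mean r (\<lambda>x. \<Sum>i\<in>I. f i x) = (\<Sum>i\<in>I. sphere_mean r (f i))"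
  using assms by (simp add: sphere_mean_def sphere_measure_integrable sum_divide_distrib)

lemma sphere_mean_const:
  assumes r: "r > 0" shows "sphere_mean r (\<lambda>x::real^'n. c) = c"
proof -
  have "measure (sphere_measure r :: (real^'n) measure) (sphere 0 r) = sphere_area CARD('n) r"
    using sphere_area_pos[of "CARD('n)" r] r by (simp add: measure_def sphere_measure_total)
  then show ?thesis using sphere_area_pos[of "CARD('n)" r] r
    by (simp add: sphere_mean_def sphere_measure_space)
qed

lemma sphere_mean_orthogonal:
  fixes f :: "real^'n \<Rightarrow> real" and T :: "real^'n \<Rightarrow> real^'n"
  assumes r: "r > 0" and T: "orthogonal_transformation T" and f: "continuous_on UNIV f"
  shows "sphere_mean r (\<lambda>x. f (T x)) = sphere_mean r f"
proof -
  let ?\<sigma> = "sphere_measure r :: (real^'n) measure"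
  have s: "sets ?\<sigma> = sets (restrict_space borel (sphere 0 r))" by (rule sphere_measure_sets[OF r])
  have cT: "continuous_on UNIV T"
    using T by (intro linear_continuous_on) (simp add: linear_conv_bounded_linear[symmetric] orthogonal_transformation_linear)
  have "T \<in> measurable (restrict_space borel (sphere 0 r)) (restrict_space borel (sphere 0 r))"
    using T cT by (intro measurable_restrict_space2 measurable_restrict_space1 borel_measurable_continuous_onI)
      (auto simp: space_restrict_space orthogonal_transformation_norm)
  then have Tm: "T \<in> measurable ?\<sigma> ?\<sigma>" using measurable_cong_sets[OF s s] by blast
  have "distr ?\<sigma> ?\<sigma> T = ?\<sigma>"
  proof (rule measure_eqI)
    fix A assume "A \<in> sets (distr ?\<sigma> ?\<sigma> T)"
    then have A: "A \<in> sets ?\<sigma>" by simp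
    let ?B = "T -` A \<inter> space ?\<sigma>"
    have B: "?B \<in> sets ?\<sigma>" by (rule measurable_sets[OF Tm A])
    \<comment> \<open>Invariance is given for images, whereas the push-forward measures preimages;
      surjectivity of \<open>T\<close> converts one into the other.\<close>
    have "T ` ?B = A"
    proof
      show "A \<subseteq> T ` ?B"
      proof
        fix y assume y: "y \<in> A"
        obtain x where x: "y = T x" using orthogonal_transformation_surj[OF T] by (metis surjD)
        have "y \<in> sphere 0 r" using y sets.sets_into_space[OF A] by (auto simp: sphere_measure_space[OF r])
        then have "x \<in> sphere 0 r" using x T by (simp add: orthogonal_transformation_norm)
        then show "y \<in> T ` ?B" using x y by (auto simp: sphere_measure_space[OF r])
      qed
    qed auto
    moreover have "emeasure ?\<sigma> (T ` ?B) = emeasure ?\<sigma> ?B"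
      using is_sphere_measure_sphere_measure[OF r] T B unfolding is_sphere_measure_def by blast
    ultimately show "emeasure (distr ?\<sigma> ?\<sigma> T) A = emeasure ?\<sigma> A"
      by (simp add: emeasure_distr[OF Tm A])
  qed simp
  moreover have "(\<integral>x. f x \<partial>distr ?\<sigma> ?\<sigma> T) = (\<integral>x. f (T x) \<partial>?\<sigma>)"
    by (rule integral_distr[OF Tm sphere_measure_measurable[OF r f]])
  ultimately show ?thesis using r by (simp add: sphere_mean_def)
qed

lemma sphere_mean_inner_norm:
  fixes u v :: "real^'n"
  assumes r: "r > 0" and n: "norm u = norm v"
  shows "sphere_mean r (\<lambda>z. (u \<bullet> z) ^ k) = sphere_mean r (\<lambda>z. (v \<bullet> z) ^ k)"
proof -
  obtain T where T: "orthogonal_transformation T" "T u = v"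
    using n orthogonal_transformation_exists by metis
  have "sphere_mean r (\<lambda>z. (v \<bullet> T z) ^ k) = sphere_mean r (\<lambda>z. (v \<bullet> z) ^ k)"
    by (rule sphere_mean_orthogonal[OF r T(1), where f = "\<lambda>z. (v \<bullet> z) ^ k"]) (intro continuous_intros)
  moreover have "v \<bullet> T z = u \<bullet> z" for z
    using T by (auto simp: orthogonal_transformation_def)
  ultimately show ?thesis by simp
qed

lemma sphere_mean_inner_odd:
  fixes v :: "real^'n"
  assumes r: "r > 0" and k: "odd k"
  shows "sphere_mean r (\<lambda>z. (v \<bullet> z) ^ k) = 0"
proof -
  have "sphere_mean r (\<lambda>z. (-v \<bullet> z) ^ k) = sphere_mean r (\<lambda>z. (v \<bullet> z) ^ k)"
    by (rule sphere_mean_inner_norm[OF r]) simp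
  moreover have "(\<lambda>z. (-v \<bullet> z) ^ k) = (\<lambda>z. (-1) * (v \<bullet> z) ^ k)"
    using k by (simp add: fun_eq_iff)
  ultimately show ?thesis using sphere_mean_cmult[OF r, of "-1" "\<lambda>z. (v \<bullet> z) ^ k"] by simp
qed

lemma sphere_mean_inner_pow:
  fixes v :: "real^'n"
  assumes r: "r > 0"
  shows "sphere_mean r (\<lambda>z. (v \<bullet> z) ^ k) = norm v ^ k * sphere_mean r (\<lambda>z. ((axis i 1 :: real^'n) \<bullet> z) ^ k)"
proof -
  have "sphere_mean r (\<lambda>z. (v \<bullet> z) ^ k) = sphere_mean r (\<lambda>z. ((norm v *\<^sub>R axis i 1) \<bullet> z) ^ k)"
    by (rule sphere_mean_inner_norm[OF r]) simp
  also have "\<dots> = sphere_mean r (\<lambda>z. norm v ^ k * (axis i 1 \<bullet> z) ^ k)"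
    by (simp add: power_mult_distrib)
  finally show ?thesis using r by (simp add: sphere_mean_cmult)
qed

section \<open>Even and mixed moments of linear forms\<close>

lemmas sphere_mean_simps = sphere_mean_add sphere_mean_diff sphere_mean_cmult sphere_mean_const

lemma norm_add_scale2: "(norm (x + c *\<^sub>R y))\<^sup>2 = (norm x)\<^sup>2 + 2 * c * (x \<bullet> y) + c\<^sup>2 * (norm y)\<^sup>2"
  for x y :: "'a::real_inner"
  unfolding power2_norm_eq_inner by (simp add: inner_simps inner_commute[of y x] power2_eq_square algebra_simps)

text \<open>On the sphere \<open>(norm z)\<^sup>2\<close> is constant, so inserting it under the
  mean and expanding it in coordinates (\<open>sum_trick\<close>) links each even moment to the next
  one. The mixed means that arise are polarised into pure powers, whose means depend on norms
  only.\<close>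

lemma sphere_mean_even_constants:
  fixes i :: "'n::finite"
  assumes r: "r > 0"
  defines "e \<equiv> \<lambda>k. sphere_mean r (\<lambda>z. ((axis i 1 :: real^'n) \<bullet> z) ^ k)"
  shows "e 2 = r\<^sup>2 / real CARD('n)"
    and "e 4 = 3 * r ^ 4 / (real CARD('n) * (real CARD('n) + 2))"
    and "e 6 = 15 * r ^ 6 / (real CARD('n) * (real CARD('n) + 2) * (real CARD('n) + 4))"
proof -
  let ?n = "real CARD('n)"
  have n: "?n > 0" by simp
  let ?v = "axis i 1 :: real^'n"
  have pow: "sphere_mean r (\<lambda>z. (u \<bullet> z) ^ (2 * k)) = ((norm u)\<^sup>2) ^ k * e (2 * k)" for u :: "real^'n" and k
    using sphere_mean_inner_pow[OF r, of u "2 * k" i] by (simp add: e_def power_mult)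
  have pw: "sphere_mean r (\<lambda>z. (u \<bullet> z)\<^sup>2) = (norm u)\<^sup>2 * e 2"
    "sphere_mean r (\<lambda>z. (u \<bullet> z) ^ 4) = ((norm u)\<^sup>2)\<^sup>2 * e 4"
    "sphere_mean r (\<lambda>z. (u \<bullet> z) ^ 6) = ((norm u)\<^sup>2) ^ 3 * e 6" for u :: "real^'n"
    using pow[of u 1] pow[of u 2] pow[of u 3] by simp_all
  have nrm: "(norm z)\<^sup>2 = (\<Sum>j\<in>UNIV. (axis j 1 \<bullet> z)\<^sup>2)" for z :: "real^'n"
    unfolding power2_norm_eq_inner inner_axis' by (simp add: inner_vec_def power2_eq_square)
  have sum_trick: "r\<^sup>2 * sphere_mean r f = (\<Sum>j\<in>UNIV. sphere_mean r (\<lambda>z. (axis j 1 \<bullet> z)\<^sup>2 * f z))"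
    if f: "continuous_on UNIV f" for f :: "real^'n \<Rightarrow> real"
  proof -
    have "r\<^sup>2 * sphere_mean r f = sphere_mean r (\<lambda>z. r\<^sup>2 * f z)" using r by (simp add: sphere_mean_cmult)
    also have "\<dots> = sphere_mean r (\<lambda>z. \<Sum>j\<in>UNIV. (axis j 1 \<bullet> z)\<^sup>2 * f z)"
      using r by (intro sphere_mean_cong) (auto simp: nrm simp flip: sum_distrib_right)
    finally show ?thesis using r f by (simp add: sphere_mean_sum continuous_intros)
  qed
  have "r\<^sup>2 * sphere_mean r (\<lambda>z::real^'n. 1) = (\<Sum>j\<in>(UNIV::'n set). e 2)"
    by (subst sum_trick) (auto simp: pw)
  then show e2: "e 2 = r\<^sup>2 / ?n" using r n by (simp add: sphere_mean_const field_simps)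
  have c: "(\<Sum>j\<in>UNIV. (axis j 1 \<bullet> ?v)\<^sup>2) = 1" using nrm[of ?v] by simp
  have 22: "sphere_mean r (\<lambda>z. (u \<bullet> z)\<^sup>2 * (?v \<bullet> z)\<^sup>2) = (1 + 2 * (u \<bullet> ?v)\<^sup>2) * e 4 / 3"
    if u: "norm u = 1" for u :: "real^'n"
  proof -
    have "(u \<bullet> z)\<^sup>2 * (?v \<bullet> z)\<^sup>2 = (1/12) * (((u + 1 *\<^sub>R ?v) \<bullet> z)^4 + ((u + (-1) *\<^sub>R ?v) \<bullet> z)^4
       - 2 * (u \<bullet> z)^4 - 2 * (?v \<bullet> z)^4)" for z
      unfolding inner_simps by algebra
    then have "sphere_mean r (\<lambda>z. (u \<bullet> z)\<^sup>2 * (?v \<bullet> z)\<^sup>2) =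
       sphere_mean r (\<lambda>z. (1/12) * (((u + 1 *\<^sub>R ?v) \<bullet> z)^4 + ((u + (-1) *\<^sub>R ?v) \<bullet> z)^4
       - 2 * (u \<bullet> z)^4 - 2 * (?v \<bullet> z)^4))" by (simp only:)
    also have "\<dots> = (1/12) * (((norm (u + 1 *\<^sub>R ?v))\<^sup>2)\<^sup>2 * e 4 + ((norm (u + (-1) *\<^sub>R ?v))\<^sup>2)\<^sup>2 * e 4
       - 2 * (((norm u)\<^sup>2)\<^sup>2 * e 4) - 2 * (((norm ?v)\<^sup>2)\<^sup>2 * e 4))"
      using r by (simp only: sphere_mean_simps pw continuous_intros)
    also have "\<dots> = (1 + 2 * (u \<bullet> ?v)\<^sup>2) * e 4 / 3"
      unfolding norm_add_scale2 u norm_axis_1 by (simp add: algebra_simps power2_eq_square)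
    finally show ?thesis .
  qed
  have "r\<^sup>2 * e 2 = (\<Sum>j\<in>UNIV. (1 + 2 * (axis j 1 \<bullet> ?v)\<^sup>2) * e 4 / 3)"
    unfolding e_def by (subst sum_trick) (auto simp: 22 e_def intro!: continuous_intros)
  also have "\<dots> = (?n + 2) * e 4 / 3"
    using c by (simp add: sum.distrib distrib_right flip: sum_distrib_left sum_distrib_right sum_divide_distrib)
  finally have e4': "e 4 = 3 * r\<^sup>2 * e 2 / (?n + 2)" using n by (simp add: field_simps)
  then show e4: "e 4 = 3 * r ^ 4 / (?n * (?n + 2))"
    unfolding e2 using n by (simp add: field_simps power2_eq_square eval_nat_numeral)
  have 24: "sphere_mean r (\<lambda>z. (u \<bullet> z)\<^sup>2 * (?v \<bullet> z)^4) = (1 + 4 * (u \<bullet> ?v)\<^sup>2) * e 6 / 5"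
    if u: "norm u = 1" for u :: "real^'n"
  proof -
    \<comment> \<open>In (v + t u)^6 + (v - t u)^6 the coefficients of v^4 u^2 and v^2 u^4 are 30
      t^2 and 30 t^4. The multipliers 16 at t = 1 and -1 at t = 2 cancel the latter and leave 360
      for the former.\<close>
    have "(u \<bullet> z)\<^sup>2 * (?v \<bullet> z)^4 = (1/360) * (16 * (((?v + 1 *\<^sub>R u) \<bullet> z)^6 + ((?v + (-1) *\<^sub>R u) \<bullet> z)^6)
       - (((?v + 2 *\<^sub>R u) \<bullet> z)^6 + ((?v + (-2) *\<^sub>R u) \<bullet> z)^6) - 30 * (?v \<bullet> z)^6 + 96 * (u \<bullet> z)^6)" for z
      unfolding inner_simps by algebra
    then have "sphere_mean r (\<lambda>z. (u \<bullet> z)\<^sup>2 * (?v \<bullet> z)^4) =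
       sphere_mean r (\<lambda>z. (1/360) * (16 * (((?v + 1 *\<^sub>R u) \<bullet> z)^6 + ((?v + (-1) *\<^sub>R u) \<bullet> z)^6)
       - (((?v + 2 *\<^sub>R u) \<bullet> z)^6 + ((?v + (-2) *\<^sub>R u) \<bullet> z)^6) - 30 * (?v \<bullet> z)^6 + 96 * (u \<bullet> z)^6))" by (simp only:)
    also have "\<dots> = (1/360) * (16 * (((norm (?v + 1 *\<^sub>R u))\<^sup>2)^3 * e 6 + ((norm (?v + (-1) *\<^sub>R u))\<^sup>2)^3 * e 6)
       - (((norm (?v + 2 *\<^sub>R u))\<^sup>2)^3 * e 6 + ((norm (?v + (-2) *\<^sub>R u))\<^sup>2)^3 * e 6)
       - 30 * (((norm ?v)\<^sup>2)^3 * e 6) + 96 * (((norm u)\<^sup>2)^3 * e 6))"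
      using r by (simp only: sphere_mean_simps pw continuous_intros)
    also have "\<dots> = (1 + 4 * (u \<bullet> ?v)\<^sup>2) * e 6 / 5"
      unfolding norm_add_scale2 u norm_axis_1
      by (simp add: algebra_simps power2_eq_square power3_eq_cube inner_commute)
    finally show ?thesis .
  qed
  have "r\<^sup>2 * e 4 = (\<Sum>j\<in>UNIV. (1 + 4 * (axis j 1 \<bullet> ?v)\<^sup>2) * e 6 / 5)"
    unfolding e_def by (subst sum_trick) (auto simp: 24 e_def intro!: continuous_intros)
  also have "\<dots> = (?n + 4) * e 6 / 5"
    using c by (simp add: sum.distrib distrib_right flip: sum_distrib_left sum_distrib_right sum_divide_distrib)
  finally have e6': "e 6 = 5 * r\<^sup>2 * e 4 / (?n + 4)" using n by (simp add: field_simps)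
  then show "e 6 = 15 * r ^ 6 / (?n * (?n + 2) * (?n + 4))"
    unfolding e4 using n by (simp add: field_simps power2_eq_square eval_nat_numeral)
qed

lemma sphere_mean_odd:
  fixes f :: "real^'n \<Rightarrow> real"
  assumes r: "r > 0" and f: "continuous_on UNIV f" and odd: "\<And>z. f (- z) = - f z"
  shows "sphere_mean r f = 0"
proof -
  have "orthogonal_transformation (\<lambda>z::real^'n. - z)" by (simp add: orthogonal_transformation_neg)
  from sphere_mean_orthogonal[OF r this f] have "sphere_mean r (\<lambda>z. (-1) * f z) = sphere_mean r f"
    by (simp add: odd)
  then show ?thesis using sphere_mean_cmult[OF r, of "-1" f] by simp
qed

context
  fixes r :: real and a :: "real^'n"
  assumes r: "r > 0"
begin

lemma sphere_mean_inner_2: "sphere_mean r (\<lambda>z. (a \<bullet> z)\<^sup>2) = r\<^sup>2 / real CARD('n) * (norm a)\<^sup>2"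
  by (subst sphere_mean_inner_pow[OF r, of _ _ undefined])
    (simp add: sphere_mean_even_constants[OF r])

lemma sphere_mean_inner_4:
  "sphere_mean r (\<lambda>z. (a \<bullet> z)^4) = 3 * r^4 / (real CARD('n) * (real CARD('n) + 2)) * ((norm a)\<^sup>2)\<^sup>2"
  by (subst sphere_mean_inner_pow[OF r, of _ _ undefined])
    (simp add: sphere_mean_even_constants[OF r])

lemma sphere_mean_inner_6:
  "sphere_mean r (\<lambda>z. (a \<bullet> z)^6) =
    15 * r^6 / (real CARD('n) * (real CARD('n) + 2) * (real CARD('n) + 4)) * ((norm a)\<^sup>2)^3"
  by (subst sphere_mean_inner_pow[OF r, of _ _ undefined])
    (simp add: sphere_mean_even_constants[OF r])

end

text \<open>\<open>A\<close>, \<open>B\<close>, \<open>P\<close> stand for the squared norms of two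
  vectors and their inner product. The mixed means below are combinations of means of pure powers,
  and these identities evaluate the combinations.\<close>

lemma polar_22: "(1/12) * (c * (A + 2 * 1 * P + 1\<^sup>2 * B)\<^sup>2 + c * (A + 2 * (-1) * P + (-1)\<^sup>2 * B)\<^sup>2
    - 2 * (c * A\<^sup>2) - 2 * (c * B\<^sup>2)) = c * ((A * B + 2 * P\<^sup>2) / 3)" for A B P c :: real
  by (simp add: power2_eq_square field_simps)

lemma polar_31: "(1/48) * (8 * (c * (A + 2 * 1 * P + 1\<^sup>2 * B)\<^sup>2 - c * (A + 2 * (-1) * P + (-1)\<^sup>2 * B)\<^sup>2)
    - (c * (A + 2 * 2 * P + 2\<^sup>2 * B)\<^sup>2 - c * (A + 2 * (-2) * P + (-2)\<^sup>2 * B)\<^sup>2)) = c * (A * P)"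
  for A B P c :: real
  by (simp add: power2_eq_square field_simps)

text \<open>The multiplier 34 cancels the terms x^5 a and x a^5: their coefficient is 12 in the
  first difference, and 24 + 384 = 34 * 12 in the two others together.\<close>

lemma polar_33: "(1/720) * (34 * (c * (A + 2 * 1 * P + 1\<^sup>2 * B)^3 - c * (A + 2 * (-1) * P + (-1)\<^sup>2 * B)^3)
    - (c * (A + 2 * 2 * P + 2\<^sup>2 * B)^3 - c * (A + 2 * (-2) * P + (-2)\<^sup>2 * B)^3)
    - (c * (B + 2 * 2 * P + 2\<^sup>2 * A)^3 - c * (B + 2 * (-2) * P + (-2)\<^sup>2 * A)^3))
    = c * ((9 * A * B * P + 6 * P^3) / 15)"
  for A B P c :: real
  by (simp add: power2_eq_square power3_eq_cube field_simps)

context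
  fixes r :: real and x a :: "real^'n"
  assumes r: "r > 0"
begin

lemma sphere_mean_inner_1_1:
  "sphere_mean r (\<lambda>z. (x \<bullet> z) * (a \<bullet> z)) = r\<^sup>2 / real CARD('n) * (x \<bullet> a)"
proof -
  have "sphere_mean r (\<lambda>z. (x \<bullet> z) * (a \<bullet> z)) =
      sphere_mean r (\<lambda>z. (1/4) * (((x + 1 *\<^sub>R a) \<bullet> z)\<^sup>2 - ((x + (-1) *\<^sub>R a) \<bullet> z)\<^sup>2))"
    by (rule arg_cong[where f = "sphere_mean r"], rule ext, unfold inner_simps) algebra
  also have "\<dots> = (1/4) * (sphere_mean r (\<lambda>z. ((x + 1 *\<^sub>R a) \<bullet> z)\<^sup>2) - sphere_mean r (\<lambda>z. ((x + (-1) *\<^sub>R a) \<bullet> z)\<^sup>2))"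
    using r by (simp only: sphere_mean_simps continuous_intros)
  also have "\<dots> = r\<^sup>2 / real CARD('n) * (x \<bullet> a)"
    unfolding sphere_mean_inner_2[OF r] norm_add_scale2 by (simp add: algebra_simps)
  finally show ?thesis .
qed

lemma sphere_mean_inner_2_2:
  "sphere_mean r (\<lambda>z. (x \<bullet> z)\<^sup>2 * (a \<bullet> z)\<^sup>2) =
    r^4 / (real CARD('n) * (real CARD('n) + 2)) * ((norm x)\<^sup>2 * (norm a)\<^sup>2 + 2 * (x \<bullet> a)\<^sup>2)"
proof -
  have "sphere_mean r (\<lambda>z. (x \<bullet> z)\<^sup>2 * (a \<bullet> z)\<^sup>2) =
      sphere_mean r (\<lambda>z. (1/12) * (((x + 1 *\<^sub>R a) \<bullet> z)^4 + ((x + (-1) *\<^sub>R a) \<bullet> z)^4 - 2 * (x \<bullet> z)^4 - 2 * (a \<bullet> z)^4))"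
    by (rule arg_cong[where f = "sphere_mean r"], rule ext, unfold inner_simps) algebra
  also have "\<dots> = (1/12) * (sphere_mean r (\<lambda>z. ((x + 1 *\<^sub>R a) \<bullet> z)^4) + sphere_mean r (\<lambda>z. ((x + (-1) *\<^sub>R a) \<bullet> z)^4)
      - 2 * sphere_mean r (\<lambda>z. (x \<bullet> z)^4) - 2 * sphere_mean r (\<lambda>z. (a \<bullet> z)^4))"
    using r by (simp only: sphere_mean_simps continuous_intros)
  also have "\<dots> = 3 * r^4 / (real CARD('n) * (real CARD('n) + 2)) *
      (((norm x)\<^sup>2 * (norm a)\<^sup>2 + 2 * (x \<bullet> a)\<^sup>2) / 3)"
    unfolding sphere_mean_inner_4[OF r] norm_add_scale2
    by (rule polar_22)
  finally show ?thesis by simp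
qed

lemma sphere_mean_inner_3_1:
  "sphere_mean r (\<lambda>z. (x \<bullet> z)^3 * (a \<bullet> z)) =
    3 * r^4 / (real CARD('n) * (real CARD('n) + 2)) * ((norm x)\<^sup>2 * (x \<bullet> a))"
proof -
  have "sphere_mean r (\<lambda>z. (x \<bullet> z)^3 * (a \<bullet> z)) =
      sphere_mean r (\<lambda>z. (1/48) * (8 * (((x + 1 *\<^sub>R a) \<bullet> z)^4 - ((x + (-1) *\<^sub>R a) \<bullet> z)^4)
        - (((x + 2 *\<^sub>R a) \<bullet> z)^4 - ((x + (-2) *\<^sub>R a) \<bullet> z)^4)))"
    by (rule arg_cong[where f = "sphere_mean r"], rule ext, unfold inner_simps) algebra
  also have "\<dots> = (1/48) * (8 * (sphere_mean r (\<lambda>z. ((x + 1 *\<^sub>R a) \<bullet> z)^4) - sphere_mean r (\<lambda>z. ((x + (-1) *\<^sub>R a) \<bullet> z)^4))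
        - (sphere_mean r (\<lambda>z. ((x + 2 *\<^sub>R a) \<bullet> z)^4) - sphere_mean r (\<lambda>z. ((x + (-2) *\<^sub>R a) \<bullet> z)^4)))"
    using r by (simp only: sphere_mean_simps continuous_intros)
  also have "\<dots> = 3 * r^4 / (real CARD('n) * (real CARD('n) + 2)) * ((norm x)\<^sup>2 * (x \<bullet> a))"
    unfolding sphere_mean_inner_4[OF r] norm_add_scale2
    by (rule polar_31)
  finally show ?thesis by simp
qed

lemma sphere_mean_inner_3_3:
  "sphere_mean r (\<lambda>z. (x \<bullet> z)^3 * (a \<bullet> z)^3) =
    r^6 / (real CARD('n) * (real CARD('n) + 2) * (real CARD('n) + 4)) *
      (9 * (norm x)\<^sup>2 * (norm a)\<^sup>2 * (x \<bullet> a) + 6 * (x \<bullet> a)^3)"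
proof -
  have "sphere_mean r (\<lambda>z. (x \<bullet> z)^3 * (a \<bullet> z)^3) =
      sphere_mean r (\<lambda>z. (1/720) * (34 * (((x + 1 *\<^sub>R a) \<bullet> z)^6 - ((x + (-1) *\<^sub>R a) \<bullet> z)^6)
        - (((x + 2 *\<^sub>R a) \<bullet> z)^6 - ((x + (-2) *\<^sub>R a) \<bullet> z)^6)
        - (((a + 2 *\<^sub>R x) \<bullet> z)^6 - ((a + (-2) *\<^sub>R x) \<bullet> z)^6)))"
    by (rule arg_cong[where f = "sphere_mean r"], rule ext, unfold inner_simps) algebra
  also have "\<dots> = (1/720) * (34 * (sphere_mean r (\<lambda>z. ((x + 1 *\<^sub>R a) \<bullet> z)^6) - sphere_mean r (\<lambda>z. ((x + (-1) *\<^sub>R a) \<bullet> z)^6))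
        - (sphere_mean r (\<lambda>z. ((x + 2 *\<^sub>R a) \<bullet> z)^6) - sphere_mean r (\<lambda>z. ((x + (-2) *\<^sub>R a) \<bullet> z)^6))
        - (sphere_mean r (\<lambda>z. ((a + 2 *\<^sub>R x) \<bullet> z)^6) - sphere_mean r (\<lambda>z. ((a + (-2) *\<^sub>R x) \<bullet> z)^6)))"
    using r by (simp only: sphere_mean_simps continuous_intros)
  also have "\<dots> = 15 * r^6 / (real CARD('n) * (real CARD('n) + 2) * (real CARD('n) + 4)) *
      ((9 * (norm x)\<^sup>2 * (norm a)\<^sup>2 * (x \<bullet> a) + 6 * (x \<bullet> a)^3) / 15)"
    unfolding sphere_mean_inner_6[OF r] norm_add_scale2 inner_commute[of a x]
    by (rule polar_33)
  finally show ?thesis by simp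
qed

end

lemma sphere_mean_inner_mixed:
  fixes x a :: "real^'n"
  assumes r: "r > 0"
  defines "I \<equiv> \<lambda>j k. sphere_mean r (\<lambda>z. (x \<bullet> z) ^ j * (a \<bullet> z) ^ k)"
    and "n \<equiv> real CARD('n)"
  shows "odd (j + k) \<Longrightarrow> I j k = 0"
    and "I 0 0 = 1"
    and "I 1 1 = r\<^sup>2 / n * (x \<bullet> a)"
    and "I 2 0 = r\<^sup>2 / n * (norm x)\<^sup>2"
    and "I 0 2 = r\<^sup>2 / n * (norm a)\<^sup>2"
    and "I 2 2 = r^4 / (n * (n + 2)) * ((norm x)\<^sup>2 * (norm a)\<^sup>2 + 2 * (x \<bullet> a)\<^sup>2)"
    and "I 3 1 = 3 * r^4 / (n * (n + 2)) * ((norm x)\<^sup>2 * (x \<bullet> a))"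
    and "I 1 3 = 3 * r^4 / (n * (n + 2)) * ((norm a)\<^sup>2 * (x \<bullet> a))"
    and "I 3 3 = r^6 / (n * (n + 2) * (n + 4)) * (9 * (norm x)\<^sup>2 * (norm a)\<^sup>2 * (x \<bullet> a) + 6 * (x \<bullet> a)^3)"
proof -
  show "I j k = 0" if "odd (j + k)"
    unfolding I_def using that by (intro sphere_mean_odd[OF r] continuous_intros) (cases "even j"; simp)
  show "I 1 3 = 3 * r^4 / (n * (n + 2)) * ((norm a)\<^sup>2 * (x \<bullet> a))"
    using sphere_mean_inner_3_1[OF r, of a x] by (simp add: I_def n_def inner_commute mult.commute)
qed (use r in \<open>simp_all add: I_def n_def sphere_mean_const sphere_mean_inner_1_1 sphere_mean_inner_2
    sphere_mean_inner_2_2 sphere_mean_inner_3_1 sphere_mean_inner_3_3\<close>)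

section \<open>The reproducing kernel\<close>

locale two_sphere_design =
  fixes X :: "(real^'n) set" and w :: "real^'n \<Rightarrow> real" and r s :: real
  assumes design: "euclidean_design 6 X w"
    and radii: "norm ` X = {r, s}" "r \<noteq> s" "0 < r" "0 < s"
begin

definition "dm = real CARD('n)"
definition "W \<rho> = (\<Sum>x\<in>X \<inter> sphere 0 \<rho>. w x)"
text \<open>\<open>M2\<close> and \<open>M3\<close> integrate the fourth and sixth power of the
  norm; they scale the inner product on harmonics of degree 2 and 3. \<open>\<kappa>2\<close> and
  \<open>\<kappa>3\<close> divide by them the leading coefficients of the zonal harmonics of the
  unit sphere, normalised so that the value at 1 is the dimension of the harmonic space.\<close>

definition "M2 = W r * r^4 + W s * s^4"
definition "M3 = W r * r^6 + W s * s^6"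
definition "\<kappa>2 = dm * (dm + 2) / (2 * M2)"
definition "\<kappa>3 = dm * (dm + 2) * (dm + 4) / (6 * M3)"

lemma finite_X: "finite X" and w_pos: "x \<in> X \<Longrightarrow> 0 < w x"
  using design by (auto simp: euclidean_design_def)

lemma radii_squares: "r\<^sup>2 \<noteq> s\<^sup>2"
  using radii by (simp add: power2_eq_iff_nonneg)

lemma dm_pos: "dm > 0" by (simp add: dm_def)

lemma W_pos: "\<rho> \<in> {r, s} \<Longrightarrow> W \<rho> > 0"
proof -
  assume "\<rho> \<in> {r, s}"
  then have "X \<inter> sphere 0 \<rho> \<noteq> {}" using radii(1) by force
  then show ?thesis unfolding W_def using finite_X w_pos by (intro sum_pos) auto
qed

lemma M_pos: "M2 > 0" "M3 > 0"
  using W_pos[of r] W_pos[of s] radii by (simp_all add: M2_def M3_def add_pos_pos)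

lemma design_sum:
  assumes "f \<in> Pol 6"
  shows "(\<Sum>x\<in>X. w x * f x) = W r * sphere_mean r f + W s * sphere_mean s f"
  using design assms radii by (simp add: euclidean_design_def W_def)

text \<open>The kernel is written out only for points of the first sphere; interchanging the radii
  supplies the other one.\<close>

lemma swap: "two_sphere_design X w s r"
  using design radii by unfold_locales auto

text \<open>Reproducing kernel of the polynomials of degree at most 3 on the two spheres, for \<open>x\<close> on the
  sphere of radius \<open>r\<close>. The first summand is the kernel for the harmonics of degree 0 and 1 times
  radial functions; the interpolating factor makes it vanish on the other sphere.\<close>

definition "ker x z = ((norm z)\<^sup>2 - s\<^sup>2) / (r\<^sup>2 - s\<^sup>2) * (1 + dm * (x \<bullet> z) / r\<^sup>2) / W r
  + \<kappa>2 * ((x \<bullet> z)\<^sup>2 - r\<^sup>2 * (norm z)\<^sup>2 / dm)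
  + \<kappa>3 * ((x \<bullet> z)^3 - 3 * r\<^sup>2 * (norm z)\<^sup>2 * (x \<bullet> z) / (dm + 2))"

lemma ker_Pol: "ker x \<in> Pol 3"
proof -
  have "(\<lambda>z. ((norm z)\<^sup>2 - s\<^sup>2) * (1 + (dm / r\<^sup>2) * (x \<bullet> z))) \<in> Pol (2 + 1)"
    by (intro Pol_mult Pol_diff Pol_add Pol_cmult Pol_norm2 Pol_const Pol_inner) simp
  then have 1: "(\<lambda>z. (1 / (r\<^sup>2 - s\<^sup>2) / W r) * (((norm z)\<^sup>2 - s\<^sup>2) * (1 + (dm / r\<^sup>2) * (x \<bullet> z)))) \<in> Pol 3"
    by (intro Pol_cmult) simp
  have 2: "(\<lambda>z. \<kappa>2 * ((x \<bullet> z)\<^sup>2 - (r\<^sup>2 / dm) * (norm z)\<^sup>2)) \<in> Pol 3"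
    by (rule Pol_mono[of _ 2], intro Pol_cmult Pol_diff Pol_inner_pow Pol_norm2) simp
  have 3: "(\<lambda>z. \<kappa>3 * ((x \<bullet> z)^3 - (3 * r\<^sup>2 / (dm + 2)) * ((norm z)\<^sup>2 * (x \<bullet> z)))) \<in> Pol 3"
    using Pol_mult[OF Pol_norm2 Pol_inner[of 1 x]]
    by (intro Pol_cmult Pol_diff Pol_inner_pow) simp
  show ?thesis
    using Pol_add[OF Pol_add[OF 1 2] 3] unfolding ker_def by (simp add: mult_ac)
qed

lemma ker_on_r:
  "norm z = r \<Longrightarrow> ker x z = (1 + dm * (x \<bullet> z) / r\<^sup>2) / W r
    + \<kappa>2 * ((x \<bullet> z)\<^sup>2 - r^4 / dm) + \<kappa>3 * ((x \<bullet> z)^3 - 3 * r^4 * (x \<bullet> z) / (dm + 2))"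
  using radii_squares by (simp add: ker_def)

lemma ker_on_s:
  "norm z = s \<Longrightarrow> ker x z =
    \<kappa>2 * ((x \<bullet> z)\<^sup>2 - r\<^sup>2 * s\<^sup>2 / dm) + \<kappa>3 * ((x \<bullet> z)^3 - 3 * r\<^sup>2 * s\<^sup>2 * (x \<bullet> z) / (dm + 2))"
  using radii by (simp add: ker_def mult_ac)

text \<open>For \<open>k \<le> 3\<close> the product has degree at most 6, so the design sum becomes
  a sum of sphere means. There each harmonic component of the power is reproduced by the kernel
  summand of the same degree.\<close>

lemma ker_reproduces_pow:
  assumes x: "norm x = r" and k: "k \<le> 3"
  shows "(\<Sum>z\<in>X. w z * (ker x z * (a \<bullet> z)^k)) = (a \<bullet> x)^k"
proof -
  define I where "I \<rho> j k = sphere_mean \<rho> (\<lambda>z. (x \<bullet> z)^j * (a \<bullet> z)^k)" for \<rho> j k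
  have "(\<lambda>z. ker x z * (a \<bullet> z)^k) \<in> Pol 6"
    using Pol_mult[OF ker_Pol Pol_mono[OF Pol_inner_pow k]] by simp
  then have "(\<Sum>z\<in>X. w z * (ker x z * (a \<bullet> z)^k)) =
      W r * sphere_mean r (\<lambda>z. ker x z * (a \<bullet> z)^k) + W s * sphere_mean s (\<lambda>z. ker x z * (a \<bullet> z)^k)"
    by (rule design_sum)
  also have "sphere_mean r (\<lambda>z. ker x z * (a \<bullet> z)^k) =
    sphere_mean r (\<lambda>z. (1 / W r) * ((x \<bullet> z)^0 * (a \<bullet> z)^k) + (dm / (r\<^sup>2 * W r)) * ((x \<bullet> z)^1 * (a \<bullet> z)^k)
      + \<kappa>2 * ((x \<bullet> z)^2 * (a \<bullet> z)^k) - (\<kappa>2 * r^4 / dm) * ((x \<bullet> z)^0 * (a \<bullet> z)^k)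
      + \<kappa>3 * ((x \<bullet> z)^3 * (a \<bullet> z)^k) - (\<kappa>3 * 3 * r^4 / (dm + 2)) * ((x \<bullet> z)^1 * (a \<bullet> z)^k))"
    by (rule sphere_mean_cong[OF radii(3)]) (simp add: ker_on_r add_divide_distrib algebra_simps)
  also have "\<dots> = (1 / W r) * I r 0 k + (dm / (r\<^sup>2 * W r)) * I r 1 k
      + \<kappa>2 * I r 2 k - (\<kappa>2 * r^4 / dm) * I r 0 k
      + \<kappa>3 * I r 3 k - (\<kappa>3 * 3 * r^4 / (dm + 2)) * I r 1 k"
    unfolding I_def using radii by (simp only: sphere_mean_simps continuous_intros)
  also have "sphere_mean s (\<lambda>z. ker x z * (a \<bullet> z)^k) =
    sphere_mean s (\<lambda>z. \<kappa>2 * ((x \<bullet> z)^2 * (a \<bullet> z)^k) - (\<kappa>2 * r\<^sup>2 * s\<^sup>2 / dm) * ((x \<bullet> z)^0 * (a \<bullet> z)^k)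
      + \<kappa>3 * ((x \<bullet> z)^3 * (a \<bullet> z)^k) - (\<kappa>3 * 3 * r\<^sup>2 * s\<^sup>2 / (dm + 2)) * ((x \<bullet> z)^1 * (a \<bullet> z)^k))"
    by (rule sphere_mean_cong[OF radii(4)]) (simp add: ker_on_s add_divide_distrib algebra_simps)
  also have "\<dots> = \<kappa>2 * I s 2 k - (\<kappa>2 * r\<^sup>2 * s\<^sup>2 / dm) * I s 0 k
      + \<kappa>3 * I s 3 k - (\<kappa>3 * 3 * r\<^sup>2 * s\<^sup>2 / (dm + 2)) * I s 1 k"
    unfolding I_def using radii by (simp only: sphere_mean_simps continuous_intros)
  finally have eq: "(\<Sum>z\<in>X. w z * (ker x z * (a \<bullet> z)^k)) =
    W r * ((1 / W r) * I r 0 k + (dm / (r\<^sup>2 * W r)) * I r 1 k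
      + \<kappa>2 * I r 2 k - (\<kappa>2 * r^4 / dm) * I r 0 k
      + \<kappa>3 * I r 3 k - (\<kappa>3 * 3 * r^4 / (dm + 2)) * I r 1 k)
    + W s * (\<kappa>2 * I s 2 k - (\<kappa>2 * r\<^sup>2 * s\<^sup>2 / dm) * I s 0 k
      + \<kappa>3 * I s 3 k - (\<kappa>3 * 3 * r\<^sup>2 * s\<^sup>2 / (dm + 2)) * I s 1 k)" .
  have odd: "I \<rho> j k = 0" if "odd (j + k)" "\<rho> > 0" for \<rho> j k
    using that sphere_mean_inner_mixed(1) unfolding I_def by blast
  note mix = sphere_mean_inner_mixed(2-9)[where x = x and a = a, folded I_def dm_def, unfolded x]
  have pos: "W r > 0" "W s > 0" "M2 > 0" "M3 > 0" "dm > 0" "dm + 2 > 0" "dm + 4 > 0" "r > 0" "s > 0"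
    using W_pos M_pos dm_pos radii by auto
  define A P where "A = (norm a)\<^sup>2" and "P = x \<bullet> a"
  note mix' = mix[folded A_def P_def]
  from k consider "k = 0" | "k = 1" | "k = 2" | "k = 3" by linarith
  then show ?thesis
  proof cases
    case 1
    show ?thesis unfolding eq unfolding 1 using pos
      by (simp add: odd mix'[OF radii(3)] mix'[OF radii(4)] x)
  next
    case 2
    have "W r * (dm / (r\<^sup>2 * W r) * (r\<^sup>2 / dm * P)) = P" using pos by (simp add: field_simps)
    \<comment> \<open>The cubic summand is orthogonal to linear forms on each sphere
      separately.\<close>
    moreover have "\<kappa>3 * (3 * \<rho>^4 / (dm * (dm + 2)) * (r\<^sup>2 * P)) = \<kappa>3 * 3 * r\<^sup>2 * \<rho>\<^sup>2 / (dm + 2) * (\<rho>\<^sup>2 / dm * P)"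
      for \<rho> using pos by (simp add: field_simps eval_nat_numeral)
    ultimately show ?thesis unfolding eq unfolding 2 using pos
      by (simp add: odd mix'[OF radii(3), simplified] mix'[OF radii(4), simplified] distrib_left right_diff_distrib)
        (simp add: inner_commute P_def eval_nat_numeral mult_ac)
  next
    case 3
    \<comment> \<open>The degree 0 component \<open>r\<^sup>2 * A / dm\<close> of the square comes
      from the first kernel summand. The harmonic remainder gets the share
      \<open>W \<rho> * (\<rho>^4 / M2)\<close> from the sphere of radius \<open>\<rho>\<close>, and
      the shares add up to 1.\<close>
    have a: "\<kappa>2 * (\<rho>^4 / (dm * (dm + 2)) * (r\<^sup>2 * A + 2 * P\<^sup>2)) - \<kappa>2 * r\<^sup>2 * \<rho>\<^sup>2 / dm * (\<rho>\<^sup>2 / dm * A)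
      = (P\<^sup>2 - r\<^sup>2 * A / dm) * (\<rho>^4 / M2)" for \<rho>
      unfolding \<kappa>2_def using pos by (simp add: divide_simps) (simp add: algebra_simps eval_nat_numeral)
    have b: "W r * (1 / W r * (r\<^sup>2 / dm * A)) = r\<^sup>2 * A / dm" using pos by simp
    have c: "W r * (r^4 / M2) + W s * (s^4 / M2) = 1"
      using pos by (simp add: M2_def flip: add_divide_distrib)
    have odd0: "I r 1 2 = 0" "I s 1 2 = 0" "I r 3 2 = 0" "I s 3 2 = 0"
      using odd pos by simp_all
    have "(\<Sum>z\<in>X. w z * (ker x z * (a \<bullet> z)^k)) = W r * (1 / W r * (r\<^sup>2 / dm * A))
       + W r * (\<kappa>2 * (r^4 / (dm * (dm + 2)) * (r\<^sup>2 * A + 2 * P\<^sup>2)) - \<kappa>2 * r\<^sup>2 * r\<^sup>2 / dm * (r\<^sup>2 / dm * A))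
       + W s * (\<kappa>2 * (s^4 / (dm * (dm + 2)) * (r\<^sup>2 * A + 2 * P\<^sup>2)) - \<kappa>2 * r\<^sup>2 * s\<^sup>2 / dm * (s\<^sup>2 / dm * A))"
      unfolding eq unfolding 3
      unfolding odd0 mix'[OF radii(3)] mix'[OF radii(4)] by (simp add: algebra_simps)
    also have "\<dots> = r\<^sup>2 * A / dm + (P\<^sup>2 - r\<^sup>2 * A / dm) * (W r * (r^4 / M2) + W s * (s^4 / M2))"
      unfolding a b by (simp add: algebra_simps add_divide_distrib)
    finally show ?thesis unfolding c 3 by (simp add: P_def inner_commute)
  next
    case 4
    \<comment> \<open>The same splitting for the cube: its degree 1 component is
      \<open>3 * r\<^sup>2 * A * P / (dm + 2)\<close>, and the remainder is shared according to
      \<open>\<rho>^6 / M3\<close>.\<close>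
    have a: "\<kappa>3 * (\<rho>^6 / (dm * (dm + 2) * (dm + 4)) * (9 * r\<^sup>2 * A * P + 6 * P^3))
        - \<kappa>3 * 3 * r\<^sup>2 * \<rho>\<^sup>2 / (dm + 2) * (3 * \<rho>^4 / (dm * (dm + 2)) * (A * P))
      = (P^3 - 3 * r\<^sup>2 * A * P / (dm + 2)) * (\<rho>^6 / M3)" for \<rho>
      unfolding \<kappa>3_def using pos by (simp add: divide_simps) (simp add: algebra_simps eval_nat_numeral)
    have b: "W r * (dm / (r\<^sup>2 * W r) * (3 * r^4 / (dm * (dm + 2)) * (A * P))) = 3 * r\<^sup>2 * A * P / (dm + 2)"
      using pos by (simp add: divide_simps eval_nat_numeral)
    have c: "W r * (r^6 / M3) + W s * (s^6 / M3) = 1"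
      using pos by (simp add: M3_def flip: add_divide_distrib)
    have odd0: "I r 0 3 = 0" "I s 0 3 = 0" "I r 2 3 = 0" "I s 2 3 = 0"
      using odd pos by simp_all
    have "(\<Sum>z\<in>X. w z * (ker x z * (a \<bullet> z)^k)) = W r * (dm / (r\<^sup>2 * W r) * (3 * r^4 / (dm * (dm + 2)) * (A * P)))
       + W r * (\<kappa>3 * (r^6 / (dm * (dm + 2) * (dm + 4)) * (9 * r\<^sup>2 * A * P + 6 * P^3))
        - \<kappa>3 * 3 * r\<^sup>2 * r\<^sup>2 / (dm + 2) * (3 * r^4 / (dm * (dm + 2)) * (A * P)))
       + W s * (\<kappa>3 * (s^6 / (dm * (dm + 2) * (dm + 4)) * (9 * r\<^sup>2 * A * P + 6 * P^3))
        - \<kappa>3 * 3 * r\<^sup>2 * s\<^sup>2 / (dm + 2) * (3 * s^4 / (dm * (dm + 2)) * (A * P)))"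
      unfolding eq unfolding 4
      unfolding odd0 mix'[OF radii(3)] mix'[OF radii(4)] by (simp add: algebra_simps)
    also have "\<dots> = 3 * r\<^sup>2 * A * P / (dm + 2) + (P^3 - 3 * r\<^sup>2 * A * P / (dm + 2)) * (W r * (r^6 / M3) + W s * (s^6 / M3))"
      unfolding a b by (simp add: algebra_simps add_divide_distrib)
    finally show ?thesis unfolding c 4 by (simp add: P_def inner_commute)
  qed
qed

lemma ker_reproduces:
  assumes x: "norm x = r" and f: "f \<in> Pol 3"
  shows "(\<Sum>z\<in>X. w z * (ker x z * f z)) = f x"
  using f
proof (rule Pol_3_induct)
  fix f g assume "(\<Sum>z\<in>X. w z * (ker x z * f z)) = f x" "(\<Sum>z\<in>X. w z * (ker x z * g z)) = g x"
  then show "(\<Sum>z\<in>X. w z * (ker x z * (f z + g z))) = f x + g x"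
    by (simp add: algebra_simps sum.distrib)
next
  fix c f assume "(\<Sum>z\<in>X. w z * (ker x z * f z)) = f x"
  then show "(\<Sum>z\<in>X. w z * (ker x z * (c * f z))) = c * f x"
    by (simp add: mult.left_commute[of _ c] flip: sum_distrib_left)
qed (rule ker_reproduces_pow[OF x])

end

section \<open>Tightness\<close>

interpretation fun_space_pair: vector_space_pair "\<lambda>(c::real) (f::'a \<Rightarrow> real) x. c * f x"
  "\<lambda>(c::real) (f::'b \<Rightarrow> real) x. c * f x"
  by unfold_locales

text \<open>Extension by zero, as in \<open>Pol_on\<close>, keeps all restrictions inside one
  function space, so that restrictions to the spheres and to \<open>X\<close> are linear
  endomorphisms that can be composed.\<close>

definition restr :: "'a set \<Rightarrow> ('a \<Rightarrow> real) \<Rightarrow> 'a \<Rightarrow> real" where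
  "restr S f = (\<lambda>x. if x \<in> S then f x else 0)"

lemma Pol_on_restr: "Pol_on t S = restr S ` Pol t"
  by (simp add: Pol_on_def restr_def)

lemma linear_restr: "Vector_Spaces.linear (\<lambda>(c::real) f x. c * f x) (\<lambda>c f x. c * f x) (restr S)"
  by unfold_locales (auto simp: restr_def fun_eq_iff)

lemma subspace_Pol: "fun_space.subspace (Pol t)"
  by (rule fun_space.subspaceI) (simp_all add: zero_fun_def plus_fun_def Pol_zero Pol_add Pol_cmult)

lemma sum_fun_eq: "(\<Sum>i\<in>I. f i) = (\<lambda>x. \<Sum>i\<in>I. f i x)" for f :: "'i \<Rightarrow> 'a \<Rightarrow> real"
  by (rule ext) (induction I rule: infinite_finite_induct, auto)

lemma Pol_subset_span: "Pol t \<subseteq> fun_space.span (monom_fun ` exponents_le t)"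
proof
  fix f :: "real^'n \<Rightarrow> real" assume "f \<in> Pol t"
  then obtain c where "f = (\<lambda>x. \<Sum>\<alpha>\<in>exponents_le t. c \<alpha> * monom_fun \<alpha> x)" unfolding Pol_iff by blast
  then have f: "f = (\<Sum>\<alpha>\<in>exponents_le t. (\<lambda>x. c \<alpha> * monom_fun \<alpha> x))" by (simp add: sum_fun_eq)
  show "f \<in> fun_space.span (monom_fun ` exponents_le t)"
    unfolding f by (intro fun_space.span_sum fun_space.span_scale fun_space.span_base) auto
qed

text \<open>A nonzero polynomial vanishing on \<open>S\<close> could be extended to a basis of
  \<open>Pol t\<close>; restriction kills that basis vector, so the dimension would drop.\<close>

lemma Pol_vanishing_eq_0:
  fixes f :: "real^'n \<Rightarrow> real"
  assumes dim: "fun_dim (Pol_on t S) = fun_dim (Pol t :: (real^'n \<Rightarrow> real) set)"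
    and f: "f \<in> Pol t" "\<And>x. x \<in> S \<Longrightarrow> f x = 0"
  shows "f = (\<lambda>x. 0)"
proof (rule ccontr)
  assume "f \<noteq> (\<lambda>x. 0)"
  then have "fun_space.independent {f}" by (simp add: zero_fun_def)
  then obtain B where B: "{f} \<subseteq> B" "B \<subseteq> Pol t" "fun_space.independent B" "Pol t \<subseteq> fun_space.span B"
    using fun_space.maximal_independent_subset_extend[of "{f}" "Pol t"] f(1) by auto
  have fin: "finite B"
    using fun_space.independent_span_bound[OF finite_imageI[OF finite_exponents_le] B(3)] B(2) Pol_subset_span
    by blast
  have card: "card B = fun_dim (Pol t :: (real^'n \<Rightarrow> real) set)"
    unfolding fun_dim_def by (rule fun_space.basis_card_eq_dim[OF B(2,4,3)])
  have "restr S f = 0" using f(2) by (auto simp: restr_def)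
  then have "restr S ` B = insert 0 (restr S ` (B - {f}))" using B(1) by auto
  then have sp: "fun_space.span (restr S ` B) = fun_space.span (restr S ` (B - {f}))" by simp
  have "Pol_on t S \<subseteq> fun_space.span (restr S ` B)"
    using B(4) unfolding Pol_on_restr fun_space_pair.linear_span_image[OF linear_restr] by blast
  then have "fun_dim (Pol_on t S) \<le> card (restr S ` (B - {f}))"
    unfolding fun_dim_def sp by (rule fun_space.dim_le_card) (simp add: fin)
  also have "\<dots> \<le> card (B - {f})" by (rule card_image_le) (simp add: fin)
  also have "\<dots> < card B" using B(1) fin by (intro psubset_card_mono) auto
  finally show False using dim card by simp
qed

text \<open>Restriction from \<open>S\<close> to \<open>X\<close> is injective by
  \<open>inj\<close>, and the dimension equals the number of points. Hence it is onto and reaches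
  the indicator of \<open>y\<close>.\<close>

lemma Pol_interpolation:
  fixes X :: "(real^'n) set"
  assumes X: "finite X" "y \<in> X" "X \<subseteq> S" and card: "card X = fun_dim (Pol_on t S)"
    and inj: "\<And>g x. g \<in> Pol t \<Longrightarrow> (\<And>x. x \<in> X \<Longrightarrow> g x = 0) \<Longrightarrow> x \<in> S \<Longrightarrow> g x = 0"
  shows "\<exists>g\<in>Pol t. \<forall>x\<in>X. g x = (if x = y then 1 else 0)"
proof -
  obtain B where B: "B \<subseteq> Pol_on t S" "fun_space.independent B" "Pol_on t S \<subseteq> fun_space.span B"
    "card B = fun_dim (Pol_on t S)"
    unfolding fun_dim_def using fun_space.basis_exists by blast
  have cX: "card X > 0" using X by (auto simp: card_gt_0_iff)
  then have fB: "finite B" using B(4) card card_ge_0_finite[of B] by simp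
  have "fun_space.subspace (Pol_on t S)"
    unfolding Pol_on_restr by (rule fun_space_pair.linear_subspace_image[OF linear_restr subspace_Pol])
  then have sp: "fun_space.span B = Pol_on t S"
    using B(1,3) fun_space.span_minimal by blast
  have injR: "inj_on (restr X) (fun_space.span B)"
  proof (rule inj_onI)
    fix f g assume fg: "f \<in> fun_space.span B" "g \<in> fun_space.span B" "restr X f = restr X g"
    then obtain p q where p: "p \<in> Pol t" "f = restr S p" and q: "q \<in> Pol t" "g = restr S q"
      unfolding sp Pol_on_restr by auto
    have "p x - q x = 0" if "x \<in> X" for x
      using fun_cong[OF fg(3), of x] that X(3) by (auto simp: restr_def p q)
    then have "p x - q x = 0" if "x \<in> S" for x
      using inj[OF Pol_diff[OF p(1) q(1)]] that by blast
    then show "f = g" unfolding p q restr_def by auto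
  qed
  define ind :: "real^'n \<Rightarrow> real^'n \<Rightarrow> real" where "ind x = (\<lambda>z. if z = x then 1 else 0)" for x
  have RB: "fun_space.independent (restr X ` B)"
    by (rule fun_space_pair.linear_independent_injective_image[OF linear_restr B(2) injR])
  have "inj_on (restr X) B" using inj_on_subset[OF injR fun_space.span_superset] .
  then have cRB: "card (restr X ` B) = card X" using card B(4) by (simp add: card_image)
  have sub: "restr X h \<in> fun_space.span (ind ` X)" for h
  proof -
    have "restr X h = (\<Sum>x\<in>X. (\<lambda>z. h x * ind x z))"
      unfolding sum_fun_eq using X(1)
      by (auto simp: restr_def ind_def fun_eq_iff if_distrib[where f = "\<lambda>c. _ * c"] sum.delta' cong: if_cong)
    also have "\<dots> \<in> fun_space.span (ind ` X)"
      by (intro fun_space.span_sum fun_space.span_scale fun_space.span_base imageI)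
    finally show ?thesis .
  qed
  have "ind y \<in> fun_space.span (restr X ` B)"
  proof (rule ccontr)
    assume n: "ind y \<notin> fun_space.span (restr X ` B)"
    then have ind: "fun_space.independent (insert (ind y) (restr X ` B))"
      by (rule fun_space.independent_insertI[OF _ RB])
    have "insert (ind y) (restr X ` B) \<subseteq> fun_space.span (ind ` X)"
    proof (intro insert_subsetI image_subsetI sub)
      show "ind y \<in> fun_space.span (ind ` X)" using X(2) by (intro fun_space.span_base imageI)
    qed
    from fun_space.independent_span_bound[OF finite_imageI[OF X(1)] ind this]
    have "card (insert (ind y) (restr X ` B)) \<le> card X" using card_image_le[OF X(1), of ind] by linarith
    moreover have "ind y \<notin> restr X ` B" by (rule contra_subsetD[OF fun_space.span_superset n])
    ultimately show False
      using card_insert_disjoint[OF finite_imageI[OF fB]] cRB by (metis Suc_n_not_le_n)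
  qed
  then have "ind y \<in> restr X ` Pol_on t S"
    unfolding fun_space_pair.linear_span_image[OF linear_restr] sp .
  then obtain p where p: "p \<in> Pol t" "ind y = restr X (restr S p)" unfolding Pol_on_restr by auto
  have "p x = (if x = y then 1 else 0)" if "x \<in> X" for x
    using fun_cong[OF p(2), of x] that X(3) by (auto simp: restr_def ind_def)
  then show ?thesis using p(1) by blast
qed

text \<open>If one sphere were the origin, a coordinate times
  \<open>(norm x)\<^sup>2 - s\<^sup>2\<close> would be a nonzero cubic vanishing on the support,
  against the equality of dimensions required by tightness.\<close>

lemma tight_radii_pos:
  fixes X :: "(real^'n) set"
  assumes tight: "tight_euclidean_design 3 X w" and R: "norm ` X = {r, s}" "r \<noteq> s"
  shows "0 < r"
proof (rule ccontr)
  assume "\<not> 0 < r"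
  moreover have "0 \<le> r" "0 \<le> s"
    using R(1) by (metis imageE insertI1 norm_ge_zero, metis imageE insertCI norm_ge_zero)
  ultimately have r: "r = 0" and s: "s > 0" using R(2) by auto
  define i :: 'n where "i = undefined"
  define f where "f x = x $ i * ((norm x)\<^sup>2 - s\<^sup>2)" for x :: "real^'n"
  have "f \<in> Pol (1 + 2)"
    unfolding f_def by (intro Pol_mult Pol_nth Pol_diff Pol_norm2 Pol_const) simp
  then have "f \<in> Pol 3" by (simp add: numeral_3_eq_3)
  moreover have "f x = 0" if "x \<in> support_spheres X" for x
    using that unfolding support_spheres_def R(1) r by (auto simp: f_def)
  ultimately have "f = (\<lambda>x. 0)"
    using tight by (intro Pol_vanishing_eq_0[of 3 "support_spheres X"]) (auto simp: tight_euclidean_design_def)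
  \<comment> \<open>A point of the coordinate axis off the sphere of radius \<open>s\<close>, where
    neither factor of \<open>f\<close> vanishes.\<close>
  then have "f ((s + 1) *\<^sub>R axis i 1) = 0" by simp
  moreover have "(s + 1)\<^sup>2 \<noteq> s\<^sup>2" using s by (simp add: power2_eq_iff_nonneg)
  ultimately show False using s by (simp add: f_def)
qed

locale tight_two_sphere_design = two_sphere_design X w r s for X :: "(real^'n) set" and w r s +
  assumes tight: "tight_euclidean_design 3 X w"
begin

lemma swap_tight: "tight_two_sphere_design X w s r"
  using swap tight by (simp add: tight_two_sphere_design_def tight_two_sphere_design_axioms_def)

sublocale sw: two_sphere_design X w s r
  by (rule swap)

text \<open>The reproducing property is used twice: it expresses values on the spheres by values on
  \<open>X\<close>, which makes restriction to \<open>X\<close> injective, and applied to the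
  interpolating polynomial of \<open>y\<close> it isolates a single term.\<close>

lemma ker_eq_delta:
  assumes x: "x \<in> X" "norm x = r" and y: "y \<in> X"
  shows "w y * ker x y = (if x = y then 1 else 0)"
proof -
  have S: "support_spheres X = sphere 0 r \<union> sphere 0 s"
    by (simp add: support_spheres_def radii(1))
  have "\<exists>g\<in>Pol 3. \<forall>x\<in>X. g x = (if x = y then 1 else 0)"
  proof (rule Pol_interpolation[OF finite_X y, where S = "support_spheres X"])
    show "X \<subseteq> support_spheres X" by (auto simp: support_spheres_def)
    show "card X = fun_dim (Pol_on 3 (support_spheres X))"
      using tight by (simp add: tight_euclidean_design_def)
    fix g z assume g: "g \<in> Pol 3" "\<And>x. x \<in> X \<Longrightarrow> g x = 0" and "z \<in> support_spheres X"
    then consider "norm z = r" | "norm z = s" unfolding S by auto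
    then show "g z = 0"
      using ker_reproduces[OF _ g(1), of z] sw.ker_reproduces[OF _ g(1), of z] g(2) by cases auto
  qed
  then obtain g where g: "g \<in> Pol 3" "\<And>x. x \<in> X \<Longrightarrow> g x = (if x = y then 1 else 0)" by blast
  have "g x = (\<Sum>z\<in>X. w z * (ker x z * g z))" using ker_reproduces[OF x(2) g(1)] by simp
  also have "\<dots> = (\<Sum>z\<in>X. if z = y then w z * ker x z else 0)" by (intro sum.cong) (auto simp: g(2))
  also have "\<dots> = w y * ker x y" using y finite_X by simp
  finally show ?thesis using g(2)[OF x(1)] by simp
qed

end

section \<open>Weights, cardinalities and moments read off from the kernel\<close>

context tight_two_sphere_design
begin

lemma sw_consts: "sw.M2 = M2" "sw.M3 = M3" "sw.\<kappa>2 = \<kappa>2" "sw.\<kappa>3 = \<kappa>3"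
  unfolding sw.\<kappa>2_def sw.\<kappa>3_def \<kappa>2_def \<kappa>3_def sw.M2_def sw.M3_def M2_def M3_def by simp_all

text \<open>On the diagonal the kernel has one value \<open>D\<close> on the whole sphere, so every
  weight there is \<open>1 / D\<close> and the number of points is \<open>W r * D\<close>. The
  factors \<open>(dm + 2) * (dm - 1) / 2\<close> and \<open>dm * (dm + 4) * (dm - 1) / 6\<close> are
  the dimensions of the harmonics of degree 2 and 3.\<close>

lemma weight_const:
  assumes x: "x \<in> X" "norm x = r"
  shows "w x = W r / real (card (X \<inter> sphere 0 r))"
    and "real (card (X \<inter> sphere 0 r)) = 1 + dm + (W r * r^4 / M2) * ((dm + 2) * (dm - 1) / 2)
       + (W r * r^6 / M3) * (dm * (dm + 4) * (dm - 1) / 6)"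
proof -
  define D where "D = (1 + dm) / W r + \<kappa>2 * (r^4 - r^4 / dm) + \<kappa>3 * (r^6 - 3 * r^6 / (dm + 2))"
  have pos: "W r > 0" "M2 > 0" "M3 > 0" "dm > 0" "r > 0"
    using W_pos M_pos dm_pos radii by auto
  have wD: "w z * D = 1" if z: "z \<in> X" "norm z = r" for z
  proof -
    have "z \<bullet> z = r\<^sup>2" using z(2) power2_norm_eq_inner[of z] by simp
    then have "ker z z = D"
      using pos unfolding D_def by (subst ker_on_r[OF z(2)]) (simp add: eval_nat_numeral mult_ac)
    then show ?thesis using ker_eq_delta[OF z z(1)] by simp
  qed
  then have D0: "D \<noteq> 0" using x by force
  have wz: "w z = 1 / D" if "z \<in> X" "norm z = r" for z
    using wD[OF that] D0 by (simp add: field_simps)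
  have W: "W r = real (card (X \<inter> sphere 0 r)) * (1 / D)"
    unfolding W_def by (subst sum.cong[OF refl, of _ _ "\<lambda>_. 1 / D"]) (auto simp: wz)
  then have c: "real (card (X \<inter> sphere 0 r)) = W r * D" using D0 by simp
  show "w x = W r / real (card (X \<inter> sphere 0 r))"
    unfolding c wz[OF x] using pos D0 by simp
  have "W r * ((1 + dm) / W r) = 1 + dm" using pos by simp
  moreover have "W r * (\<kappa>2 * (r^4 - r^4 / dm)) = (W r * r^4 / M2) * ((dm + 2) * (dm - 1) / 2)"
    unfolding \<kappa>2_def using pos by (simp add: field_simps)
  moreover have "W r * (\<kappa>3 * (r^6 - 3 * r^6 / (dm + 2))) = (W r * r^6 / M3) * (dm * (dm + 4) * (dm - 1) / 6)"
  proof -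
    have "r^6 - 3 * r^6 / (dm + 2) = r^6 * (dm - 1) / (dm + 2)" using pos by (simp add: field_simps)
    then show ?thesis unfolding \<kappa>3_def using pos by (simp add: divide_simps)
  qed
  ultimately show "real (card (X \<inter> sphere 0 r)) = 1 + dm + (W r * r^4 / M2) * ((dm + 2) * (dm - 1) / 2)
       + (W r * r^6 / M3) * (dm * (dm + 4) * (dm - 1) / 6)"
    unfolding c D_def distrib_left by linarith
qed

lemma sphere_nonempty: obtains x where "x \<in> X" "norm x = r"
  using radii(1) by (metis imageE insertI1)

lemmas card_r = weight_const(2)

lemma cross_inner_root:
  assumes "x \<in> X" "norm x = r" "y \<in> X" "norm y = s"
  shows "\<kappa>2 * ((x \<bullet> y / (r * s))\<^sup>2 - 1 / dm) + \<kappa>3 * r * s * ((x \<bullet> y / (r * s))^3 - 3 * (x \<bullet> y / (r * s)) / (dm + 2)) = 0"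
proof -
  define u where "u = x \<bullet> y / (r * s)"
  have u: "x \<bullet> y = r * s * u" using radii by (simp add: u_def)
  have "x \<noteq> y" using assms radii by auto
  then have "ker x y = 0" using ker_eq_delta[OF assms(1-3)] w_pos[OF assms(3)] by simp
  then have "r\<^sup>2 * s\<^sup>2 * (\<kappa>2 * (u\<^sup>2 - 1 / dm) + \<kappa>3 * r * s * (u^3 - 3 * u / (dm + 2))) = 0"
    unfolding ker_on_s[OF assms(4)] u
    by (simp add: algebra_simps power2_eq_square power3_eq_cube)
  then show ?thesis using radii by (simp add: u_def)
qed

text \<open>Multiplying by \<open>(norm z)\<^sup>2 - s\<^sup>2\<close> removes the other sphere at
  the cost of two degrees, which leaves strength 4. Constancy of the weights then turns the weighted
  sum into a plain one.\<close>

lemma sphere_design_sum: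
  assumes k: "k \<le> 4"
  shows "(\<Sum>y\<in>X \<inter> sphere 0 r. (v \<bullet> y)^k) = real (card (X \<inter> sphere 0 r)) * sphere_mean r (\<lambda>z. (v \<bullet> z)^k)"
proof -
  let ?N = "real (card (X \<inter> sphere 0 r))"
  obtain x where x: "x \<in> X" "norm x = r" by (rule sphere_nonempty)
  then have N: "?N > 0" using finite_X by (auto simp: card_gt_0_iff)
  have Wr: "W r > 0" using W_pos by simp
  let ?f = "\<lambda>z. ((norm z)\<^sup>2 - s\<^sup>2) * (v \<bullet> z)^k"
  have "?f \<in> Pol (2 + 4)"
    by (intro Pol_mult Pol_diff Pol_norm2 Pol_const) (rule Pol_mono[OF Pol_inner_pow k])
  then have "(\<Sum>z\<in>X. w z * ?f z) = W r * sphere_mean r ?f + W s * sphere_mean s ?f"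
    by (intro design_sum) simp
  also have "sphere_mean r ?f = sphere_mean r (\<lambda>z. (r\<^sup>2 - s\<^sup>2) * (v \<bullet> z)^k)"
    by (rule sphere_mean_cong[OF radii(3)]) simp
  also have "\<dots> = (r\<^sup>2 - s\<^sup>2) * sphere_mean r (\<lambda>z. (v \<bullet> z)^k)" by (rule sphere_mean_cmult[OF radii(3)])
  also have "sphere_mean s ?f = sphere_mean s (\<lambda>z::real^'n. 0)"
    by (rule sphere_mean_cong[OF radii(4)]) simp
  also have "\<dots> = 0" by (rule sphere_mean_const[OF radii(4)])
  also have "(\<Sum>z\<in>X. w z * ?f z) = (\<Sum>z\<in>X \<inter> sphere 0 r. w z * ?f z)"
    using radii(1) finite_X by (intro sum.mono_neutral_right) auto
  also have "\<dots> = (\<Sum>z\<in>X \<inter> sphere 0 r. W r / ?N * (r\<^sup>2 - s\<^sup>2) * (v \<bullet> z)^k)"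
    by (intro sum.cong) (auto simp: weight_const(1))
  also have "\<dots> = W r / ?N * (r\<^sup>2 - s\<^sup>2) * (\<Sum>z\<in>X \<inter> sphere 0 r. (v \<bullet> z)^k)" by (simp add: sum_distrib_left)
  finally have "(W r * (r\<^sup>2 - s\<^sup>2)) * (\<Sum>z\<in>X \<inter> sphere 0 r. (v \<bullet> z)^k) =
      (W r * (r\<^sup>2 - s\<^sup>2)) * (?N * sphere_mean r (\<lambda>z. (v \<bullet> z)^k))"
    using N by (simp add: field_simps)
  then show ?thesis using Wr radii_squares by simp
qed

lemma sphere_design_moments:
  assumes x: "norm x = s"
  defines "N \<equiv> real (card (X \<inter> sphere 0 r))" and "u \<equiv> \<lambda>y. x \<bullet> y / (r * s)"
  shows "(\<Sum>y\<in>X \<inter> sphere 0 r. u y) = 0"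
    and "(\<Sum>y\<in>X \<inter> sphere 0 r. (u y)\<^sup>2) = N / dm"
    and "(\<Sum>y\<in>X \<inter> sphere 0 r. (u y)^3) = 0"
    and "(\<Sum>y\<in>X \<inter> sphere 0 r. (u y)^4) = N * (3 / (dm * (dm + 2)))"
proof -
  define v where "v = (1 / (r * s)) *\<^sub>R x"
  have u: "u y = v \<bullet> y" for y by (simp add: u_def v_def)
  have nv: "norm v = 1 / r" using x radii by (simp add: v_def)
  note d = sphere_design_sum[where v = v, folded u, folded N_def]
  have "(\<Sum>y\<in>X \<inter> sphere 0 r. u y ^ 1) = 0"
    using sphere_mean_inner_odd[OF radii(3), of 1 v] by (subst d) (simp_all add: u[abs_def])
  then show "(\<Sum>y\<in>X \<inter> sphere 0 r. u y) = 0" by simp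
  show "(\<Sum>y\<in>X \<inter> sphere 0 r. (u y)^3) = 0"
    by (subst d) (simp_all add: u sphere_mean_inner_odd[OF radii(3)])
  show "(\<Sum>y\<in>X \<inter> sphere 0 r. (u y)\<^sup>2) = N / dm"
    using radii by (subst d) (simp_all add: u sphere_mean_inner_2[OF radii(3)] nv dm_def field_simps)
  show "(\<Sum>y\<in>X \<inter> sphere 0 r. (u y)^4) = N * (3 / (dm * (dm + 2)))"
    using radii by (subst d) (simp_all add: u sphere_mean_inner_4[OF radii(3)] nv dm_def power_divide)
qed

end

text \<open>Whenever the context is reopened, the facts proved so far become available under \<open>tw\<close> with the
  two radii interchanged.\<close>

context tight_two_sphere_design
begin

sublocale tw: tight_two_sphere_design X w s r
  by (rule swap_tight)

text \<open>In degrees 2 and 3 the shares of the two spheres add up to 1, so the unknown weights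
  cancel.\<close>

lemma card_sum:
  "real (card (X \<inter> sphere 0 r)) + real (card (X \<inter> sphere 0 s)) =
    2 * (1 + dm) + (dm + 2) * (dm - 1) / 2 + dm * (dm + 4) * (dm - 1) / 6"
proof -
  obtain x where x: "x \<in> X" "norm x = r" by (rule sphere_nonempty)
  obtain y where y: "y \<in> X" "norm y = s" by (rule tw.sphere_nonempty)
  have "W r * r^4 / M2 + W s * s^4 / M2 = 1" "W r * r^6 / M3 + W s * s^6 / M3 = 1"
    using M_pos by (simp_all add: M2_def M3_def flip: add_divide_distrib)
  then have e: "W s * s^4 / M2 = 1 - W r * r^4 / M2" "W s * s^6 / M3 = 1 - W r * r^6 / M3" by simp_all
  have gen: "(1 + d + a * h + b * k) + (1 + d + (1 - a) * h + (1 - b) * k) = 2 * (1 + d) + h + k"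
    for a b d h k :: real by algebra
  show ?thesis
    unfolding card_r[OF x] tw.card_r[OF y] sw_consts e by (rule gen)
qed

end

section \<open>Quadrature rules with three nodes\<close>

lemma sum_fibres_3:
  fixes u :: "'a \<Rightarrow> real"
  assumes Z: "finite Z" and im: "u ` Z \<subseteq> {a, b, c}" and d: "a \<noteq> b" "a \<noteq> c" "b \<noteq> c"
  shows "(\<Sum>z\<in>Z. f (u z)) = real (card {z\<in>Z. u z = a}) * f a + real (card {z\<in>Z. u z = b}) * f b
    + real (card {z\<in>Z. u z = c}) * f c"
proof -
  have "(\<Sum>z\<in>Z. f (u z)) = (\<Sum>y\<in>{a, b, c}. \<Sum>z\<in>{z\<in>Z. u z = y}. f (u z))"
    using Z im by (intro sum.group[symmetric]) auto
  also have "\<dots> = (\<Sum>y\<in>{a, b, c}. real (card {z\<in>Z. u z = y}) * f y)"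
    by (intro sum.cong) auto
  finally show ?thesis using d by simp
qed

text \<open>A finite family of reals with the first four moments of the uniform distribution on the sphere,
  projected to an axis.\<close>

locale moment_family =
  fixes Z :: "'a set" and u :: "'a \<Rightarrow> real" and d :: real
  assumes finite_Z: "finite Z" and Z_ne: "Z \<noteq> {}" and d: "d \<ge> 2"
    and m1: "(\<Sum>z\<in>Z. u z) = 0"
    and m2: "(\<Sum>z\<in>Z. (u z)\<^sup>2) = card Z / d"
    and m3: "(\<Sum>z\<in>Z. (u z)^3) = 0"
    and m4: "(\<Sum>z\<in>Z. (u z)^4) = card Z * (3 / (d * (d + 2)))"
begin

lemma card_pos: "real (card Z) > 0" using finite_Z Z_ne by (simp add: card_gt_0_iff)

lemma sum_quadratic: "(\<Sum>z\<in>Z. (u z - p) * (u z - q)) = card Z * (1 / d + p * q)"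
proof -
  have "(\<Sum>z\<in>Z. (u z - p) * (u z - q)) = (\<Sum>z\<in>Z. (u z)\<^sup>2 - (p + q) * u z + p * q)"
    by (intro sum.cong) (auto simp: algebra_simps power2_eq_square)
  then show ?thesis
    by (simp add: sum.distrib sum_subtractf m1 m2 algebra_simps flip: sum_distrib_left)
qed

text \<open>The average of \<open>((u z - p) * (u z - q))\<^sup>2\<close> is a sum of nonnegative
  terms plus the excess of the fourth moment over the square of the second, which is positive for
  \<open>d \<ge> 2\<close>.\<close>

lemma not_two_valued: "\<not> u ` Z \<subseteq> {p, q}"
proof
  assume sub: "u ` Z \<subseteq> {p, q}"
  have "0 = (\<Sum>z\<in>Z. ((u z - p) * (u z - q))\<^sup>2)"
    using sub by (intro sum.neutral[symmetric]) auto
  also have "\<dots> = (\<Sum>z\<in>Z. (u z)^4 - 2 * (p + q) * (u z)^3 + ((p + q)\<^sup>2 + 2 * p * q) * (u z)\<^sup>2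
      - 2 * (p + q) * p * q * u z + p\<^sup>2 * q\<^sup>2)"
    by (intro sum.cong refl) algebra
  also have "\<dots> = card Z * (3 / (d * (d + 2)) - 1 / d\<^sup>2 + (p + q)\<^sup>2 / d + (1 / d + p * q)\<^sup>2)"
    using d by (simp add: sum.distrib sum_subtractf m1 m2 m3 m4 flip: sum_distrib_left)
      (simp add: field_simps power2_eq_square)
  finally have "3 / (d * (d + 2)) - 1 / d\<^sup>2 + (p + q)\<^sup>2 / d + (1 / d + p * q)\<^sup>2 = 0"
    using card_pos by simp
  moreover have "3 / (d * (d + 2)) - 1 / d\<^sup>2 > 0"
  proof -
    have "3 / (d * (d + 2)) - 1 / d\<^sup>2 = 2 * (d - 1) / (d\<^sup>2 * (d + 2))"
      using d by (simp add: divide_simps) (simp add: algebra_simps power2_eq_square)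
    then show ?thesis using d by simp
  qed
  moreover have "(p + q)\<^sup>2 / d \<ge> 0" "(1 / d + p * q)\<^sup>2 \<ge> 0" using d by simp_all
  ultimately show False by linarith
qed

end

locale moment_family_3 = moment_family Z u d for Z :: "'a set" and u :: "'a \<Rightarrow> real" and d +
  fixes a b c :: real
  assumes im: "u ` Z \<subseteq> {a, b, c}"
begin

definition "freq y = real (card {z\<in>Z. u z = y}) / real (card Z)"

text \<open>A coincidence among the nodes would leave a family with at most two values.\<close>

lemma distinct: "a \<noteq> b" "a \<noteq> c" "b \<noteq> c"
  using not_two_valued[of a b] not_two_valued[of a c] not_two_valued[of b c] im by auto

lemma freq_pos: "y \<in> {a, b, c} \<Longrightarrow> freq y > 0"
proof -
  assume y: "y \<in> {a, b, c}"
  have "{z\<in>Z. u z = y} \<noteq> {}"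
  proof
    assume "{z\<in>Z. u z = y} = {}"
    then have "u ` Z \<subseteq> {a, b, c} - {y}" using im by auto
    also have "\<exists>p q. {a, b, c} - {y} \<subseteq> {p, q}" using y by auto
    then obtain p q where "{a, b, c} - {y} \<subseteq> {p, q}" by blast
    finally show False using not_two_valued by blast
  qed
  then have "card {z\<in>Z. u z = y} > 0" using finite_Z by (simp add: card_gt_0_iff)
  then show ?thesis using card_pos by (simp add: freq_def)
qed

lemma freq_sum: "freq a * f a + freq b * f b + freq c * f c = (\<Sum>z\<in>Z. f (u z)) / card Z"
  unfolding sum_fibres_3[OF finite_Z im distinct] freq_def by (simp add: add_divide_distrib)

lemma freq_moments:
  shows "freq a + freq b + freq c = 1"
    and "freq a * a + freq b * b + freq c * c = 0"
    and "freq a * a\<^sup>2 + freq b * b\<^sup>2 + freq c * c\<^sup>2 = 1 / d"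
    and "freq a * a^3 + freq b * b^3 + freq c * c^3 = 0"
    and "freq a * a^4 + freq b * b^4 + freq c * c^4 = 3 / (d * (d + 2))"
  using freq_sum[of "\<lambda>_. 1"] freq_sum[of "\<lambda>x. x"] freq_sum[of "\<lambda>x. x^2"] freq_sum[of "\<lambda>x. x^3"]
    freq_sum[of "\<lambda>x. x^4"] m1 m2 m3 m4 card_pos by simp_all

text \<open>Averaging the product of the two other linear factors isolates one weight, and only the
  first two moments enter.\<close>

lemma freq_nodes:
  "freq a = (1 / d + b * c) / ((a - b) * (a - c))"
  "freq b = (1 / d + a * c) / ((b - a) * (b - c))"
  "freq c = (1 / d + a * b) / ((c - a) * (c - b))"
proof -
  have "freq a * ((a - b) * (a - c)) = 1 / d + b * c" "freq b * ((b - a) * (b - c)) = 1 / d + a * c"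
    "freq c * ((c - a) * (c - b)) = 1 / d + a * b"
    using freq_sum[of "\<lambda>x. (x - b) * (x - c)"] sum_quadratic[of b c]
      freq_sum[of "\<lambda>x. (x - a) * (x - c)"] sum_quadratic[of a c]
      freq_sum[of "\<lambda>x. (x - a) * (x - b)"] sum_quadratic[of a b] card_pos
    by simp_all
  then show "freq a = (1 / d + b * c) / ((a - b) * (a - c))"
    "freq b = (1 / d + a * c) / ((b - a) * (b - c))" "freq c = (1 / d + a * b) / ((c - a) * (c - b))"
    using distinct by (metis divisors_zero eq_iff_diff_eq_0 nonzero_mult_div_cancel_right)+
qed

lemma card_freq: "real (card Z) * freq y = real (card {z\<in>Z. u z = y})"
  using card_pos by (simp add: freq_def)

end

text \<open>Both frequencies are determined by the nodes alone, hence equal; so multiplying them by either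
  cardinality gives integers, and so does multiplying by the greatest common divisor.\<close>

lemma freq_gcd_integral:
  assumes 1: "moment_family_3 Z u d a b c" and 2: "moment_family_3 Z' u' d a b c"
    and y: "y \<in> {a, b, c}"
  shows "real (gcd (card Z) (card Z')) * moment_family_3.freq Z u y \<in> \<int>"
proof -
  interpret A: moment_family_3 Z u d a b c by fact
  interpret B: moment_family_3 Z' u' d a b c by fact
  have eq: "A.freq y = B.freq y"
    using y A.freq_nodes B.freq_nodes by auto
  have i: "real (card Z) * A.freq y \<in> \<int>" "real (card Z') * A.freq y \<in> \<int>"
    using A.card_freq[of y] B.card_freq[of y] eq by simp_all
  obtain p q where "p * int (card Z) + q * int (card Z') = gcd (int (card Z)) (int (card Z'))"
    using bezout_int by blast
  then have "of_int p * real (card Z) + of_int q * real (card Z') = real (gcd (card Z) (card Z'))"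
    by (metis gcd_int_int_eq of_int_add of_int_mult of_int_of_nat_eq)
  then have "real (gcd (card Z) (card Z')) * A.freq y
      = of_int p * (real (card Z) * A.freq y) + of_int q * (real (card Z') * A.freq y)"
    by (metis distrib_right mult.assoc)
  then show ?thesis using i by simp
qed

section \<open>Non-integrality in dimensions 3 to 8\<close>

text \<open>The node polynomial averages to 0 against 1 and against the variable. This gives two
  equations for the sum \<sigma> and the product \<pi> of the outer nodes, solved in terms of
  \<open>b\<close> after multiplication by \<tau> > 0. The bound on \<open>b\<close> expresses that
  \<open>(1 - b1) * (1 - b3)\<close> and \<open>(1 + b1) * (1 + b3)\<close> are nonnegative.\<close>

lemma middle_node_identities:
  fixes d b b1 b3 w w1 w3 :: real
  assumes d: "d \<ge> 2"
    and m0: "w1 + w + w3 = 1"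
    and m1: "w1 * b1 + w * b + w3 * b3 = 0"
    and m2: "w1 * b1\<^sup>2 + w * b\<^sup>2 + w3 * b3\<^sup>2 = 1 / d"
    and m3: "w1 * b1^3 + w * b^3 + w3 * b3^3 = 0"
    and m4: "w1 * b1^4 + w * b^4 + w3 * b3^4 = 3 / (d * (d + 2))"
    and mid: "d * b\<^sup>2 < 1" and le1: "\<bar>b1\<bar> \<le> 1" "\<bar>b3\<bar> \<le> 1"
  defines "\<tau> \<equiv> 1 - d * b\<^sup>2" and "k \<equiv> (d - 1) / (d + 2)"
  shows "w * (\<tau>\<^sup>2 + 2 * k * (2 - \<tau>)) = 2 * k"
    and "(d + 2) * b\<^sup>2 + 2 * \<bar>b\<bar> \<le> 1"
    and "(w1 - w3)\<^sup>2 * (k\<^sup>2 + (2 * k - k\<^sup>2) * \<tau> + \<tau>\<^sup>2) = (1 - \<tau>) * (w * \<tau> + (1 - w) * k)\<^sup>2"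
proof -
  define \<sigma> \<pi> where "\<sigma> = b1 + b3" and "\<pi> = b1 * b3"
  have \<tau>0: "\<tau> > 0" using mid by (simp add: \<tau>_def)
  have t: "d * b\<^sup>2 = 1 - \<tau>" by (simp add: \<tau>_def)
  have k: "3 * d / (d + 2) = 1 + 2 * k" "k > 0" using d by (simp_all add: k_def field_simps)
  \<comment> \<open>Average of the node polynomial itself; multiplied by the variable, as done next,
    it also involves the fourth moment.\<close>
  have "0 = w1 * ((b1 - b1) * (b1 - b) * (b1 - b3)) + w * ((b - b1) * (b - b) * (b - b3)) + w3 * ((b3 - b1) * (b3 - b) * (b3 - b3))"
    by simp
  also have "\<dots> = (w1 * b1^3 + w * b^3 + w3 * b3^3) - (b1 + b + b3) * (w1 * b1\<^sup>2 + w * b\<^sup>2 + w3 * b3\<^sup>2)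
     + (\<pi> + b * \<sigma>) * (w1 * b1 + w * b + w3 * b3) - b * \<pi> * (w1 + w + w3)"
    unfolding \<sigma>_def \<pi>_def by algebra
  finally have E2: "d * (b * \<pi>) = - b - \<sigma>"
    using d unfolding m0 m1 m2 m3 \<sigma>_def by (simp add: field_simps)
  have "0 = w1 * (b1 * ((b1 - b1) * (b1 - b) * (b1 - b3))) + w * (b * ((b - b1) * (b - b) * (b - b3))) + w3 * (b3 * ((b3 - b1) * (b3 - b) * (b3 - b3)))"
    by simp
  also have "\<dots> = (w1 * b1^4 + w * b^4 + w3 * b3^4) - (b1 + b + b3) * (w1 * b1^3 + w * b^3 + w3 * b3^3)
     + (\<pi> + b * \<sigma>) * (w1 * b1\<^sup>2 + w * b\<^sup>2 + w3 * b3\<^sup>2) - b * \<pi> * (w1 * b1 + w * b + w3 * b3)"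
    unfolding \<sigma>_def \<pi>_def by algebra
  finally have "3 / (d * (d + 2)) + (\<pi> + b * \<sigma>) / d = 0"
    unfolding m4 m1 m2 m3 by simp
  then have "(3 / (d + 2) + (\<pi> + b * \<sigma>)) / d = 0" by (simp add: add_divide_distrib mult.commute)
  then have E1: "\<pi> + b * \<sigma> = - (3 / (d + 2))" using d by simp
  have \<pi>\<tau>: "\<pi> * \<tau> = b\<^sup>2 - 3 / (d + 2)"
    using E1 E2 unfolding \<tau>_def by algebra
  then have "d * (\<pi> * \<tau>) = d * b\<^sup>2 - 3 * d / (d + 2)" by (simp only: right_diff_distrib times_divide_eq_right mult.commute[of d 3])
  then have d\<pi>\<tau>: "d * \<pi> * \<tau> = - \<tau> - 2 * k" unfolding k t mult.assoc by linarith
  have "(d * (b * \<pi>)) * \<tau> = (- b - \<sigma>) * \<tau>" by (simp only: E2)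
  moreover have "(d * (b * \<pi>)) * \<tau> = b * (d * \<pi> * \<tau>)" by algebra
  ultimately have "b * (- \<tau> - 2 * k) = (- b - \<sigma>) * \<tau>" by (simp only: d\<pi>\<tau>)
  then have \<sigma>\<tau>: "\<sigma> * \<tau> = 2 * k * b" by algebra
  \<comment> \<open>Averaging the monic quadratic with roots \<open>b1\<close> and \<open>b3\<close>
    isolates \<open>w\<close>.\<close>
  have "w * ((b - b1) * (b - b3)) = (w1 * b1\<^sup>2 + w * b\<^sup>2 + w3 * b3\<^sup>2) - \<sigma> * (w1 * b1 + w * b + w3 * b3) + \<pi> * (w1 + w + w3)"
    unfolding \<sigma>_def \<pi>_def by algebra
  then have "w * ((b - b1) * (b - b3)) = 1 / d + \<pi>" unfolding m0 m1 m2 by simp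
  then have "d * (w * ((b - b1) * (b - b3))) = 1 + d * \<pi>" using d by (simp add: field_simps)
  moreover have "(b - b1) * (b - b3) = b\<^sup>2 - \<sigma> * b + \<pi>" unfolding \<sigma>_def \<pi>_def by algebra
  ultimately have W: "d * (w * (b\<^sup>2 - \<sigma> * b + \<pi>)) = 1 + d * \<pi>" by simp
  have "w * (d * b\<^sup>2 * \<tau> - d * b * (\<sigma> * \<tau>) + d * \<pi> * \<tau>) = d * (w * (b\<^sup>2 - \<sigma> * b + \<pi>)) * \<tau>" by algebra
  also have "\<dots> = \<tau> + d * \<pi> * \<tau>" unfolding W by algebra
  finally have "w * (d * b\<^sup>2 * \<tau> - d * b * (\<sigma> * \<tau>) + d * \<pi> * \<tau>) = \<tau> + d * \<pi> * \<tau>" .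
  moreover have "d * b * (2 * k * b) = 2 * k * (d * b\<^sup>2)" by algebra
  ultimately have "w * ((1 - \<tau>) * \<tau> - 2 * k * (1 - \<tau>) + (- \<tau> - 2 * k)) = \<tau> + (- \<tau> - 2 * k)"
    by (simp only: \<sigma>\<tau> d\<pi>\<tau> t)
  then show "w * (\<tau>\<^sup>2 + 2 * k * (2 - \<tau>)) = 2 * k"
    by (simp add: algebra_simps power2_eq_square)
  have ee: "0 \<le> (1 - b1) * (1 - b3)" "0 \<le> (1 + b1) * (1 + b3)" using le1 by simp_all
  have "(1 - b1) * (1 - b3) * \<tau> = \<tau> * (1 + \<pi>) - \<sigma> * \<tau>" "(1 + b1) * (1 + b3) * \<tau> = \<tau> * (1 + \<pi>) + \<sigma> * \<tau>"
    unfolding \<sigma>_def \<pi>_def by algebra+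
  then have p: "0 \<le> \<tau> * (1 + \<pi>) - 2 * k * b" "0 \<le> \<tau> * (1 + \<pi>) + 2 * k * b"
    using ee \<tau>0 unfolding \<sigma>\<tau> by (metis less_imp_le mult_nonneg_nonneg)+
  have "\<tau> * (1 + \<pi>) = k * (1 - (d + 2) * b\<^sup>2)"
  proof -
    have "\<tau> * (1 + \<pi>) = \<tau> + b\<^sup>2 - 3 / (d + 2)" using \<pi>\<tau> by (simp add: algebra_simps)
    also have "\<dots> = k * (1 - (d + 2) * b\<^sup>2)"
      unfolding \<tau>_def k_def using d by (simp add: divide_simps) (simp add: algebra_simps)
    finally show ?thesis .
  qed
  with p have "0 \<le> k * (1 - (d + 2) * b\<^sup>2 - 2 * b)" "0 \<le> k * (1 - (d + 2) * b\<^sup>2 + 2 * b)"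
    by (simp_all add: algebra_simps)
  then show "(d + 2) * b\<^sup>2 + 2 * \<bar>b\<bar> \<le> 1" using k(2) by (simp add: zero_le_mult_iff abs_if)
  \<comment> \<open>Obtained from the sum and the first moment of the outer weights. The order of
    \<open>b1\<close> and \<open>b3\<close> is not fixed, hence the squares in the claim.\<close>
  have "(w1 - w3) * (b1 - b3) = 2 * (w1 * b1 + w * b + w3 * b3) - 2 * w * b - ((w1 + w + w3) - w) * \<sigma>"
    unfolding \<sigma>_def by algebra
  then have "(w1 - w3) * (b1 - b3) = - 2 * w * b - (1 - w) * \<sigma>" unfolding m0 m1 by simp
  then have "(w1 - w3) * (b1 - b3) * \<tau> = - 2 * w * b * \<tau> - (1 - w) * (\<sigma> * \<tau>)" by algebra
  then have eq: "(w1 - w3) * (b1 - b3) * \<tau> = - 2 * b * (w * \<tau> + (1 - w) * k)"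
    unfolding \<sigma>\<tau> by algebra
  have "d * (b1 - b3)\<^sup>2 * \<tau>\<^sup>2 = d * (\<sigma> * \<tau>)\<^sup>2 - 4 * (d * \<pi> * \<tau>) * \<tau>"
    unfolding \<sigma>_def \<pi>_def by algebra
  also have "\<dots> = 4 * k\<^sup>2 * (d * b\<^sup>2) + 4 * (\<tau> + 2 * k) * \<tau>"
    unfolding \<sigma>\<tau> d\<pi>\<tau> by algebra
  also have "\<dots> = 4 * (k\<^sup>2 + (2 * k - k\<^sup>2) * \<tau> + \<tau>\<^sup>2)" unfolding t by algebra
  finally have Q: "4 * (k\<^sup>2 + (2 * k - k\<^sup>2) * \<tau> + \<tau>\<^sup>2) = d * (b1 - b3)\<^sup>2 * \<tau>\<^sup>2" by simp
  have "4 * ((w1 - w3)\<^sup>2 * (k\<^sup>2 + (2 * k - k\<^sup>2) * \<tau> + \<tau>\<^sup>2)) = (w1 - w3)\<^sup>2 * (d * (b1 - b3)\<^sup>2 * \<tau>\<^sup>2)"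
    unfolding Q[symmetric] by simp
  also have "\<dots> = d * ((w1 - w3) * (b1 - b3) * \<tau>)\<^sup>2" by algebra
  also have "\<dots> = 4 * ((d * b\<^sup>2) * (w * \<tau> + (1 - w) * k)\<^sup>2)" unfolding eq by algebra
  finally show "(w1 - w3)\<^sup>2 * (k\<^sup>2 + (2 * k - k\<^sup>2) * \<tau> + \<tau>\<^sup>2) = (1 - \<tau>) * (w * \<tau> + (1 - w) * k)\<^sup>2"
    unfolding t by simp
qed

section \<open>Enclosures for the middle node, its weight and the weight difference\<close>

lemma middle_node_bound:
  fixes b d :: real
  assumes d: "3 \<le> d" "d \<le> 8" and b: "(d + 2) * b\<^sup>2 + 2 * \<bar>b\<bar> \<le> 1"
  shows "d * b\<^sup>2 \<le> 11 / 25"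
proof (rule ccontr)
  assume "\<not> d * b\<^sup>2 \<le> 11 / 25"
  then have h: "11 / 25 < d * b\<^sup>2" by simp
  moreover have "d * b\<^sup>2 \<le> 8 * b\<^sup>2" using d by (intro mult_right_mono) auto
  ultimately have b2: "11 / 200 < b\<^sup>2" by linarith
  \<comment> \<open>234/1000 lies just below the square root of 11/200, and 11/25 + 2 * 11/200 + 2 *
    234/1000 still exceeds 1.\<close>
  have "\<bar>b\<bar> > 234 / 1000"
  proof (rule ccontr)
    assume "\<not> \<bar>b\<bar> > 234 / 1000"
    then have "\<bar>b\<bar>\<^sup>2 \<le> (234 / 1000)\<^sup>2" by (intro power_mono) auto
    then show False using b2 by (simp add: power2_eq_square)
  qed
  moreover have "(d + 2) * b\<^sup>2 = d * b\<^sup>2 + 2 * b\<^sup>2" by algebra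
  ultimately show False using b h b2 by linarith
qed

text \<open>As a function of \<tau>, the factor of \<open>w\<close> is a parabola with vertex at
  \<open>k\<close>. On the given range it is at most its value at \<open>\<tau> = 1\<close>, where
  the middle node is the origin, and at least its vertex value \<open>k * (4 - k)\<close>.\<close>

lemma weight_bounds:
  fixes \<tau> k w :: real
  assumes k: "0 < k" "k \<le> 7 / 10" and \<tau>: "14 / 25 \<le> \<tau>" "\<tau> \<le> 1"
    and w: "w * (\<tau>\<^sup>2 + 2 * k * (2 - \<tau>)) = 2 * k" "0 < w"
  shows "2 * k \<le> w * (1 + 2 * k)" "w * (4 - k) \<le> 2"
proof -
  have "(\<tau> - 1) * (\<tau> + 1 - 2 * k) \<le> 0" using k \<tau> by (intro mult_nonpos_nonneg) auto
  then have "\<tau>\<^sup>2 + 2 * k * (2 - \<tau>) \<le> 1 + 2 * k" by (simp add: algebra_simps power2_eq_square)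
  then show "2 * k \<le> w * (1 + 2 * k)" using w by (metis less_imp_le mult_left_mono)
  have "\<tau>\<^sup>2 + 2 * k * (2 - \<tau>) = (\<tau> - k)\<^sup>2 + k * (4 - k)" by (simp add: algebra_simps power2_eq_square)
  then have "k * (4 - k) \<le> \<tau>\<^sup>2 + 2 * k * (2 - \<tau>)" by simp
  then have "w * (k * (4 - k)) \<le> 2 * k" using w by (metis less_imp_le mult_left_mono)
  then have "k * (w * (4 - k)) \<le> k * 2" by (simp add: mult_ac)
  then show "w * (4 - k) \<le> 2" using k by simp
qed

text \<open>The two numerical conditions place the absolute value of \<open>g * D\<close> strictly
  between \<open>E\<close> and \<open>E + 1\<close>. In the formula for \<open>D\<^sup>2\<close> the
  factor \<open>1 - \<tau>\<close> decreases while the two others increase, so each bound takes some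
  factors at \<open>L\<close> and some at \<open>U\<close>.\<close>

lemma no_integer_between:
  fixes g D k W \<tau> L U :: real and E e :: int
  assumes k: "0 < k" "k \<le> 1" and W: "0 \<le> W" "W \<le> 1" and \<tau>: "0 \<le> L" "L \<le> \<tau>" "\<tau> \<le> U" "U \<le> 1"
    and D: "D\<^sup>2 * (k\<^sup>2 + (2 * k - k\<^sup>2) * \<tau> + \<tau>\<^sup>2) = (1 - \<tau>) * (W * \<tau> + (1 - W) * k)\<^sup>2"
    and e: "g * D = of_int e" "0 < g" and E: "0 \<le> E"
    and lo: "(of_int E)\<^sup>2 * (k\<^sup>2 + (2 * k - k\<^sup>2) * U + U\<^sup>2) < g\<^sup>2 * ((1 - U) * (W * L + (1 - W) * k)\<^sup>2)"
    and hi: "g\<^sup>2 * ((1 - L) * (W * U + (1 - W) * k)\<^sup>2) < (of_int (E + 1))\<^sup>2 * (k\<^sup>2 + (2 * k - k\<^sup>2) * L + L\<^sup>2)"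
  shows False
proof -
  define Q N where "Q x = k\<^sup>2 + (2 * k - k\<^sup>2) * x + x\<^sup>2" and "N x = W * x + (1 - W) * k" for x
  have kk: "2 * k - k\<^sup>2 \<ge> 0" using k mult_mono[of k 1 k 1] by (simp add: power2_eq_square)
  have Q: "Q x \<le> Q y" if "0 \<le> x" "x \<le> y" for x y
    unfolding Q_def using that kk k by (intro add_mono mult_left_mono power_mono) auto
  have Q0: "Q x > 0" if "0 \<le> x" for x
    unfolding Q_def using that kk k by (intro add_pos_nonneg mult_nonneg_nonneg) auto
  have N: "N x \<le> N y" if "x \<le> y" for x y unfolding N_def using that W by (intro add_right_mono mult_left_mono) auto
  have N0: "0 \<le> N x" if "0 \<le> x" for x unfolding N_def using that W k by (intro add_nonneg_nonneg mult_nonneg_nonneg) auto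
  have eq: "(of_int e)\<^sup>2 * Q \<tau> = g\<^sup>2 * ((1 - \<tau>) * (N \<tau>)\<^sup>2)"
    using D unfolding e(1)[symmetric] Q_def N_def by algebra
  have "(of_int E)\<^sup>2 * Q \<tau> \<le> (of_int E)\<^sup>2 * Q U" using Q \<tau> by (intro mult_left_mono) auto
  also have "\<dots> < g\<^sup>2 * ((1 - U) * (N L)\<^sup>2)" using lo unfolding Q_def N_def .
  also have "\<dots> \<le> g\<^sup>2 * ((1 - \<tau>) * (N \<tau>)\<^sup>2)"
    using \<tau> N N0 by (intro mult_left_mono mult_mono power_mono) auto
  also have "\<dots> = (of_int e)\<^sup>2 * Q \<tau>" using eq by simp
  finally have 1: "(of_int E :: real)\<^sup>2 < (of_int e)\<^sup>2" using Q0[of \<tau>] \<tau> by simp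
  have "(of_int e)\<^sup>2 * Q \<tau> = g\<^sup>2 * ((1 - \<tau>) * (N \<tau>)\<^sup>2)" by (rule eq)
  also have "\<dots> \<le> g\<^sup>2 * ((1 - L) * (N U)\<^sup>2)"
    using \<tau> N N0 by (intro mult_left_mono mult_mono power_mono) auto
  also have "\<dots> < (of_int (E + 1))\<^sup>2 * Q L" using hi unfolding Q_def N_def .
  also have "\<dots> \<le> (of_int (E + 1))\<^sup>2 * Q \<tau>" using Q \<tau> by (intro mult_left_mono) auto
  finally have 2: "(of_int e :: real)\<^sup>2 < (of_int (E + 1))\<^sup>2" using Q0[of \<tau>] \<tau> by simp
  have "E\<^sup>2 < e\<^sup>2" "e\<^sup>2 < (E + 1)\<^sup>2" using 1 2 by (simp_all only: of_int_power[symmetric] of_int_less_iff)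
  then have "\<bar>E\<bar> < \<bar>e\<bar>" "\<bar>e\<bar> < \<bar>E + 1\<bar>" by (simp_all add: abs_less_iff flip: abs_square_less_1 abs_le_square_iff not_le)
  then show False using E by linarith
qed

text \<open>Here \<open>\<tau>\<close> is the larger root of a quadratic polynomial, enclosed between \<open>L\<close> and \<open>U\<close>.\<close>

lemma no_integer_between_root:
  fixes g D k W \<tau> L U :: real and E e :: int
  assumes w: "W * (\<tau>\<^sup>2 + 2 * k * (2 - \<tau>)) = 2 * k" and \<tau>: "14 / 25 \<le> \<tau>"
    and D: "D\<^sup>2 * (k\<^sup>2 + (2 * k - k\<^sup>2) * \<tau> + \<tau>\<^sup>2) = (1 - \<tau>) * (W * \<tau> + (1 - W) * k)\<^sup>2"
    and e: "g * D = of_int e"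
    and num: "0 < k" "k \<le> 1" "0 < W" "W \<le> 1" "14 / 25 \<le> L" "k \<le> U" "U \<le> 1" "0 < g" "0 \<le> E"
    "W * ((14/25)\<^sup>2 + 2 * k * (2 - 14/25)) < 2 * k" "W * (L\<^sup>2 + 2 * k * (2 - L)) < 2 * k"
    "2 * k < W * (U\<^sup>2 + 2 * k * (2 - U))"
    and lo: "(of_int E)\<^sup>2 * (k\<^sup>2 + (2 * k - k\<^sup>2) * U + U\<^sup>2) < g\<^sup>2 * ((1 - U) * (W * L + (1 - W) * k)\<^sup>2)"
    and hi: "g\<^sup>2 * ((1 - L) * (W * U + (1 - W) * k)\<^sup>2) < (of_int (E + 1))\<^sup>2 * (k\<^sup>2 + (2 * k - k\<^sup>2) * L + L\<^sup>2)"
  shows False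
proof -
  define f where "f x = x\<^sup>2 + 2 * k * (2 - x)" for x
  have fU: "f \<tau> < f U" and fL: "f L < f \<tau>" and f0: "f (14/25) < f \<tau>"
    unfolding mult_less_cancel_left_pos[OF num(3), symmetric, of "f _"] using num(10-12) w by (simp_all only: f_def)
  have U: "\<tau> \<le> U"
  proof (rule ccontr)
    assume "\<not> \<tau> \<le> U"
    then have "0 \<le> (\<tau> - U) * (\<tau> + U - 2 * k)" using num by simp
    then have "f U \<le> f \<tau>" by (simp add: f_def algebra_simps power2_eq_square)
    then show False using fU by simp
  qed
  have L: "L \<le> \<tau>"
  proof (rule ccontr)
    assume l: "\<not> L \<le> \<tau>"
    \<comment> \<open>\<open>f\<close> is symmetric about \<open>k\<close>, so comparing values
      compares distances from \<open>k\<close>. The test point 14/25 excludes the smaller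
      root.\<close>
    have "(\<tau> - x) * (\<tau> + x - 2 * k) = f \<tau> - f x" for x
      by (simp add: f_def algebra_simps power2_eq_square)
    then have "(\<tau> - L) * (\<tau> + L - 2 * k) > 0" "(\<tau> - 14/25) * (\<tau> + 14/25 - 2 * k) > 0"
      using fL f0 by (simp_all only: diff_gt_0_iff_gt)
    then have "\<tau> + L - 2 * k < 0" "\<tau> + 14/25 - 2 * k > 0"
      using l \<tau> by (simp_all add: zero_less_mult_iff)
    then show False using num(5) by linarith
  qed
  show False
    by (rule no_integer_between[OF _ _ _ _ _ L U _ D e _ _ lo hi]) (use num in auto)
qed

text \<open>\<open>w\<close> is the weight of the node \<open>b\<close> closest to the origin, \<open>D\<close> the difference of the other two weights,
  \<open>g\<close> a common denominator; \<open>k = (n - 1) / (n + 2)\<close> and \<open>\<tau> = 1 - n * b\<^sup>2\<close>.\<close>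

locale middle_node =
  fixes k g w \<tau> D :: real and a e :: int
  assumes k: "0 < k" "k \<le> 7 / 10" and g: "0 < g" and w0: "0 < w"
    and \<tau>: "14 / 25 \<le> \<tau>" "\<tau> \<le> 1"
    and w_eq: "w * (\<tau>\<^sup>2 + 2 * k * (2 - \<tau>)) = 2 * k"
    and D_eq: "D\<^sup>2 * (k\<^sup>2 + (2 * k - k\<^sup>2) * \<tau> + \<tau>\<^sup>2) = (1 - \<tau>) * (w * \<tau> + (1 - w) * k)\<^sup>2"
    and aw: "g * w = of_int a" and eD: "g * D = of_int e"
begin

lemma w_a: "w = of_int a / g" using aw g by (simp add: field_simps)

lemma a_bounds: "2 * k * g \<le> of_int a * (1 + 2 * k)" "of_int a * (4 - k) \<le> 2 * g"
  using mult_left_mono[OF weight_bounds(1)[OF k \<tau> w_eq w0], of g]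
    mult_left_mono[OF weight_bounds(2)[OF k \<tau> w_eq w0], of g] g
  unfolding aw[symmetric] by (simp_all add: mult_ac)

text \<open>At the upper end of the weight range the quadratic for \<tau> has discriminant
  0.\<close>

lemma double_root:
  assumes "w * (4 - k) = 2" shows "\<tau> = k"
proof -
  have "w * (\<tau> - k)\<^sup>2 = w * (\<tau>\<^sup>2 + 2 * k * (2 - \<tau>)) - k * (w * (4 - k))" by algebra
  also have "\<dots> = 0" unfolding assms w_eq by simp
  finally show ?thesis using w0 by simp
qed

end

text \<open>Each of these lemmas treats one dimension n, with k = (n - 1) / (n + 2), and one
  denominator g = T / p, where T = binomial (n + 3) 3 and p is a prime factor; n and g form the
  name. \<open>a_bounds\<close> leaves at most two numerators of the weight. The last numerical
  arguments are rational bounds for \<tau> and the integer part of the absolute value of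
  \<open>g * D\<close>.\<close>

lemma no_middle_node_3_10: "\<not> middle_node (2 / 5) 10 w \<tau> D a e"
proof
  assume "middle_node (2 / 5) 10 w \<tau> D a e"
  then interpret middle_node "2 / 5" 10 w \<tau> D a e .
  have "a = 5" using a_bounds by (simp add: field_simps)
  then have W: "w = 1 / 2" using w_a by simp
  show False
    using w_eq D_eq \<tau>(1) eD unfolding W by (intro no_integer_between_root[of "1 / 2" \<tau> "2 / 5" D 10 e "39 / 50" "41 / 50" 2])
    (simp_all add: power2_eq_square)
qed

lemma no_middle_node_3_4: "\<not> middle_node (2 / 5) 4 w \<tau> D a e"
proof
  assume "middle_node (2 / 5) 4 w \<tau> D a e"
  then interpret middle_node "2 / 5" 4 w \<tau> D a e .
  have "a = 2" using a_bounds by (simp add: field_simps)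
  then have W: "w = 1 / 2" using w_a by simp
  show False
    using w_eq D_eq \<tau>(1) eD unfolding W by (intro no_integer_between_root[of "1 / 2" \<tau> "2 / 5" D 4 e "79 / 100" "81 / 100" 0])
    (simp_all add: power2_eq_square)
qed

lemma no_middle_node_4_7: "\<not> middle_node (1 / 2) 7 w \<tau> D a e"
proof
  assume "middle_node (1 / 2) 7 w \<tau> D a e"
  then interpret middle_node "1 / 2" 7 w \<tau> D a e .
  have "a = 4" using a_bounds by (simp add: field_simps)
  then have W: "w = 4 / 7" using w_a by simp
  \<comment> \<open>4/7 is the upper end of the weight range, and its only root lies below the bound
    14/25.\<close>
  have "\<tau> = 1 / 2" using double_root W by simp
  then show False using \<tau> by simp
qed

lemma no_middle_node_4_5: "\<not> middle_node (1 / 2) 5 w \<tau> D a e"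
proof
  assume "middle_node (1 / 2) 5 w \<tau> D a e"
  then interpret middle_node "1 / 2" 5 w \<tau> D a e .
  have "2 < real_of_int a" "real_of_int a < 3" using a_bounds by simp_all
  then have "2 < a" "a < 3" by simp_all
  then show False by linarith
qed

lemma no_middle_node_5_28: "\<not> middle_node (4 / 7) 28 w \<tau> D a e"
proof
  assume "middle_node (4 / 7) 28 w \<tau> D a e"
  then interpret middle_node "4 / 7" 28 w \<tau> D a e .
  have "a = 15 \<or> a = 16" using a_bounds by (simp add: field_simps) linarith
  then consider "a = 15" | "a = 16" by linarith
  then show False
  proof cases
    case 1
    then have W: "w = 15 / 28" using w_a by simp
    show False
      using w_eq D_eq \<tau>(1) eD unfolding W by (intro no_integer_between_root[of "15 / 28" \<tau> "4 / 7" D 28 e "197 / 200" "199 / 200" 1])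
        (simp_all add: power2_eq_square)
  next
    case 2
    then have W: "w = 4 / 7" using w_a by simp
    show False
      using w_eq D_eq \<tau>(1) eD unfolding W by (intro no_integer_between_root[of "4 / 7" \<tau> "4 / 7" D 28 e "19 / 25" "39 / 50" 7])
        (simp_all add: power2_eq_square)
  qed
qed

lemma no_middle_node_5_8: "\<not> middle_node (4 / 7) 8 w \<tau> D a e"
proof
  assume "middle_node (4 / 7) 8 w \<tau> D a e"
  then interpret middle_node "4 / 7" 8 w \<tau> D a e .
  have "4 < real_of_int a" "real_of_int a < 5" using a_bounds by simp_all
  then have "4 < a" "a < 5" by simp_all
  then show False by linarith
qed

lemma no_middle_node_6_42: "\<not> middle_node (5 / 8) 42 w \<tau> D a e"
proof
  assume "middle_node (5 / 8) 42 w \<tau> D a e"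
  then interpret middle_node "5 / 8" 42 w \<tau> D a e .
  have "a = 24" using a_bounds by (simp add: field_simps)
  then have W: "w = 4 / 7" using w_a by simp
  show False
    using w_eq D_eq \<tau>(1) eD unfolding W by (intro no_integer_between_root[of "4 / 7" \<tau> "5 / 8" D 42 e "451 / 500" "453 / 500" 7])
    (simp_all add: power2_eq_square)
qed

lemma no_middle_node_6_28: "\<not> middle_node (5 / 8) 28 w \<tau> D a e"
proof
  assume "middle_node (5 / 8) 28 w \<tau> D a e"
  then interpret middle_node "5 / 8" 28 w \<tau> D a e .
  have "a = 16" using a_bounds by (simp add: field_simps)
  then have W: "w = 4 / 7" using w_a by simp
  show False
    using w_eq D_eq \<tau>(1) eD unfolding W by (intro no_integer_between_root[of "4 / 7" \<tau> "5 / 8" D 28 e "9 / 10" "91 / 100" 4])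
    (simp_all add: power2_eq_square)
qed

lemma no_middle_node_6_12: "\<not> middle_node (5 / 8) 12 w \<tau> D a e"
proof
  assume "middle_node (5 / 8) 12 w \<tau> D a e"
  then interpret middle_node "5 / 8" 12 w \<tau> D a e .
  have "a = 7" using a_bounds by (simp add: field_simps)
  then have W: "w = 7 / 12" using w_a by simp
  show False
    using w_eq D_eq \<tau>(1) eD unfolding W by (intro no_integer_between_root[of "7 / 12" \<tau> "5 / 8" D 12 e "161 / 200" "163 / 200" 2])
    (simp_all add: power2_eq_square)
qed

lemma no_middle_node_7_60: "\<not> middle_node (2 / 3) 60 w \<tau> D a e"
proof
  assume "middle_node (2 / 3) 60 w \<tau> D a e"
  then interpret middle_node "2 / 3" 60 w \<tau> D a e .
  have "a = 35 \<or> a = 36" using a_bounds by (simp add: field_simps) linarith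
  then consider "a = 35" | "a = 36" by linarith
  then show False
  proof cases
    case 1
    then have W: "w = 7 / 12" using w_a by simp
    show False
      using w_eq D_eq \<tau>(1) eD unfolding W by (intro no_integer_between_root[of "7 / 12" \<tau> "2 / 3" D 60 e "183 / 200" "37 / 40" 9])
        (simp_all add: power2_eq_square)
  next
    case 2
    then have W: "w = 3 / 5" using w_a by simp
    \<comment> \<open>Again the upper end of the weight range; \<tau> is known exactly and the
      enclosure degenerates to \<open>L = U\<close>.\<close>
    have "\<tau> = 2 / 3" using double_root W by simp
    then show False
      using D_eq eD unfolding W by (intro no_integer_between[of "2 / 3" "3 / 5" "2 / 3" \<tau> "2 / 3" D 60 e 18])
        (simp_all add: power2_eq_square)
  qed
qed

lemma no_middle_node_7_40: "\<not> middle_node (2 / 3) 40 w \<tau> D a e"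
proof
  assume "middle_node (2 / 3) 40 w \<tau> D a e"
  then interpret middle_node "2 / 3" 40 w \<tau> D a e .
  have "a = 23 \<or> a = 24" using a_bounds by (simp add: field_simps) linarith
  then consider "a = 23" | "a = 24" by linarith
  then show False
  proof cases
    case 1
    then have W: "w = 23 / 40" using w_a by simp
    show False
      using w_eq D_eq \<tau>(1) eD unfolding W by (intro no_integer_between_root[of "23 / 40" \<tau> "2 / 3" D 40 e "122 / 125" "49 / 50" 3])
        (simp_all add: power2_eq_square)
  next
    case 2
    then have W: "w = 3 / 5" using w_a by simp
    have "\<tau> = 2 / 3" using double_root W by simp
    then show False
      using D_eq eD unfolding W by (intro no_integer_between[of "2 / 3" "3 / 5" "2 / 3" \<tau> "2 / 3" D 40 e 12])
        (simp_all add: power2_eq_square)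
  qed
qed

lemma no_middle_node_7_24: "\<not> middle_node (2 / 3) 24 w \<tau> D a e"
proof
  assume "middle_node (2 / 3) 24 w \<tau> D a e"
  then interpret middle_node "2 / 3" 24 w \<tau> D a e .
  have "a = 14" using a_bounds by (simp add: field_simps)
  then have W: "w = 7 / 12" using w_a by simp
  show False
    using w_eq D_eq \<tau>(1) eD unfolding W by (intro no_integer_between_root[of "7 / 12" \<tau> "2 / 3" D 24 e "183 / 200" "37 / 40" 3])
    (simp_all add: power2_eq_square)
qed

lemma no_middle_node_8_55: "\<not> middle_node (7 / 10) 55 w \<tau> D a e"
proof
  assume "middle_node (7 / 10) 55 w \<tau> D a e"
  then interpret middle_node "7 / 10" 55 w \<tau> D a e .
  have "a = 33" using a_bounds by (simp add: field_simps)
  then have W: "w = 3 / 5" using w_a by simp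
  show False
    using w_eq D_eq \<tau>(1) eD unfolding W by (intro no_integer_between_root[of "3 / 5" \<tau> "7 / 10" D 55 e "17 / 20" "427 / 500" 11])
    (simp_all add: power2_eq_square)
qed

lemma no_middle_node_8_33: "\<not> middle_node (7 / 10) 33 w \<tau> D a e"
proof
  assume "middle_node (7 / 10) 33 w \<tau> D a e"
  then interpret middle_node "7 / 10" 33 w \<tau> D a e .
  have "a = 20" using a_bounds by (simp add: field_simps)
  then have W: "w = 20 / 33" using w_a by simp
  have "\<tau> = 7 / 10" using double_root W by simp
  then show False
    using D_eq eD unfolding W by (intro no_integer_between[of "7 / 10" "20 / 33" "7 / 10" \<tau> "7 / 10" D 33 e 9])
    (simp_all add: power2_eq_square)
qed

lemma no_middle_node_8_15: "\<not> middle_node (7 / 10) 15 w \<tau> D a e"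
proof
  assume "middle_node (7 / 10) 15 w \<tau> D a e"
  then interpret middle_node "7 / 10" 15 w \<tau> D a e .
  have "a = 9" using a_bounds by (simp add: field_simps)
  then have W: "w = 3 / 5" using w_a by simp
  show False
    using w_eq D_eq \<tau>(1) eD unfolding W by (intro no_integer_between_root[of "3 / 5" \<tau> "7 / 10" D 15 e "21 / 25" "43 / 50" 3])
    (simp_all add: power2_eq_square)
qed

section \<open>From a three-node family to the case check\<close>

context moment_family_3
begin

text \<open>The average of \<open>d * y\<^sup>2 - 1\<close> is 0. If no node made it negative, all
  three nodes would have the same square, and at most two of them could differ.\<close>

lemma exists_middle: "\<exists>y\<in>{a, b, c}. d * y\<^sup>2 < 1"
proof (rule ccontr)
  assume "\<not> (\<exists>y\<in>{a, b, c}. d * y\<^sup>2 < 1)"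
  then have ge: "d * y\<^sup>2 - 1 \<ge> 0" if "y \<in> {a, b, c}" for y using that by force
  then have nn: "freq y * (d * y\<^sup>2 - 1) \<ge> 0" if "y \<in> {a, b, c}" for y
    using that freq_pos[OF that] by simp
  have "freq a * (d * a\<^sup>2 - 1) + freq b * (d * b\<^sup>2 - 1) + freq c * (d * c\<^sup>2 - 1) =
      d * (freq a * a\<^sup>2 + freq b * b\<^sup>2 + freq c * c\<^sup>2) - (freq a + freq b + freq c)" by algebra
  also have "\<dots> = 0" unfolding freq_moments using d by simp
  finally have 0: "freq a * (d * a\<^sup>2 - 1) + freq b * (d * b\<^sup>2 - 1) + freq c * (d * c\<^sup>2 - 1) = 0" .
  have "0 \<le> freq a * (d * a\<^sup>2 - 1)" "0 \<le> freq b * (d * b\<^sup>2 - 1)" "0 \<le> freq c * (d * c\<^sup>2 - 1)"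
    by (rule nn; simp)+
  with 0 have "freq a * (d * a\<^sup>2 - 1) = 0" "freq b * (d * b\<^sup>2 - 1) = 0" "freq c * (d * c\<^sup>2 - 1) = 0"
    by linarith+
  then have "d * a\<^sup>2 = 1" "d * b\<^sup>2 = 1" "d * c\<^sup>2 = 1"
    using freq_pos[of a] freq_pos[of b] freq_pos[of c] by auto
  then have "d * a\<^sup>2 = d * b\<^sup>2" "d * a\<^sup>2 = d * c\<^sup>2" by simp_all
  then have "a\<^sup>2 = b\<^sup>2" "a\<^sup>2 = c\<^sup>2" using d by simp_all
  then show False using distinct by (auto simp: power2_eq_iff)
qed

lemma middle_node_of_integral:
  assumes mid: "d * b\<^sup>2 < 1" and d8: "3 \<le> d" "d \<le> 8" and le1: "\<bar>a\<bar> \<le> 1" "\<bar>c\<bar> \<le> 1"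
    and g: "0 < g" "\<And>y. y \<in> {a, b, c} \<Longrightarrow> g * freq y \<in> \<int>"
  shows "\<exists>\<tau> m e. middle_node ((d - 1) / (d + 2)) g (freq b) \<tau> (freq a - freq c) m e"
proof -
  note id = middle_node_identities[OF d freq_moments mid le1]
  have "d * b\<^sup>2 \<le> 11 / 25" by (rule middle_node_bound[OF d8 id(2)])
  moreover have "d * b\<^sup>2 \<ge> 0" using d by simp
  ultimately have \<tau>: "14 / 25 \<le> 1 - d * b\<^sup>2" "1 - d * b\<^sup>2 \<le> 1" by simp_all
  have k: "0 < (d - 1) / (d + 2)" "(d - 1) / (d + 2) \<le> 7 / 10" using d8 by (simp_all add: field_simps)
  have "g * (freq a - freq c) \<in> \<int>" using g(2)[of a] g(2)[of c] by (simp add: right_diff_distrib)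
  then obtain e where e: "g * (freq a - freq c) = of_int e" by (elim Ints_cases)
  have "g * freq b \<in> \<int>" using g(2)[of b] by simp
  then obtain m where m: "g * freq b = of_int m" by (elim Ints_cases)
  have "middle_node ((d - 1) / (d + 2)) g (freq b) (1 - d * b\<^sup>2) (freq a - freq c) m e"
    by (rule middle_node.intro[OF k g(1) _ \<tau> id(1,3) m e]) (simp add: freq_pos)
  then show ?thesis by blast
qed

end

text \<open>Replaces an unknown proper divisor by one of the few maximal ones
  \<open>T div p\<close>.\<close>

lemma proper_divisor_dvd:
  fixes g T :: nat
  assumes "g dvd T" "g < T"
  obtains p where "prime p" "p dvd T" "g dvd T div p"
proof -
  obtain q where q: "T = g * q" using assms(1) by auto
  then have "q \<noteq> 1" using assms(2) by auto
  then obtain p where p: "prime p" "p dvd q" using prime_factor_nat by blast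
  then obtain q' where "q = p * q'" by auto
  then have "T div p = g * q'" using q p prime_gt_0_nat by (simp add: mult.left_commute)
  then show thesis using that[OF p(1)] p(2) q by simp
qed

lemma moment_family_3_not_integral:
  assumes fam: "moment_family_3 Z u d a b c" and dn: "d = real n" "3 \<le> n" "n \<le> 8"
    and le1: "\<And>y. y \<in> {a, b, c} \<Longrightarrow> \<bar>y\<bar> \<le> 1"
    and T: "6 * T = (n + 1) * (n + 2) * (n + 3)" and g: "g dvd T" "g < T"
    and int: "\<And>y. y \<in> {a, b, c} \<Longrightarrow> real g * moment_family_3.freq Z u y \<in> \<int>"
  shows False
proof -
  interpret moment_family_3 Z u d a b c by fact
  obtain p where p: "prime p" "p dvd T" "g dvd T div p" by (rule proper_divisor_dvd[OF g])
  have no: "\<not> middle_node ((d - 1) / (d + 2)) (real (T div p)) w \<tau> D m e" for w \<tau> D m e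
  proof -
    have pd: "q = p" if "prime q" "p dvd q" for q using p(1) that primes_dvd_imp_eq by metis
    have p235: "prime (2::nat)" "prime (3::nat)" "prime (5::nat)" "prime (7::nat)" "prime (11::nat)"
      by simp_all
    from dn consider "n = 3" | "n = 4" | "n = 5" | "n = 6" | "n = 7" | "n = 8" by linarith
    then show ?thesis
    proof cases
      case 1
      then have "T = 2 * (2 * 5)" using T by simp
      then have "p = 2 \<or> p = 5" using p(1,2) pd p235 unfolding \<open>T = _\<close> prime_dvd_mult_iff[OF p(1)] by blast
      then show ?thesis using \<open>T = _\<close> dn(1) 1 no_middle_node_3_10 no_middle_node_3_4 by auto
    next
      case 2
      then have "T = 5 * 7" using T by simp
      then have "p = 5 \<or> p = 7" using p(1,2) pd p235 unfolding \<open>T = _\<close> prime_dvd_mult_iff[OF p(1)] by blast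
      then show ?thesis using \<open>T = _\<close> dn(1) 2 no_middle_node_4_7 no_middle_node_4_5 by auto
    next
      case 3
      then have "T = 2 * (2 * (2 * 7))" using T by simp
      then have "p = 2 \<or> p = 7" using p(1,2) pd p235 unfolding \<open>T = _\<close> prime_dvd_mult_iff[OF p(1)] by blast
      then show ?thesis using \<open>T = _\<close> dn(1) 3 no_middle_node_5_28 no_middle_node_5_8 by auto
    next
      case 4
      then have "T = 2 * (2 * (3 * 7))" using T by simp
      then have "p = 2 \<or> p = 3 \<or> p = 7" using p(1,2) pd p235 unfolding \<open>T = _\<close> prime_dvd_mult_iff[OF p(1)] by blast
      then show ?thesis using \<open>T = _\<close> dn(1) 4 no_middle_node_6_42 no_middle_node_6_28 no_middle_node_6_12 by auto
    next
      case 5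
      then have "T = 2 * (2 * (2 * (3 * 5)))" using T by simp
      then have "p = 2 \<or> p = 3 \<or> p = 5" using p(1,2) pd p235 unfolding \<open>T = _\<close> prime_dvd_mult_iff[OF p(1)] by blast
      then show ?thesis using \<open>T = _\<close> dn(1) 5 no_middle_node_7_60 no_middle_node_7_40 no_middle_node_7_24 by auto
    next
      case 6
      then have "T = 3 * (5 * 11)" using T by simp
      then have "p = 3 \<or> p = 5 \<or> p = 11" using p(1,2) pd p235 unfolding \<open>T = _\<close> prime_dvd_mult_iff[OF p(1)] by blast
      then show ?thesis using \<open>T = _\<close> dn(1) 6 no_middle_node_8_55 no_middle_node_8_33 no_middle_node_8_15 by auto
    qed
  qed
  have int': "real (T div p) * freq y \<in> \<int>" if "y \<in> {a, b, c}" for y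
  proof -
    obtain q where "T div p = g * q" using p(3) by auto
    then have "real (T div p) * freq y = real q * (real g * freq y)" by simp
    also have "\<dots> \<in> \<int>" by (rule Ints_mult[OF Ints_of_nat int[OF that]])
    finally show ?thesis .
  qed
  have Tp: "real (T div p) > 0"
    using p g dvd_div_eq_0_iff[OF p(2)] by simp
  \<comment> \<open>The node near the origin may be any of the three; a permutation moves it into
    the second slot.\<close>
  have key: False if "{x, y, z} = {a, b, c}" "d * y\<^sup>2 < 1" for x y z
  proof -
    have "moment_family_3 Z u d x y z" using fam that(1) by (simp add: moment_family_3_def moment_family_3_axioms_def)
    then interpret perm: moment_family_3 Z u d x y z .
    have "\<bar>x\<bar> \<le> 1" "\<bar>z\<bar> \<le> 1" using le1[of x] le1[of z] unfolding that(1)[symmetric] by simp_all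
    then show False
      using perm.middle_node_of_integral[OF that(2) _ _ _ _ Tp] int' no dn unfolding that(1) by auto
  qed
  from exists_middle consider "d * a\<^sup>2 < 1" | "d * b\<^sup>2 < 1" | "d * c\<^sup>2 < 1" by auto
  then show False
  proof cases
    case 1 then show ?thesis using key[of b a c] by (simp add: insert_commute)
  next
    case 2 then show ?thesis using key[of a b c] by simp
  next
    case 3 then show ?thesis using key[of a c b] by (simp add: insert_commute)
  qed
qed

lemma card_le_3_subset:
  assumes "finite R" "card R \<le> 3" shows "\<exists>a b c. R \<subseteq> {a, b, c}"
proof -
  obtain xs where xs: "set xs = R" "length xs = card R" using finite_distinct_list[OF assms(1)] distinct_card by metis
  then have "length xs \<le> 3" using assms by simp
  then consider "xs = []" | a where "xs = [a]" | a b where "xs = [a, b]" | a b c where "xs = [a, b, c]"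
    by (auto simp: eval_nat_numeral le_Suc_eq length_Suc_conv)
  then show ?thesis using xs(1) by cases auto
qed

section \<open>Application to the inner products between the two spheres\<close>

context tight_two_sphere_design
begin

definition "cross_root t \<longleftrightarrow> \<kappa>2 * (t\<^sup>2 - 1 / dm) + \<kappa>3 * r * s * (t^3 - 3 * t / (dm + 2)) = 0"

text \<open>Coincident or missing roots do no harm here: that \<open>a\<close>, \<open>b\<close>,
  \<open>c\<close> are distinct and attained follows later from the moments.\<close>

lemma cross_roots_subset: "\<exists>a b c. {t. cross_root t} \<subseteq> {a, b, c}"
proof -
  define p where "p = [: - \<kappa>2 / dm, - 3 * (\<kappa>3 * r * s) / (dm + 2), \<kappa>2, \<kappa>3 * r * s :]"
  have k: "\<kappa>3 * r * s \<noteq> 0" using dm_pos M_pos radii by (simp add: \<kappa>3_def)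
  then have p: "p \<noteq> 0" by (simp add: p_def)
  have "poly p t = \<kappa>2 * (t\<^sup>2 - 1 / dm) + \<kappa>3 * r * s * (t^3 - 3 * t / (dm + 2))" for t
    unfolding p_def by (simp add: algebra_simps power2_eq_square power3_eq_cube)
  then have eq: "{t. cross_root t} = {t. poly p t = 0}" by (simp add: cross_root_def)
  have "degree p \<le> 3" by (simp add: p_def)
  then have "card {t. poly p t = 0} \<le> 3" using card_poly_roots_bound[OF p] by linarith
  then show ?thesis unfolding eq using card_le_3_subset[OF poly_roots_finite[OF p]] by blast
qed

lemma moment_family:
  assumes dm: "dm \<ge> 2" and x: "x \<in> X" "norm x = s" and R: "{t. cross_root t} \<subseteq> {a, b, c}"
  shows "moment_family_3 (X \<inter> sphere 0 r) (\<lambda>y. x \<bullet> y / (r * s)) dm a b c"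
proof unfold_locales
  obtain z where "z \<in> X" "norm z = r" by (rule sphere_nonempty)
  then show "X \<inter> sphere 0 r \<noteq> {}" by auto
  show "(\<lambda>y. x \<bullet> y / (r * s)) ` (X \<inter> sphere 0 r) \<subseteq> {a, b, c}"
  proof (intro image_subsetI subsetD[OF R] CollectI)
    fix y assume "y \<in> X \<inter> sphere 0 r"
    then show "cross_root (x \<bullet> y / (r * s))"
      using cross_inner_root[of y x] x by (simp add: cross_root_def inner_commute)
  qed
qed (use dm finite_X sphere_design_moments[OF x(2)] in auto)

end

context tight_two_sphere_design
begin

text \<open>The cubic is symmetric in the radii, so both spheres yield families with the same nodes,
  as \<open>freq_gcd_integral\<close> requires.\<close>

lemma sw_cross_root: "tw.cross_root t \<longleftrightarrow> cross_root t"
  unfolding tw.cross_root_def cross_root_def sw_consts by (simp add: mult_ac)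

lemma integral_frequencies:
  assumes dm: "dm \<ge> 2"
  defines "N \<equiv> card (X \<inter> sphere 0 r)" and "N' \<equiv> card (X \<inter> sphere 0 s)"
  obtains Z :: "(real^'n) set" and u a b c where "moment_family_3 Z u dm a b c"
    and "\<And>y. y \<in> {a, b, c} \<Longrightarrow> \<bar>y\<bar> \<le> 1"
    and "\<And>y. y \<in> {a, b, c} \<Longrightarrow> real (gcd N N') * moment_family_3.freq Z u y \<in> \<int>"
proof -
  obtain a b c where R: "{t. cross_root t} \<subseteq> {a, b, c}" using cross_roots_subset by blast
  then have R': "{t. tw.cross_root t} \<subseteq> {a, b, c}" by (simp add: sw_cross_root)
  obtain x where x: "x \<in> X" "norm x = r" by (rule sphere_nonempty)
  obtain y where y: "y \<in> X" "norm y = s" by (rule tw.sphere_nonempty)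
  define Z u where "Z = X \<inter> sphere 0 r" and "u = (\<lambda>z. y \<bullet> z / (r * s))"
  have 1: "moment_family_3 Z u dm a b c" unfolding Z_def u_def by (rule moment_family[OF dm y R])
  have 2: "moment_family_3 (X \<inter> sphere 0 s) (\<lambda>z. x \<bullet> z / (s * r)) dm a b c" by (rule tw.moment_family[OF dm x R'])
  interpret moment_family_3 Z u dm a b c by (rule 1)
  \<comment> \<open>Every node has positive frequency and is therefore the cosine of an actual
    angle.\<close>
  have "\<bar>t\<bar> \<le> 1" if "t \<in> {a, b, c}" for t
  proof -
    have "freq t \<noteq> 0" using freq_pos[OF that] by simp
    then have "{z \<in> Z. u z = t} \<noteq> {}" by (auto simp: freq_def card_gt_0_iff)
    then obtain z where z: "z \<in> Z" "t = y \<bullet> z / (r * s)" by (auto simp: u_def)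
    have "\<bar>y \<bullet> z\<bar> \<le> s * r" using Cauchy_Schwarz_ineq2[of y z] y z by (simp add: Z_def)
    then show ?thesis using z(2) radii by (simp add: abs_mult divide_le_eq_1 mult.commute)
  qed
  moreover have "real (gcd N N') * freq t \<in> \<int>" if "t \<in> {a, b, c}" for t
    using freq_gcd_integral[OF 1 2 that] by (simp add: N_def N'_def Z_def)
  ultimately show thesis using that[OF 1] by blast
qed

lemma card_spheres_pos: "card (X \<inter> sphere 0 r) > 0" "card (X \<inter> sphere 0 s) > 0"
proof -
  obtain x where "x \<in> X" "norm x = r" by (rule sphere_nonempty)
  then show "card (X \<inter> sphere 0 r) > 0" using finite_X by (auto simp: card_gt_0_iff)
  obtain y where "y \<in> X" "norm y = s" by (rule tw.sphere_nonempty)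
  then show "card (X \<inter> sphere 0 s) > 0" using finite_X by (auto simp: card_gt_0_iff)
qed

lemma dimension_not_3_to_8: "\<not> (3 \<le> CARD('n) \<and> CARD('n) \<le> 8)"
proof
  assume n: "3 \<le> CARD('n) \<and> CARD('n) \<le> 8"
  define N N' where "N = card (X \<inter> sphere 0 r)" and "N' = card (X \<inter> sphere 0 s)"
  have "6 * (real N + real N') = (dm + 1) * (dm + 2) * (dm + 3)"
    unfolding N_def N'_def card_sum by (simp add: field_simps)
  then have "real (6 * (N + N')) = real ((CARD('n) + 1) * (CARD('n) + 2) * (CARD('n) + 3))"
    by (simp only: dm_def of_nat_mult of_nat_add of_nat_numeral of_nat_1)
  then have T: "6 * (N + N') = (CARD('n) + 1) * (CARD('n) + 2) * (CARD('n) + 3)" by linarith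
  have pos: "N > 0" "N' > 0" unfolding N_def N'_def by (rule card_spheres_pos)+
  have "gcd N N' \<le> N" using pos by (intro dvd_imp_le) auto
  then have lt: "gcd N N' < N + N'" using pos by linarith
  have "dm \<ge> 2" using n by (simp add: dm_def)
  then show False
  proof (rule integral_frequencies)
    fix Z :: "(real^'n) set" and u a b c
    assume fam: "moment_family_3 Z u dm a b c"
      and le1: "\<And>y. y \<in> {a, b, c} \<Longrightarrow> \<bar>y\<bar> \<le> 1"
      and int: "\<And>y. y \<in> {a, b, c} \<Longrightarrow>
        real (gcd (card (X \<inter> sphere 0 r)) (card (X \<inter> sphere 0 s))) * moment_family_3.freq Z u y \<in> \<int>"
    show False
      by (rule moment_family_3_not_integral[OF fam dm_def _ _ le1 T _ lt])
        (use n int in \<open>auto simp: N_def N'_def\<close>)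
  qed
qed

end

section \<open>The planar case\<close>

text \<open>As 5x is an odd multiple of pi, \<open>cos (3 * x) = - cos (2 * x)\<close>. The
  multiple-angle formulas turn this into a cubic in \<open>cos x\<close>, from which the root -1 is
  divided out.\<close>

lemma cos_pi_5_cubic:
  assumes "5 * x = pi \<or> 5 * x = 3 * pi" shows "4 * cos x ^ 2 - 2 * cos x - 1 = 0"
proof -
  have "0 \<le> x \<and> x < pi" using assms pi_gt_zero by (elim disjE) linarith+
  then have x0: "cos x > -1" using cos_monotone_0_pi[of x pi] by simp
  have "cos (3 * x) = - cos (2 * x)"
  proof (cases "5 * x = pi")
    case True
    then have "3 * x = pi - 2 * x" by simp
    then have "cos (3 * x) = cos (pi - 2 * x)" by (simp only:)
    then show ?thesis by (simp add: cos_diff)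
  next
    case False
    then have "3 * x = (pi - 2 * x) + 2 * pi" using assms by simp
    then have "cos (3 * x) = cos (pi - 2 * x)" by (simp only: cos_periodic)
    then show ?thesis by (simp add: cos_diff)
  qed
  then have "4 * cos x ^ 3 - 3 * cos x = - (2 * cos x ^ 2 - 1)"
    by (simp add: cos_treble_cos cos_double_cos)
  then have "(cos x + 1) * (4 * cos x ^ 2 - 2 * cos x - 1) = 0"
    by (simp add: algebra_simps power2_eq_square power3_eq_cube)
  then show ?thesis using x0 by auto
qed

lemma pentagon_cubic_roots:
  fixes t :: real
  assumes "4 * (t\<^sup>2 - 1 / 2) + 8 * (t^3 - 3 * t / 4) = 0"
  shows "t = cos pi \<or> t = cos (pi / 5) \<or> t = cos (3 * pi / 5)"
proof -
  define c1 c3 where "c1 = cos (pi / 5)" and "c3 = cos (3 * pi / 5)"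
  have e: "4 * c1\<^sup>2 - 2 * c1 - 1 = 0" "4 * c3\<^sup>2 - 2 * c3 - 1 = 0"
    unfolding c1_def c3_def by (rule cos_pi_5_cubic; simp)+
  have "c3 < c1" unfolding c1_def c3_def by (rule cos_monotone_0_pi) auto
  moreover have "(c1 - c3) * (4 * (c1 + c3) - 2) = 0" using e by algebra
  ultimately have s: "4 * (c1 + c3) = 2" by simp
  have "(t + 1) * (4 * t\<^sup>2 - 2 * t - 1) = 0" using assms by algebra
  then consider "t = -1" | "4 * t\<^sup>2 - 2 * t - 1 = 0" by auto
  then show ?thesis
  proof cases
    case 2
    have "(t - c1) * (t - c3) = 0" using 2 e s by algebra
    then show ?thesis by (auto simp: c1_def c3_def)
  qed simp
qed

lemma plane_polar:
  fixes z :: "real^'n"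
  assumes ab: "CARD('n) = 2" "a \<noteq> b" and z: "norm z = \<rho>" "z $ a = \<rho> * cos \<theta>"
  shows "z = axis a (\<rho> * cos \<theta>) + axis b (\<rho> * sin \<theta>) \<or> z = axis a (\<rho> * cos \<theta>) + axis b (\<rho> * sin (- \<theta>))"
proof -
  have U: "(UNIV :: 'n set) = {a, b}"
    using ab by (metis card_2_iff doubleton_eq_iff insertE singletonD UNIV_I)
  have "\<rho>\<^sup>2 = (z $ a)\<^sup>2 + (z $ b)\<^sup>2"
    using ab(2) unfolding z(1)[symmetric] power2_norm_eq_inner inner_vec_def U by (simp add: power2_eq_square)
  also have "(z $ a)\<^sup>2 = \<rho>\<^sup>2 - (\<rho> * sin \<theta>)\<^sup>2"
    unfolding z(2) using sin_cos_squared_add[of \<theta>] by algebra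
  finally have "(z $ b)\<^sup>2 = (\<rho> * sin \<theta>)\<^sup>2" by simp
  then have "z $ b = \<rho> * sin \<theta> \<or> z $ b = \<rho> * sin (- \<theta>)" by (auto simp: power2_eq_iff)
  moreover have "z = axis a (z $ a) + axis b (z $ b)"
  proof (rule vec_eq_iff[THEN iffD2], rule allI)
    fix i :: 'n
    have "i = a \<or> i = b" using U by auto
    then show "z $ i = (axis a (z $ a) + axis b (z $ b)) $ i" using ab(2) by (auto simp: axis_def)
  qed
  ultimately show ?thesis using z(2) by metis
qed

text \<open>The first coordinate fixes the point up to reflection in the axis. The indices 2, {5, 4}
  and {1, 3} arise by reducing the angles \<open>(2 * j + 1) * pi / 5\<close> modulo 2 pi.\<close>

lemma pentagon_point_1:
  fixes z :: "real^'n"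
  assumes ab: "CARD('n) = 2" "a \<noteq> b" and z: "norm z = r 1"
    and c: "z $ a = r 1 * t" "t = cos pi \<or> t = cos (pi / 5) \<or> t = cos (3 * pi / 5)"
  shows "z \<in> pentagon_point a b r 1 ` {1..5}"
proof -
  have p: "pentagon_point a b r 1 j = axis a (r 1 * cos \<theta>) + axis b (r 1 * sin \<theta>)"
    if "real (2 * j + 1) / 5 * pi = \<theta> \<or> real (2 * j + 1) / 5 * pi = \<theta> + 2 * pi" for j \<theta>
    using that unfolding pentagon_point_def by (metis cos_periodic sin_periodic)
  from c(2) consider "t = cos pi" | "t = cos (pi / 5)" | "t = cos (3 * pi / 5)" by blast
  then show ?thesis
  proof cases
    case 1
    then have "z = pentagon_point a b r 1 2"
      using plane_polar[OF ab z, of pi] c(1) p[of 2 pi] by simp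
    then show ?thesis by simp
  next
    case 2
    then have "z = pentagon_point a b r 1 5 \<or> z = pentagon_point a b r 1 4"
      using plane_polar[OF ab z, of "pi / 5"] c(1) p[of 5 "pi / 5"] p[of 4 "- (pi / 5)"] by simp
    then show ?thesis by auto
  next
    case 3
    then have "z = pentagon_point a b r 1 1 \<or> z = pentagon_point a b r 1 3"
      using plane_polar[OF ab z, of "3 * pi / 5"] c(1) p[of 1 "3 * pi / 5"] p[of 3 "- (3 * pi / 5)"] by simp
    then show ?thesis by auto
  qed
qed

text \<open>Here inner products are taken with \<open>pentagon_point a b r 1 2\<close>, which has
  angle pi; hence the minus sign and the shift of the angles by pi.\<close>

lemma pentagon_point_2:
  fixes z :: "real^'n"
  assumes ab: "CARD('n) = 2" "a \<noteq> b" and z: "norm z = r 2"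
    and c: "z $ a = - (r 2 * t)" "t = cos pi \<or> t = cos (pi / 5) \<or> t = cos (3 * pi / 5)"
  shows "z \<in> pentagon_point a b r 2 ` {1..5}"
proof -
  have p: "pentagon_point a b r 2 j = axis a (r 2 * cos \<theta>) + axis b (r 2 * sin \<theta>)"
    if "real (2 * j + 2) / 5 * pi = \<theta> \<or> real (2 * j + 2) / 5 * pi = \<theta> + 2 * pi" for j \<theta>
    using that unfolding pentagon_point_def by (metis cos_periodic sin_periodic)
  have cm: "- cos x = cos (pi - x)" for x :: real by (simp add: cos_diff)
  from c(2) consider "t = cos pi" | "t = cos (pi / 5)" | "t = cos (3 * pi / 5)" by blast
  then show ?thesis
  proof cases
    case 1
    then have "z = pentagon_point a b r 2 4"
      using plane_polar[OF ab z, of 0] c(1) p[of 4 0] by simp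
    then show ?thesis by simp
  next
    case 2
    have "z $ a = r 2 * cos (pi - pi / 5)" using c(1) 2 cm[of "pi / 5"] by (metis mult_minus_right)
    moreover have "pi - pi / 5 = 4 * pi / 5" by simp
    ultimately have "z $ a = r 2 * cos (4 * pi / 5)" by (simp only:)
    then have "z = pentagon_point a b r 2 1 \<or> z = pentagon_point a b r 2 2"
      using plane_polar[OF ab z, of "4 * pi / 5"] p[of 1 "4 * pi / 5"] p[of 2 "- (4 * pi / 5)"] by simp
    then show ?thesis by auto
  next
    case 3
    have "z $ a = r 2 * cos (pi - 3 * pi / 5)" using c(1) 3 cm[of "3 * pi / 5"] by (metis mult_minus_right)
    moreover have "pi - 3 * pi / 5 = 2 * pi / 5" by simp
    ultimately have "z $ a = r 2 * cos (2 * pi / 5)" by (simp only:)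
    then have "z = pentagon_point a b r 2 5 \<or> z = pentagon_point a b r 2 3"
      using plane_polar[OF ab z, of "2 * pi / 5"] p[of 5 "2 * pi / 5"] p[of 3 "- (2 * pi / 5)"] by simp
    then show ?thesis by auto
  qed
qed

text \<open>Three positive multiples of 1/2 cannot add up to 1.\<close>

lemma (in moment_family_3) not_half_integral:
  assumes "\<And>y. y \<in> {a, b, c} \<Longrightarrow> 2 * freq y \<in> \<int>" shows False
proof -
  have "2 * freq y \<ge> 1" if "y \<in> {a, b, c}" for y
  proof -
    have "2 * freq y \<in> \<int>" by (rule assms[OF that])
    then obtain m where m: "2 * freq y = of_int m" by (elim Ints_cases)
    then have "real_of_int m > 0" using freq_pos[OF that] by linarith
    then have "real_of_int m \<ge> 1" by simp
    then show ?thesis using m by simp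
  qed
  from this[of a] this[of b] this[of c] show False using freq_moments(1) by simp
qed

section \<open>Cardinalities, weights and the cubic in the plane\<close>

context tight_two_sphere_design
begin

text \<open>Shares of the first sphere in the harmonics of degree 2 and 3; in the plane both spaces
  have dimension 2.\<close>

definition "p2 = W r * r^4 / M2"
definition "p3 = W r * r^6 / M3"

context
  assumes planar: "CARD('n) = 2"
begin

lemma dm_eq_2: "dm = 2" by (simp add: dm_def planar)

lemma planar_card_r: "real (card (X \<inter> sphere 0 r)) = 3 + 2 * p2 + 2 * p3"
proof -
  obtain x where x: "x \<in> X" "norm x = r" by (rule sphere_nonempty)
  show ?thesis
    using card_r[OF x, folded p2_def p3_def] unfolding dm_eq_2 by simp
qed

lemma planar_card_bounds: "3 < card (X \<inter> sphere 0 r)" "card (X \<inter> sphere 0 r) < 7"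
proof -
  have "W r * r^4 < M2" "W r * r^6 < M3" using W_pos[of s] radii by (simp_all add: M2_def M3_def)
  then have "0 < p2" "p2 < 1" "0 < p3" "p3 < 1"
    using W_pos[of r] M_pos radii by (simp_all add: p2_def p3_def)
  then have "3 < real (card (X \<inter> sphere 0 r))" "real (card (X \<inter> sphere 0 r)) < 7"
    unfolding planar_card_r by linarith+
  then show "3 < card (X \<inter> sphere 0 r)" "card (X \<inter> sphere 0 r) < 7" by simp_all
qed

end

context
  assumes planar: "CARD('n) = 2"
begin

lemma planar_card: "card (X \<inter> sphere 0 r) = 5"
proof -
  let ?N = "card (X \<inter> sphere 0 r)" and ?N' = "card (X \<inter> sphere 0 s)"
  have "real ?N + real ?N' = 10" unfolding card_sum dm_eq_2[OF planar] by simp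
  then have sum: "?N + ?N' = 10" by linarith
  have not2: "gcd ?N ?N' \<noteq> 2"
  proof
    assume g: "gcd ?N ?N' = 2"
    have "dm \<ge> 2" by (simp add: dm_eq_2[OF planar])
    then show False
    proof (rule integral_frequencies)
      fix Z :: "(real^'n) set" and u a b c
      assume "moment_family_3 Z u dm a b c"
        and "\<And>y. y \<in> {a, b, c} \<Longrightarrow> real (gcd ?N ?N') * moment_family_3.freq Z u y \<in> \<int>"
      then show False using moment_family_3.not_half_integral unfolding g by fastforce
    qed
  qed
  have "?N \<noteq> 4"
  proof
    assume "?N = 4"
    moreover from this sum have "?N' = 6" by simp
    ultimately have "gcd ?N ?N' = gcd 4 6" by (simp only:)
    also have "gcd 4 6 = (2::nat)" by (simp add: gcd_nat.simps)
    finally show False using not2 by simp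
  qed
  moreover have "?N \<noteq> 6"
  proof
    assume "?N = 6"
    moreover from this sum have "?N' = 4" by simp
    ultimately have "gcd ?N ?N' = gcd 6 4" by (simp only:)
    also have "gcd 6 4 = (2::nat)" by (simp add: gcd_nat.simps)
    finally show False using not2 by simp
  qed
  ultimately show ?thesis using planar_card_bounds[OF planar] by linarith
qed

text \<open>Origin of the exponent 5 in the weights: five points force \<open>p2 + p3 = 1\<close>,
  and clearing denominators reduces this to an equality of two squares.\<close>

lemma planar_weight_relation: "W r * r^5 = W s * s^5"
proof -
  have pos: "W r > 0" "W s > 0" "M2 > 0" "M3 > 0" using W_pos M_pos by auto
  have "p2 + p3 = 1" using planar_card_r[OF planar] unfolding planar_card by linarith
  then have "W r * r^4 / M2 + W r * r^6 / M3 = 1" by (simp only: p2_def p3_def)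
  then have "W r * r^4 * M3 + W r * r^6 * M2 = M2 * M3" using pos by (simp add: field_simps)
  then have "(W r * r^5)\<^sup>2 = (W s * s^5)\<^sup>2" unfolding M2_def M3_def by algebra
  then show ?thesis using pos radii by (simp add: power2_eq_iff_nonneg)
qed

text \<open>The weight relation gives \<open>M3 = r * s * M2\<close>, so the coefficients of the
  cubic have ratio 2 whatever the radii are.\<close>

lemma planar_cross_root:
  assumes "cross_root t" shows "t = cos pi \<or> t = cos (pi / 5) \<or> t = cos (3 * pi / 5)"
proof (rule pentagon_cubic_roots)
  have M3: "M3 = r * s * M2"
    using planar_weight_relation unfolding M2_def M3_def by algebra
  have k: "\<kappa>3 * r * s = 8 / M2" "\<kappa>2 = 4 / M2"
    using M_pos(1) radii unfolding \<kappa>3_def \<kappa>2_def dm_eq_2[OF planar] M3 by simp_all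
  have "(4 * (t\<^sup>2 - 1 / 2) + 8 * (t^3 - 3 * t / 4)) / M2 = 0"
    using assms unfolding cross_root_def k dm_eq_2[OF planar] by (simp add: add_divide_distrib)
  then show "4 * (t\<^sup>2 - 1 / 2) + 8 * (t^3 - 3 * t / 4) = 0" using M_pos(1) by simp
qed

end

end

section \<open>Reconstruction of the two pentagons\<close>

context tight_two_sphere_design
begin

lemma planar_pentagons:
  fixes R :: "nat \<Rightarrow> real" and a b :: 'n
  assumes planar: "CARD('n) = 2" and R: "R 1 = r" "R 2 = s" and ab: "a \<noteq> b"
  shows "\<exists>(T :: real^'n \<Rightarrow> real^'n) c. orthogonal_transformation T \<and> 0 < c \<and>
    X = T ` {pentagon_point a b R k j | k j. k \<in> {1..2} \<and> j \<in> {1..5}} \<and>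
    (\<forall>k\<in>{1..2}. \<forall>j\<in>{1..5}. w (T (pentagon_point a b R k j)) = c * (1 / R k ^ 5))"
proof -
  let ?P = "pentagon_point a b R"
  obtain y where y: "y \<in> X" "norm y = s" by (rule tw.sphere_nonempty)
  \<comment> \<open>A point of the second sphere is rotated onto the positive \<open>a\<close>-axis;
    its inner products with the first sphere are then coordinates.\<close>
  have "norm (s *\<^sub>R axis a 1 :: real^'n) = norm y" using y radii by simp
  then obtain T :: "real^'n \<Rightarrow> real^'n" where T: "orthogonal_transformation T" "T (s *\<^sub>R axis a 1) = y"
    by (rule orthogonal_transformation_exists)
  have Tn: "norm (T z) = norm z" for z using T(1) by (rule orthogonal_transformation_norm)
  have Ti: "T u \<bullet> T v = u \<bullet> v" for u v using T(1) by (simp add: orthogonal_transformation_def)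
  have Tsurj: "\<exists>z'. z = T z'" for z using orthogonal_transformation_surj[OF T(1)] by (metis surjD)
  have root: "cross_root (x \<bullet> z / (r * s))" if "x \<in> X" "norm x = r" "z \<in> X" "norm z = s" for x z
    using cross_inner_root[OF that] by (simp add: cross_root_def)
  \<comment> \<open>Five points among at most five candidates: the inclusion is an equality.\<close>
  have eqI: "A = T ` (f ` {1..5::nat})" if "A \<subseteq> T ` (f ` {1..5})" "card A = 5" for A and f :: "nat \<Rightarrow> real^'n"
  proof (rule card_seteq[OF _ that(1)])
    have "card (T ` (f ` {1..5})) \<le> card {1..5::nat}"
      unfolding image_image by (rule card_image_le) simp
    then show "card (T ` (f ` {1..5})) \<le> card A" using that(2) by simp
  qed simp
  have "X \<inter> sphere 0 r \<subseteq> T ` (?P 1 ` {1..5})"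
  proof
    fix x assume x: "x \<in> X \<inter> sphere 0 r"
    obtain x' where x': "x = T x'" using Tsurj by blast
    have "x \<bullet> y = s * x' $ a" unfolding x' T(2)[symmetric] Ti by (simp add: inner_axis)
    then have "x' $ a = R 1 * (x \<bullet> y / (r * s))" using radii R by simp
    moreover have "norm x' = R 1" using x x' Tn R by simp
    moreover have "cross_root (x \<bullet> y / (r * s))" using x y by (intro root) auto
    ultimately have "x' \<in> ?P 1 ` {1..5}"
      using pentagon_point_1[OF planar ab] planar_cross_root[OF planar] by blast
    then show "x \<in> T ` (?P 1 ` {1..5})" unfolding x' by (rule imageI)
  qed
  then have Xr: "X \<inter> sphere 0 r = T ` (?P 1 ` {1..5})" by (rule eqI) (rule planar_card[OF planar])
  \<comment> \<open>This vertex lies on the \<open>a\<close>-axis and serves as reference point for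
    the second sphere, so both pentagons are located by the same \<open>T\<close>.\<close>
  have P12: "?P 1 2 = - (r *\<^sub>R axis a 1)"
    using R by (simp add: pentagon_point_def vec_eq_iff axis_def)
  have x0: "T (?P 1 2) \<in> X \<inter> sphere 0 r" unfolding Xr by (intro imageI) simp
  have "X \<inter> sphere 0 s \<subseteq> T ` (?P 2 ` {1..5})"
  proof
    fix z assume z: "z \<in> X \<inter> sphere 0 s"
    obtain z' where z': "z = T z'" using Tsurj by blast
    have "T (?P 1 2) \<bullet> z = - (r * z' $ a)" unfolding z' Ti P12 by (simp add: inner_axis')
    then have "z' $ a = - (R 2 * (T (?P 1 2) \<bullet> z / (r * s)))" using radii R by simp
    moreover have "norm z' = R 2" using z z' Tn R by simp
    moreover have "cross_root (T (?P 1 2) \<bullet> z / (r * s))" using z x0 by (intro root) auto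
    ultimately have "z' \<in> ?P 2 ` {1..5}"
      using pentagon_point_2[OF planar ab] planar_cross_root[OF planar] by blast
    then show "z \<in> T ` (?P 2 ` {1..5})" unfolding z' by (rule imageI)
  qed
  then have Xs: "X \<inter> sphere 0 s = T ` (?P 2 ` {1..5})" by (rule eqI) (rule tw.planar_card[OF planar])
  have X: "X = (X \<inter> sphere 0 r) \<union> (X \<inter> sphere 0 s)" using radii(1) by auto
  have "{1..2} = {1, 2::nat}" by auto
  then have P: "{?P k j | k j. k \<in> {1..2} \<and> j \<in> {1..5}} = ?P 1 ` {1..5} \<union> ?P 2 ` {1..5}"
    by (simp only:) blast
  define c where "c = W r * r^5 / 5"
  have cs: "c = W s * s^5 / 5" using planar_weight_relation[OF planar] by (simp add: c_def)
  have "w (T (?P k j)) = c * (1 / R k ^ 5)" if "k \<in> {1..2}" "j \<in> {1..5}" for k j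
  proof -
    from that(1) consider "k = 1" | "k = 2" by force
    then show ?thesis
    proof cases
      case 1
      have "T (?P 1 j) \<in> X \<inter> sphere 0 r" unfolding Xr using that by blast
      then have "w (T (?P 1 j)) = W r / 5" using weight_const(1) planar_card[OF planar] by simp
      then show ?thesis using radii R by (simp add: 1 c_def)
    next
      case 2
      have "T (?P 2 j) \<in> X \<inter> sphere 0 s" unfolding Xs using that by blast
      then have "w (T (?P 2 j)) = W s / 5" using tw.weight_const(1) tw.planar_card[OF planar] by simp
      then show ?thesis using radii R by (simp add: 2 cs)
    qed
  qed
  moreover have "X = T ` {?P k j | k j. k \<in> {1..2} \<and> j \<in> {1..5}}"
    unfolding P image_Un Xr[symmetric] Xs[symmetric] by (rule X)
  moreover have "0 < c" using W_pos[of r] radii by (simp add: c_def)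
  ultimately show ?thesis using T(1) by blast
qed

end

theorem theorem1p2:
  fixes X :: "(real^'n) set" and w :: "real^'n \<Rightarrow> real"
  assumes "2 \<le> CARD('n)" and "CARD('n) \<le> 8"
    and "tight_euclidean_design 3 X w"
    and "card (norm ` X) = 2"
  shows "CARD('n) = 2 \<and>
    (\<forall>(r :: nat \<Rightarrow> real) (a :: 'n) (b :: 'n). norm ` X = {r 1, r 2} \<and> a \<noteq> b \<longrightarrow>
       0 < r 1 \<and> 0 < r 2 \<and> r 1 \<noteq> r 2 \<and>
       (\<exists>(T :: real^'n \<Rightarrow> real^'n) (c :: real). orthogonal_transformation T \<and> 0 < c \<and>
          X = T ` {pentagon_point a b r k j | k j. k \<in> {1..2} \<and> j \<in> {1..5}} \<and>
          (\<forall>k\<in>{1..2}. \<forall>j\<in>{1..5}. w (T (pentagon_point a b r k j)) = c * (1 / r k ^ 5))))"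
proof -
  have loc: "tight_two_sphere_design X w r s" if R: "norm ` X = {r, s}" "r \<noteq> s" for r s
  proof -
    have "0 < r" by (rule tight_radii_pos[OF assms(3) R])
    moreover have "0 < s" by (rule tight_radii_pos[OF assms(3), of s r]) (use R in auto)
    ultimately show ?thesis
      using assms(3) R by unfold_locales (auto simp: tight_euclidean_design_def)
  qed
  obtain r s where rs: "norm ` X = {r, s}" "r \<noteq> s" using assms(4) by (auto simp: card_2_iff)
  have n: "CARD('n) = 2"
    using tight_two_sphere_design.dimension_not_3_to_8[OF loc[OF rs]] assms(1,2) by linarith
  have "0 < r 1 \<and> 0 < r 2 \<and> r 1 \<noteq> r 2 \<and>
       (\<exists>(T :: real^'n \<Rightarrow> real^'n) (c :: real). orthogonal_transformation T \<and> 0 < c \<and>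
          X = T ` {pentagon_point a b r k j | k j. k \<in> {1..2} \<and> j \<in> {1..5}} \<and>
          (\<forall>k\<in>{1..2}. \<forall>j\<in>{1..5}. w (T (pentagon_point a b r k j)) = c * (1 / r k ^ 5)))"
    if R: "norm ` X = {r 1, r 2}" and ab: "a \<noteq> b" for r :: "nat \<Rightarrow> real" and a b :: 'n
  proof -
    have ne: "r 1 \<noteq> r 2" using R assms(4) by auto
    interpret tight_two_sphere_design X w "r 1" "r 2" by (rule loc[OF R ne])
    show ?thesis using radii planar_pentagons[OF n refl refl ab] by blast
  qed
  then show ?thesis using n by blast
qed

end
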